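(* Let $\Phi$ be a finite (not necessarily crystallographic) root system in a Euclidean space $(V,\langle\cdot,\cdot\rangle)$. Then for every circuit $C\subset\Phi$, the acuteness graph $\Gamma_C$ is disconnected.
   Context: Let $(V,\langle\cdot,\cdot\rangle)$ be a finite-dimensional real Euclidean space. For $0\neq\alpha\in V$ let $s_\alpha(v)=v-\frac{2\langle v,\alpha\rangle}{|\alpha|^2}\alpha$. A finite (reduced, not necessarily crystallographic) root system is a finite set $\Phi\subset V$ of nonzero vectors such that $s_\alpha(\beta)\in\Phi$ for all $\alpha,\beta\in\Phi$ and $\Phi\cap\mathbb{R}\alpha=\{\pm\alpha\}$ for all $\alpha\in\Phi$; it is also assumed that the group generated by $\{s_\alpha:\alpha\in\Phi\}$ fixes no nonzero vector of $V$. A finite subset $C=\{\alpha_1,\ldots,\alpha_m\}\subset V$ (with $m$ distinct elements) is a circuit (minimal dependence) if it is linearly dependent but no proper subset of it is linearly dependent. Then there are coefficients $c_1,\ldots,c_m\in\mathbb{R}$, all nonzero, unique up to simultaneous scaling by a nonzero real number, with $\sum_{i=1}^m c_i\alpha_i=0$. The acuteness graph $\Gamma_C$ is the graph with vertex set $\{1,2,\ldots,m\}$ and an edge $\{i,j\}$ ($i\neq j$) whenever $\langle c_i\alpha_i,c_j\alpha_j\rangle>0$. *)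

theory Defs
  imports
    "HOL-Analysis.Analysis"
    "HOL-Algebra.Bij"
    "HOL-Algebra.Generated_Groups"
    "Graph_Theory.Digraph_Component"
begin

definition reflection :: "'a::euclidean_space \<Rightarrow> 'a \<Rightarrow> 'a" where
  "reflection \<alpha> v = v - (2 * (v \<bullet> \<alpha>) / (norm \<alpha>)\<^sup>2) *\<^sub>R \<alpha>"

text \<open>The group generated by the reflections, as a set of permutations of the whole space.\<close>

definition reflection_group :: "'a::euclidean_space set \<Rightarrow> ('a \<Rightarrow> 'a) set" where
  "reflection_group \<Phi> = generate (BijGroup UNIV) (reflection ` \<Phi>)"

definition root_system :: "'a::euclidean_space set \<Rightarrow> bool" where
  "root_system \<Phi> \<longleftrightarrow>
     finite \<Phi> \<and>
     0 \<notin> \<Phi> \<and>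
     (\<forall>\<alpha>\<in>\<Phi>. \<forall>\<beta>\<in>\<Phi>. reflection \<alpha> \<beta> \<in> \<Phi>) \<and>
     (\<forall>\<alpha>\<in>\<Phi>. \<Phi> \<inter> range (\<lambda>t::real. t *\<^sub>R \<alpha>) = {\<alpha>, - \<alpha>}) \<and>
     (\<forall>v. (\<forall>g\<in>reflection_group \<Phi>. g v = v) \<longrightarrow> v = 0)"

definition circuit :: "'a::euclidean_space set \<Rightarrow> bool" where
  "circuit C \<longleftrightarrow> finite C \<and> dependent C \<and> (\<forall>D. D \<subset> C \<longrightarrow> independent D)"

text \<open>Each undirected edge is encoded as the two opposite arcs.\<close>

definition acuteness_graph ::
  "nat \<Rightarrow> (nat \<Rightarrow> 'a::euclidean_space) \<Rightarrow> (nat \<Rightarrow> real) \<Rightarrow> nat pair_pre_digraph" where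
  "acuteness_graph m \<alpha> c =
     \<lparr> pverts = {1..m},
       parcs = {(i, j). i \<in> {1..m} \<and> j \<in> {1..m} \<and> i \<noteq> j \<and>
                        (c i *\<^sub>R \<alpha> i) \<bullet> (c j *\<^sub>R \<alpha> j) > 0} \<rparr>"

text \<open>
  The reflections in nonzero vectors do lie in the ambient permutation group.
\<close>

lemma reflection_reflection:
  assumes "\<alpha> \<noteq> 0"
  shows "reflection \<alpha> (reflection \<alpha> v) = v"
proof -
  have "(v - (2 * (v \<bullet> \<alpha>) / (norm \<alpha>)\<^sup>2) *\<^sub>R \<alpha>) \<bullet> \<alpha> = - (v \<bullet> \<alpha>)"
    using assms by (simp add: inner_diff_left dot_square_norm)
  then show ?thesis
    by (simp add: reflection_def)
qed

lemma reflection_in_BijGroup: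
  assumes "\<alpha> \<noteq> 0"
  shows "reflection \<alpha> \<in> carrier (BijGroup UNIV)"
proof -
  have "bij (reflection \<alpha>)"
    by (rule o_bij[of "reflection \<alpha>"]) (auto simp: reflection_reflection[OF assms])
  then show ?thesis
    by (simp add: BijGroup_def Bij_def)
qed

text \<open>
  The coefficients of a circuit exist, and are unique up to a nonzero factor, so that the
  acuteness graph does not depend on which of them are used.
\<close>

lemma circuit_coefficients_exist:
  assumes "circuit C" "inj_on \<alpha> {1..m}" "C = \<alpha> ` {1..m::nat}"
  obtains c :: "nat \<Rightarrow> real"
  where "\<forall>i\<in>{1..m}. c i \<noteq> 0" "(\<Sum>i=1..m. c i *\<^sub>R \<alpha> i) = 0"
proof -
  have fin: "finite C" and dep: "dependent C"
    and ind: "\<And>D. D \<subset> C \<Longrightarrow> independent D"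
    using assms(1) by (auto simp: circuit_def)
  obtain u where u: "\<exists>v\<in>C. u v \<noteq> 0" "(\<Sum>v\<in>C. u v *\<^sub>R v) = 0"
    using dep by (auto simp: dependent_finite[OF fin])
  have nz: "u w \<noteq> 0" if w: "w \<in> C" for w
  proof
    assume 0: "u w = 0"
    then have "(\<Sum>v\<in>C - {w}. u v *\<^sub>R v) = 0"
      using u(2) sum.remove[OF fin w, of "\<lambda>v. u v *\<^sub>R v"] by simp
    moreover have "\<exists>v\<in>C - {w}. u v \<noteq> 0"
      using u(1) 0 by auto
    ultimately have "dependent (C - {w})"
      using fin by (subst dependent_finite) auto
    then show False
      using ind[of "C - {w}"] w by auto
  qed
  have "(\<Sum>i=1..m. u (\<alpha> i) *\<^sub>R \<alpha> i) = 0"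
    using u(2) assms by (simp add: sum.reindex)
  then show thesis
    using that[of "u \<circ> \<alpha>"] nz assms(3) by auto
qed

lemma circuit_coefficients_unique:
  assumes "circuit C" "inj_on \<alpha> {1..m}" "C = \<alpha> ` {1..m::nat}"
    and c: "\<forall>i\<in>{1..m}. c i \<noteq> 0" "(\<Sum>i=1..m. c i *\<^sub>R \<alpha> i) = 0"
    and d: "\<forall>i\<in>{1..m}. d i \<noteq> 0" "(\<Sum>i=1..m. d i *\<^sub>R \<alpha> i) = 0"
  obtains t :: real where "t \<noteq> 0" "\<forall>i\<in>{1..m}. d i = t * c i"
proof (cases "m = 0")
  case True
  then show thesis using that[of 1] by simp
next
  case False
  then have 1: "1 \<in> {1..m}" by auto
  define t where "t = d 1 / c 1"
  define e where "e i = d i - t * c i" for i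
  let ?D = "\<alpha> ` ({1..m} - {1})"
  have e1: "e 1 = 0"
    using c(1) 1 by (simp add: e_def t_def)
  have "(\<Sum>i=1..m. e i *\<^sub>R \<alpha> i) = (\<Sum>i=1..m. d i *\<^sub>R \<alpha> i) - t *\<^sub>R (\<Sum>i=1..m. c i *\<^sub>R \<alpha> i)"
    by (simp add: e_def scaleR_diff_left sum_subtractf scaleR_sum_right)
  then have "(\<Sum>i\<in>{1..m} - {1}. e i *\<^sub>R \<alpha> i) = 0"
    using c(2) d(2) e1 sum.remove[of "{1..m}" 1 "\<lambda>i. e i *\<^sub>R \<alpha> i"] 1 by simp
  moreover have inj: "inj_on \<alpha> ({1..m} - {1})"
    using assms(2) by (rule inj_on_subset) auto
  ultimately have s: "(\<Sum>v\<in>?D. e (the_inv_into ({1..m} - {1}) \<alpha> v) *\<^sub>R v) = 0"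
    by (simp add: sum.reindex the_inv_into_f_f)
  have "?D \<subset> C"
    using inj_on_image_mem_iff[OF assms(2) 1, of "{1..m} - {1}"] assms(3) 1 by blast
  then have "independent ?D"
    using assms(1) by (simp add: circuit_def)
  then have z: "e (the_inv_into ({1..m} - {1}) \<alpha> v) = 0" if "v \<in> ?D" for v
    using s that by (subst (asm) dependent_finite) auto
  have "e i = 0" if "i \<in> {1..m} - {1}" for i
    using z[of "\<alpha> i"] that the_inv_into_f_f[OF inj that] by auto
  then have "\<forall>i\<in>{1..m}. d i = t * c i"
    using e1 by (metis Diff_iff e_def eq_iff_diff_eq_0 singletonD)
  moreover have "t \<noteq> 0"
    using c(1) d(1) 1 by (simp add: t_def)
  ultimately show thesis using that by blast
qed

lemma acuteness_graph_scale:
  assumes "t \<noteq> 0" "\<forall>i\<in>{1..m}. d i = t * c i"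
  shows "acuteness_graph m \<alpha> d = acuteness_graph m \<alpha> c"
proof -
  have "(d i *\<^sub>R \<alpha> i) \<bullet> (d j *\<^sub>R \<alpha> j) > 0 \<longleftrightarrow> (c i *\<^sub>R \<alpha> i) \<bullet> (c j *\<^sub>R \<alpha> j) > 0"
    if "i \<in> {1..m}" "j \<in> {1..m}" for i j
  proof -
    have "(d i *\<^sub>R \<alpha> i) \<bullet> (d j *\<^sub>R \<alpha> j) = t\<^sup>2 * ((c i *\<^sub>R \<alpha> i) \<bullet> (c j *\<^sub>R \<alpha> j))"
      using assms(2) that by (simp add: power2_eq_square)
    then show ?thesis
      using assms(1) by (simp only: zero_less_mult_iff) (auto simp: not_less)
  qed
  then show ?thesis
    by (auto simp: acuteness_graph_def)
qed

end

theory Submission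
  imports Defs
begin

text \<open>
  Replace each \<open>\<alpha>\<^sub>i\<close> by the positive multiple \<open>a\<^sub>i\<close> of \<open>c\<^sub>i \<alpha>\<^sub>i\<close> of square length two. The circuit becomes
  a family of roots whose only linear relation, up to a factor, has positive coefficients, and the
  acuteness graph joins the pairs with \<open>a\<^sub>i \<bullet> a\<^sub>j > 0\<close>. Pairing the relation with \<open>a\<^sub>b\<close> shows that
  no vertex \<open>b\<close> is joined to all others (\<open>no_dominating_vertex\<close>). The proof therefore assumes that
  the graph is connected and looks for a dominating vertex.

  For a crystallographic root system this works directly (\<open>crystallographic_circuit_disconnected\<close>).
  The relation then has coprime integer coefficients \<open>c\<^sub>i\<close>, with sum \<open>k\<close> say, and there are vectors
  \<open>x\<close> whose products with all \<open>a\<^sub>i\<close> are congruent to \<open>1/k\<close> modulo \<open>\<int>\<close>. Take \<open>x\<close> as short as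
  possible. Since a shift by a coroot preserves the congruences, no root has a product above \<open>1\<close>
  with \<open>x\<close>, so every \<open>a\<^sub>i \<bullet> x\<close> is \<open>1/k\<close> or \<open>1/k - 1\<close>. The relation forces the second value to occur
  exactly once, at a vertex \<open>b\<close> with \<open>c\<^sub>b = 1\<close>, and for every neighbour \<open>i\<close> of \<open>b\<close> the root
  \<open>a\<^sub>i - a\<^sub>b\<close> is orthogonal to all other \<open>a\<^sub>l\<close>. Hence \<open>b\<close> and \<open>i\<close> have the same neighbours, and in a
  connected graph \<open>b\<close> dominates.

  In general, consider the root system in the span of the circuit, and a simple system of it. Its
  Coxeter diagram is connected because the graph is. In rank at least three the angles between
  simple roots are those with labels 2 to 5; label 5 means that the product of the two roots is
  \<open>- \<phi>\<close> for the golden ratio \<open>\<phi>\<close>. Without label 5 the roots can be rescaled to a crystallographic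
  system (\<open>crystallographic_lengths\<close>), because the diagram is a tree; rescaling changes neither the
  shape of the relation nor the graph. With label 5 the diagram is \<open>H\<^sub>3\<close> or \<open>H\<^sub>4\<close>
  (\<open>golden_diagram\<close>), so that the circuit has four or five vectors, and Galois conjugation in
  \<open>\<rat>(\<phi>)\<close> restricts their products to \<open>0, \<plusminus>1, \<plusminus>\<phi>, \<plusminus>(\<phi> - 1)\<close> (\<open>golden_inner_products\<close>). Here the
  vertex \<open>u\<close> with the largest coefficient has a vertex \<open>v\<close> at distance at least three, and the
  remaining configurations are excluded one by one with the triangle inequality for angles and
  linear estimates of the relation (\<open>golden_circuit_disconnected\<close>).
\<close>

section \<open>Circuits of crystallographic root systems\<close>

lemma reflection_inner: "reflection q v = v - (2 * (v \<bullet> q) / (q \<bullet> q)) *\<^sub>R q"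
  by (simp add: reflection_def power2_norm_eq_inner)

definition acute_connected :: "'i set \<Rightarrow> ('i \<Rightarrow> 'a::euclidean_space) \<Rightarrow> bool" where
  "acute_connected I a \<longleftrightarrow>
     (\<forall>X. X \<subseteq> I \<and> X \<noteq> {} \<and> X \<noteq> I \<longrightarrow> (\<exists>i\<in>X. \<exists>j\<in>I - X. a i \<bullet> a j > 0))"

text \<open>The product of \<open>a b\<close> with the relation would be a sum of positive terms.\<close>

lemma no_dominating_vertex:
  assumes "finite I" "b \<in> I" "\<And>i. i \<in> I \<Longrightarrow> c i > 0" "(\<Sum>i\<in>I. c i *\<^sub>R a i) = 0"
    and "\<And>i. i \<in> I \<Longrightarrow> a b \<bullet> a i > 0"
  shows False
proof -
  have "0 = a b \<bullet> (\<Sum>i\<in>I. c i *\<^sub>R a i)"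
    using assms(4) by simp
  also have "\<dots> = (\<Sum>i\<in>I. c i * (a b \<bullet> a i))"
    by (simp add: inner_sum_right)
  also have "\<dots> > 0"
    using assms by (intro sum_pos) auto
  finally show False by simp
qed

text \<open>The vectors in question which are no longer than \<open>x0\<close> are determined by their values
  on the \<open>a i\<close>, and these lie in finitely many bounded sets of the form \<open>e + \<int>\<close>. So a shortest
  one exists.\<close>

lemma minimal_functional:
  fixes a :: "'i \<Rightarrow> 'a::euclidean_space"
  assumes "finite I" "x0 \<in> span (a ` I)" "\<And>i. i \<in> I \<Longrightarrow> a i \<bullet> x0 - e \<in> \<int>"
  obtains x where "x \<in> span (a ` I)" "\<And>i. i \<in> I \<Longrightarrow> a i \<bullet> x - e \<in> \<int>"
    "\<And>y. y \<in> span (a ` I) \<Longrightarrow> (\<And>i. i \<in> I \<Longrightarrow> a i \<bullet> y - e \<in> \<int>) \<Longrightarrow> norm x \<le> norm y"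
proof -
  define X where "X = {x \<in> span (a ` I). (\<forall>i\<in>I. a i \<bullet> x - e \<in> \<int>) \<and> norm x \<le> norm x0}"
  define F where "F x = (\<lambda>i\<in>I. a i \<bullet> x - e)" for x
  define B where "B i = \<int> \<inter> {- (norm (a i) * norm x0 + \<bar>e\<bar>) .. norm (a i) * norm x0 + \<bar>e\<bar>}" for i
  have "inj_on F X"
  proof (rule inj_onI)
    fix x y assume xy: "x \<in> X" "y \<in> X" "F x = F y"
    have "a i \<bullet> (x - y) = 0" if "i \<in> I" for i
      using fun_cong[OF xy(3), of i] that by (simp add: F_def inner_diff_right)
    then have "\<And>v. v \<in> a ` I \<Longrightarrow> (x - y) \<bullet> v = 0"
      by (auto simp: inner_commute)
    moreover have "x - y \<in> span (a ` I)"
      using xy by (auto simp: X_def span_diff)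
    ultimately have "(x - y) \<bullet> (x - y) = 0"
      by (metis orthogonal_def orthogonal_to_span)
    then show "x = y" by simp
  qed
  moreover have "F ` X \<subseteq> PiE I B"
  proof -
    have "\<bar>a i \<bullet> x - e\<bar> \<le> norm (a i) * norm x0 + \<bar>e\<bar>" if "x \<in> X" for x i
    proof -
      have "\<bar>a i \<bullet> x\<bar> \<le> norm (a i) * norm x" by (rule Cauchy_Schwarz_ineq2)
      also have "\<dots> \<le> norm (a i) * norm x0"
        using that by (auto simp: X_def intro: mult_left_mono)
      finally show ?thesis by linarith
    qed
    then have "F x i \<in> B i" if "x \<in> X" "i \<in> I" for x i
      using that unfolding F_def B_def abs_le_iff
      by (auto simp: X_def) (smt (verit))+
    then show ?thesis
      by (auto simp: F_def)
  qed
  moreover have "finite (PiE I B)"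
    using assms(1) finite_int_segment unfolding B_def
    by (intro finite_PiE) (auto simp: Int_def)
  ultimately have "finite X"
    by (metis finite_imageD finite_subset)
  moreover have "x0 \<in> X"
    using assms by (auto simp: X_def)
  ultimately have am: "is_arg_min norm (\<lambda>x. x \<in> X) (arg_min_on norm X)"
    unfolding arg_min_on_def is_arg_min_def[symmetric]
    by (metis arg_min_if_finite(1) arg_min_if_finite(2) arg_min_on_def empty_iff is_arg_min_def)
  define x where "x = arg_min_on norm X"
  have x: "x \<in> X" "\<And>y. y \<in> X \<Longrightarrow> norm x \<le> norm y"
    using am by (auto simp: x_def is_arg_min_linorder)
  show thesis
  proof (rule that[of x])
    show "norm x \<le> norm y" if "y \<in> span (a ` I)" "\<And>i. i \<in> I \<Longrightarrow> a i \<bullet> y - e \<in> \<int>" for y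
      using x that by (cases "norm y \<le> norm x0") (auto simp: X_def)
  qed (use x in \<open>auto simp: X_def\<close>)
qed

lemma bezout_primitive:
  fixes c :: "'i \<Rightarrow> int"
  assumes "finite I" "I \<noteq> {}" "\<And>i. i \<in> I \<Longrightarrow> c i > 0"
    and prim: "\<And>g. g > 0 \<Longrightarrow> (\<And>i. i \<in> I \<Longrightarrow> g dvd c i) \<Longrightarrow> g = 1"
  obtains m where "(\<Sum>i\<in>I. c i * m i) = 1"
proof -
  define P where "P n \<longleftrightarrow> n > 0 \<and> (\<exists>m. (\<Sum>i\<in>I. c i * m i) = int n)" for n :: nat
  have sgl: "(\<Sum>i\<in>I. c i * (if i = j then 1 else 0)) = c j" if "j \<in> I" for j
    using assms(1) that by (simp add: if_distrib sum.delta cong: if_cong)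
  obtain i0 where i0: "i0 \<in> I" using assms(2) by auto
  have "P (nat (c i0))"
    unfolding P_def using assms(3)[OF i0] sgl[OF i0]
    by (auto intro!: exI[of _ "\<lambda>i. if i = i0 then 1 else 0"])
  then have "\<exists>n. P n" by blast
  define g where "g = (LEAST n. P n)"
  have g: "P g" "\<And>n. P n \<Longrightarrow> g \<le> n"
    unfolding g_def using LeastI_ex[OF \<open>\<exists>n. P n\<close>] Least_le[of P] by blast+
  have gp: "g > 0" and "\<exists>m. (\<Sum>i\<in>I. c i * m i) = int g"
    using g(1) by (simp_all only: P_def)
  then obtain m where m: "(\<Sum>i\<in>I. c i * m i) = int g" by metis
  have "int g dvd c j" if j: "j \<in> I" for j
  proof (rule ccontr)
    assume nd: "\<not> int g dvd c j"
    define q where "q = c j div int g"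
    define r where "r = c j mod int g"
    have r: "0 < r" "r < int g"
      using nd gp pos_mod_sign[of "int g" "c j"] pos_mod_bound[of "int g" "c j"]
      unfolding r_def dvd_eq_mod_eq_0 by linarith+
    have "(\<Sum>i\<in>I. c i * ((if i = j then 1 else 0) - q * m i)) = c j - q * int g"
      using sgl[OF j] m
      by (simp add: right_diff_distrib sum_subtractf mult.left_commute sum_distrib_left[symmetric])
    also have "\<dots> = r"
      by (simp add: q_def r_def minus_div_mult_eq_mod)
    finally have "P (nat r)"
      using r unfolding P_def by auto
    then show False
      using g(2)[of "nat r"] r by linarith
  qed
  then have "int g = 1"
    using prim[of "int g"] gp by auto
  then show thesis using m that by auto
qed

text \<open>The relations between the vectors are exactly the multiples of \<open>c\<close>.\<close>

definition only_relation :: "'i set \<Rightarrow> ('i \<Rightarrow> 'a::real_vector) \<Rightarrow> ('i \<Rightarrow> real) \<Rightarrow> bool" where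
  "only_relation I a c \<longleftrightarrow> (\<Sum>i\<in>I. c i *\<^sub>R a i) = 0 \<and>
     (\<forall>d. (\<Sum>i\<in>I. d i *\<^sub>R a i) = 0 \<longrightarrow> (\<exists>t. \<forall>i\<in>I. d i = t * c i))"

lemma only_relation_independent:
  assumes fin: "finite I" and rel: "only_relation I a c" and pos: "\<And>i. i \<in> I \<Longrightarrow> c i > 0" and i0: "i0 \<in> I"
  shows "inj_on a (I - {i0})" "independent (a ` (I - {i0}))"
proof -
  have uniq: "\<forall>i\<in>I. d i = 0" if "(\<Sum>i\<in>I. d i *\<^sub>R a i) = 0" "d i0 = 0" for d
    using rel that pos[OF i0] i0 unfolding only_relation_def
    by (metis less_irrefl mult_eq_0_iff mult_zero_left)
  show inj: "inj_on a (I - {i0})"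
  proof (rule inj_onI, rule ccontr)
    fix i j assume ij: "i \<in> I - {i0}" "j \<in> I - {i0}" "a i = a j" "i \<noteq> j"
    let ?d = "\<lambda>k. (if k = i then 1 else 0) - (if k = j then 1 else 0 :: real)"
    have "(\<Sum>k\<in>I. ?d k *\<^sub>R a k) = a i - a j"
      using ij fin by (simp add: scaleR_diff_left sum_subtractf if_distrib[of "\<lambda>t. t *\<^sub>R _"] sum.delta cong: if_cong)
    then have "\<forall>k\<in>I. ?d k = 0"
      using ij by (intro uniq) auto
    then show False using ij by (auto dest!: bspec[of _ _ i])
  qed
  show "independent (a ` (I - {i0}))"
  proof
    assume "dependent (a ` (I - {i0}))"
    then obtain u i where u: "(\<Sum>v\<in>a ` (I - {i0}). u v *\<^sub>R v) = 0" and i: "i \<in> I" "u (a i) \<noteq> 0" "i \<noteq> i0"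
      using fin by (auto simp: dependent_finite)
    let ?d = "\<lambda>k. if k = i0 then 0 else u (a k)"
    have "(\<Sum>k\<in>I. ?d k *\<^sub>R a k) = (\<Sum>k\<in>I - {i0}. u (a k) *\<^sub>R a k)"
      using fin i0 by (subst sum.remove[of I i0]) (auto intro: sum.cong)
    also have "\<dots> = 0"
      using u inj by (simp add: sum.reindex)
    finally have "\<forall>k\<in>I. ?d k = 0"
      by (intro uniq) auto
    then show False using i by auto
  qed
qed

text \<open>The relation is the only obstruction to prescribing the values of a functional on the \<open>a i\<close>.\<close>

lemma inner_prescribed:
  fixes a :: "'i \<Rightarrow> 'a::euclidean_space"
  assumes fin: "finite I" and rel: "only_relation I a c" and pos: "\<And>i. i \<in> I \<Longrightarrow> c i > 0"
    and ne: "I \<noteq> {}" and w: "(\<Sum>i\<in>I. c i * w i) = 0"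
  obtains x where "x \<in> span (a ` I)" "\<And>i. i \<in> I \<Longrightarrow> a i \<bullet> x = w i"
proof -
  obtain i0 where i0: "i0 \<in> I" using ne by auto
  note ind = only_relation_independent[OF fin rel pos i0]
  define J where "J = I - {i0}"
  obtain f :: "'a \<Rightarrow> real" where f: "linear f" "\<forall>v\<in>a ` J. f v = w (the_inv_into J a v)"
    using linear_independent_extend[of "a ` J" "\<lambda>v. w (the_inv_into J a v)"] ind unfolding J_def by blast
  have fw: "f (a i) = w i" if "i \<in> J" for i
    using f(2) ind(1) that by (simp add: J_def the_inv_into_f_f)
  obtain y z where yz: "y \<in> span (a ` I)" "\<And>v. v \<in> span (a ` I) \<Longrightarrow> orthogonal z v" "adjoint f 1 = y + z"
    using orthogonal_subspace_decomp_exists[of "a ` I" "adjoint f 1"] by metis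
  have y: "v \<bullet> y = f v" if "v \<in> span (a ` I)" for v
  proof -
    have "v \<bullet> y = v \<bullet> adjoint f 1"
      using yz that by (simp add: inner_add_right orthogonal_def inner_commute)
    also have "\<dots> = f v"
      using adjoint_works[OF f(1), of v 1] by simp
    finally show ?thesis .
  qed
  have yJ: "a i \<bullet> y = w i" if "i \<in> J" for i
    using y[of "a i"] fw[OF that] that by (simp add: J_def span_base)
  have "0 = (\<Sum>i\<in>I. c i *\<^sub>R a i) \<bullet> y"
    using rel by (simp add: only_relation_def)
  also have "\<dots> = (\<Sum>i\<in>I. c i * (a i \<bullet> y))"
    by (simp add: inner_sum_left)
  also have "\<dots> = c i0 * (a i0 \<bullet> y) + (\<Sum>i\<in>J. c i * w i)"
    using yJ by (simp add: J_def sum.remove[OF fin i0])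
  also have "(\<Sum>i\<in>J. c i * w i) = - (c i0 * w i0)"
    using w by (simp add: J_def sum.remove[OF fin i0])
  finally have "a i0 \<bullet> y = w i0"
    using pos[OF i0] by (simp add: algebra_simps)
  then show thesis
    using that[of y] yz yJ by (auto simp: J_def)
qed

text \<open>The shortest vector \<open>x\<close> with the prescribed values modulo \<open>\<int>\<close> plays the role of a point of
  the fundamental alcove: the roots take values at most \<open>1\<close> on it. The sum of the coefficients
  where \<open>x\<close> takes a negative value is \<open>1\<close>, which singles out one vertex \<open>b\<close>.\<close>

lemma crystallographic_circuit_disconnected:
  fixes P :: "'a::euclidean_space set" and a :: "'i \<Rightarrow> 'a" and c :: "'i \<Rightarrow> int"
  assumes fin: "finite I" and card: "card I \<ge> 2"
    and P: "0 \<notin> P" "\<And>p q. p \<in> P \<Longrightarrow> q \<in> P \<Longrightarrow> reflection q p \<in> P"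
    and cartan: "\<And>p q. p \<in> P \<Longrightarrow> q \<in> P \<Longrightarrow> 2 * (p \<bullet> q) / (q \<bullet> q) \<in> \<int>"
    and a: "\<And>i. i \<in> I \<Longrightarrow> a i \<in> P" and pos: "\<And>i. i \<in> I \<Longrightarrow> c i > 0"
    and rel: "only_relation I a (\<lambda>i. of_int (c i))"
    and prim: "\<And>g. g > 0 \<Longrightarrow> (\<And>i. i \<in> I \<Longrightarrow> g dvd c i) \<Longrightarrow> g = 1"
  shows "\<not> acute_connected I a"
proof
  assume conn: "acute_connected I a"
  have ne: "I \<noteq> {}" using card by auto
  have posr: "\<And>i. i \<in> I \<Longrightarrow> real_of_int (c i) > 0" using pos by simp
  have rel0: "(\<Sum>i\<in>I. of_int (c i) *\<^sub>R a i) = 0"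
    using rel by (simp add: only_relation_def)
  define k where "k = (\<Sum>i\<in>I. c i)"
  \<comment> \<open>With this value the numbers \<open>e - m i\<close> below satisfy the relation.\<close>
  define e where "e = 1 / real_of_int k"
  have "(\<Sum>i\<in>I. 1) \<le> k"
    unfolding k_def using pos by (intro sum_mono) (force simp: int_one_le_iff_zero_less)
  then have k2: "k \<ge> 2" using card by simp
  then have e: "0 < e" "e < 1" "k * e = 1" by (auto simp: e_def)
  obtain m where m: "(\<Sum>i\<in>I. c i * m i) = 1"
    by (rule bezout_primitive[of I c]) (use fin ne pos prim in auto)
  have "(\<Sum>i\<in>I. of_int (c i) * (e - of_int (m i))) = k * e - of_int (\<Sum>i\<in>I. c i * m i)"
    by (simp add: k_def right_diff_distrib sum_subtractf sum_distrib_right)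
  also have "\<dots> = 0" using e m by simp
  finally obtain x0 where x0: "x0 \<in> span (a ` I)" "\<And>i. i \<in> I \<Longrightarrow> a i \<bullet> x0 = e - of_int (m i)"
    using inner_prescribed[OF fin rel _ ne, of "\<lambda>i. e - of_int (m i)"] pos by auto
  obtain x where x: "x \<in> span (a ` I)" "\<And>i. i \<in> I \<Longrightarrow> a i \<bullet> x - e \<in> \<int>"
    and min: "\<And>y. y \<in> span (a ` I) \<Longrightarrow> (\<And>i. i \<in> I \<Longrightarrow> a i \<bullet> y - e \<in> \<int>) \<Longrightarrow> norm x \<le> norm y"
    by (rule minimal_functional[OF fin x0(1), of e]) (auto simp: x0)
  \<comment> \<open>Shifting \<open>x\<close> by the coroot of \<open>q\<close> does not shorten it.\<close>
  have le1: "q \<bullet> x \<le> 1" if q: "q \<in> P" "q \<in> span (a ` I)" for q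
  proof -
    have qq: "q \<bullet> q > 0" using q P(1) by auto
    let ?y = "x - (2 / (q \<bullet> q)) *\<^sub>R q"
    have "norm x \<le> norm ?y"
    proof (rule min)
      show "?y \<in> span (a ` I)" using x(1) q by (simp add: span_diff span_scale)
      fix i assume i: "i \<in> I"
      have "a i \<bullet> ?y - e = (a i \<bullet> x - e) - 2 * (a i \<bullet> q) / (q \<bullet> q)"
        by (simp add: inner_diff_right)
      then show "a i \<bullet> ?y - e \<in> \<int>"
        using x(2)[OF i] cartan[OF a[OF i] q(1)] by (metis Ints_diff)
    qed
    then have "x \<bullet> x \<le> ?y \<bullet> ?y"
      by (simp add: norm_le)
    also have "\<dots> = x \<bullet> x - 4 * (q \<bullet> x) / (q \<bullet> q) + 4 / (q \<bullet> q)"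
      using qq by (simp add: inner_diff_left inner_diff_right inner_commute field_simps power2_eq_square)
    finally have "4 * (q \<bullet> x) / (q \<bullet> q) \<le> 4 / (q \<bullet> q)" by linarith
    then show ?thesis using qq by (simp add: divide_le_cancel)
  qed
  have neg: "- q \<in> P" if "q \<in> P" for q
  proof -
    have "reflection q q = - q" using that P(1) by (auto simp: reflection_inner scaleR_2)
    then show ?thesis using P(2)[OF that that] by simp
  qed
  have aspan: "a i \<in> span (a ` I)" if "i \<in> I" for i using that by (simp add: span_base)
  have reflection_span: "reflection q p \<in> span (a ` I)" if "p \<in> span (a ` I)" "q \<in> span (a ` I)" for p q
    using that by (simp add: reflection_inner span_diff span_scale)
  have val: "a i \<bullet> x = e \<or> a i \<bullet> x = e - 1" if i: "i \<in> I" for i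
  proof -
    obtain n :: int where n: "a i \<bullet> x - e = n" using x(2)[OF i] by (auto elim: Ints_cases)
    have "a i \<bullet> x \<le> 1" "- (a i \<bullet> x) \<le> 1"
      using le1[OF a[OF i] aspan[OF i]] le1[OF neg[OF a[OF i]] span_neg[OF aspan[OF i]]] by simp_all
    then have "real_of_int n < 1" "real_of_int n > -2" using n e by linarith+
    then have "n = 0 \<or> n = -1" by linarith
    then show ?thesis using n by auto
  qed
  define B where "B = {i \<in> I. a i \<bullet> x = e - 1}"
  have "0 = (\<Sum>i\<in>I. of_int (c i) *\<^sub>R a i) \<bullet> x" using rel0 by simp
  also have "\<dots> = (\<Sum>i\<in>I. of_int (c i) * (e - (if i \<in> B then 1 else 0)))"
    unfolding inner_sum_left using val by (intro sum.cong) (auto simp: B_def)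
  also have "\<dots> = k * e - (\<Sum>i\<in>I. if i \<in> B then of_int (c i) else 0)"
    unfolding k_def of_int_sum sum_distrib_right sum_subtractf[symmetric]
    by (intro sum.cong) (auto simp: algebra_simps)
  also have "(\<Sum>i\<in>I. if i \<in> B then real_of_int (c i) else 0) = of_int (\<Sum>i\<in>B. c i)"
    unfolding of_int_sum B_def by (subst sum.inter_filter[OF fin]) simp
  finally have "real_of_int (\<Sum>i\<in>B. c i) = 1" using e by simp
  then have cB: "(\<Sum>i\<in>B. c i) = 1" by linarith
  have finB: "finite B" using fin by (simp add: B_def)
  obtain b where b: "b \<in> B" using cB by (metis sum.empty ex_in_conv zero_neq_one)
  have bI: "b \<in> I" and bx: "b \<in> I" "a b \<bullet> x = e - 1" using b by (auto simp: B_def)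
  have cb: "c b + (\<Sum>i\<in>B - {b}. c i) = 1" using cB sum.remove[OF finB b, of c] by simp
  have nonneg: "(\<Sum>i\<in>B - {b}. c i) \<ge> 0" using pos by (intro sum_nonneg) (auto simp: B_def less_imp_le)
  have cb1: "c b = 1" using cb nonneg pos[OF bI] by linarith
  then have "(\<Sum>i\<in>B - {b}. c i) = 0" using cb by simp
  then have "\<forall>i\<in>B - {b}. c i = 0"
    using finB pos by (subst (asm) sum_nonneg_eq_0_iff) (auto simp: B_def less_imp_le)
  then have "i = b" if "i \<in> B" for i
    using that pos[of i] by (cases "i = b") (auto simp: B_def)
  with b have Bb: "B = {b}" by blast
  have other: "a l \<bullet> x = e" if "l \<in> I" "l \<noteq> b" for l
    using val[OF that(1)] that Bb by (auto simp: B_def)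
  \<comment> \<open>The root \<open>th\<close> takes the extreme value \<open>1\<close> at \<open>x\<close>, so its products with the \<open>a j\<close>, \<open>j \<noteq> b\<close>,
    are nonnegative; the relation then makes all but those with \<open>a i\<close> and \<open>a b\<close> vanish.\<close>
  have twin: "a l \<bullet> a i = a l \<bullet> a b" if i: "i \<in> I" "i \<noteq> b" "a b \<bullet> a i > 0" and l: "l \<in> I" "l \<noteq> i" "l \<noteq> b" for i l
  proof -
    have nz: "a j \<bullet> a j > 0" if "j \<in> I" for j using a[OF that] P(1) by auto
    have bigger: "2 * (a b \<bullet> a i) / (a i \<bullet> a i) \<in> \<int>" "2 * (a i \<bullet> a b) / (a b \<bullet> a b) \<in> \<int>"
      using cartan a i bI by auto
    obtain p :: int where p: "2 * (a b \<bullet> a i) / (a i \<bullet> a i) = p" using bigger(1) by (auto elim: Ints_cases)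
    obtain p' :: int where p': "2 * (a i \<bullet> a b) / (a b \<bullet> a b) = p'" using bigger(2) by (auto elim: Ints_cases)
    have "real_of_int p > 0" "real_of_int p' > 0" unfolding p[symmetric] p'[symmetric]
      using i nz bI by (auto simp: inner_commute)
    then have pp: "p \<ge> 1" "p' \<ge> 1" by linarith+
    have "- reflection (a i) (a b) = of_int p *\<^sub>R a i - a b" by (simp add: reflection_inner p)
    moreover have "(- reflection (a i) (a b)) \<bullet> x \<le> 1"
      using le1[OF neg[OF P(2)[OF a[OF bI] a[OF i(1)]]]] reflection_span[OF aspan aspan] i bI by (auto simp: span_neg)
    ultimately have "p * e - (e - 1) \<le> 1" using other[OF i(1,2)] bx by (simp add: inner_diff_left)
    then have "(p - 1) * e \<le> 0" by (simp add: algebra_simps)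
    then have p1: "p = 1" using pp e by (simp add: mult_le_0_iff)
    have half: "2 * (a b \<bullet> a i) = a i \<bullet> a i"
      using p nz[OF i(1)] unfolding p1 by (metis divide_eq_1_iff of_int_1)
    have long: "a i \<bullet> a i \<ge> a b \<bullet> a b"
    proof -
      have "a i \<bullet> a i = p' * (a b \<bullet> a b)" using half p' nz[OF bI] by (simp add: field_simps inner_commute)
      moreover have "1 * (a b \<bullet> a b) \<le> p' * (a b \<bullet> a b)" using pp nz[OF bI] by (intro mult_right_mono) auto
      ultimately show ?thesis by simp
    qed
    define th where "th = a i - a b"
    have thP: "th \<in> P" "th \<in> span (a ` I)" "th \<bullet> x = 1"
    proof -
      have "th = - reflection (a i) (a b)" unfolding reflection_inner p p1 by (simp add: th_def)
      then show "th \<in> P" "th \<in> span (a ` I)"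
        using neg P(2) a i bI reflection_span aspan by (auto simp: span_neg)
      show "th \<bullet> x = 1" using other[OF i(1,2)] bx by (simp add: th_def inner_diff_left)
    qed
    have th: "th \<bullet> a j \<ge> 0" if j: "j \<in> I" "j \<noteq> b" for j
    proof (rule ccontr)
      assume "\<not> th \<bullet> a j \<ge> 0"
      then have neg1: "th \<bullet> a j < 0" by simp
      define t where "t = 2 * (th \<bullet> a j) / (a j \<bullet> a j)"
      have "t < 0" using neg1 nz[OF j(1)] by (simp add: t_def divide_neg_pos)
      have "reflection (a j) th \<bullet> x \<le> 1" using le1 P(2) thP a[OF j(1)] reflection_span aspan[OF j(1)] by blast
      then have "1 - t * e \<le> 1" using other[OF j] thP by (simp add: reflection_inner t_def inner_diff_left)
      then show False using \<open>t < 0\<close> e by (simp add: mult_nonneg_nonneg zero_le_mult_iff)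
    qed
    have "0 = th \<bullet> (\<Sum>j\<in>I. of_int (c j) *\<^sub>R a j)" using rel0 by simp
    also have "\<dots> = (\<Sum>j\<in>I. of_int (c j) * (th \<bullet> a j))" by (simp add: inner_sum_right)
    also have "\<dots> = of_int (c b) * (th \<bullet> a b) + (of_int (c i) * (th \<bullet> a i) + (\<Sum>j\<in>I - {b} - {i}. of_int (c j) * (th \<bullet> a j)))"
      using i bI fin by (simp add: sum.remove[of I b] sum.remove[of "I - {b}" i])
    finally have s0: "0 = (th \<bullet> a b) + of_int (c i) * (th \<bullet> a i) + (\<Sum>j\<in>I - {b} - {i}. of_int (c j) * (th \<bullet> a j))"
      using cb1 by simp
    have "th \<bullet> a i \<le> of_int (c i) * (th \<bullet> a i)"
      using th[OF i(1,2)] pos[OF i(1)] mult_right_mono[of 1 "real_of_int (c i)" "th \<bullet> a i"] by simp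
    moreover have "th \<bullet> a b + th \<bullet> a i \<ge> 0"
      using half long by (simp add: th_def inner_diff_left inner_commute[of "a i" "a b"])
    moreover have nn: "\<And>j. j \<in> I - {b} - {i} \<Longrightarrow> of_int (c j) * (th \<bullet> a j) \<ge> 0"
      using th pos by (simp add: less_imp_le)
    ultimately have "(\<Sum>j\<in>I - {b} - {i}. of_int (c j) * (th \<bullet> a j)) \<le> 0" using s0 by linarith
    then have "(\<Sum>j\<in>I - {b} - {i}. of_int (c j) * (th \<bullet> a j)) = 0" using nn by (meson order_antisym sum_nonneg)
    then have "\<forall>j\<in>I - {b} - {i}. of_int (c j) * (th \<bullet> a j) = 0"
      using fin nn by (subst (asm) sum_nonneg_eq_0_iff) auto
    then have "of_int (c l) * (th \<bullet> a l) = 0" using l by simp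
    then have "th \<bullet> a l = 0" using pos[OF l(1)] by simp
    then show ?thesis by (simp add: th_def inner_diff_left inner_commute[of "a l"])
  qed
  define X where "X = insert b {i \<in> I. a b \<bullet> a i > 0}"
  have "X = I"
  proof (rule ccontr)
    assume "X \<noteq> I"
    moreover have "X \<subseteq> I" "X \<noteq> {}" using bI by (auto simp: X_def)
    ultimately obtain i l where il: "i \<in> X" "l \<in> I - X" "a i \<bullet> a l > 0"
      using conn unfolding acute_connected_def by blast
    have "l \<noteq> b" "l \<noteq> i" "\<not> a b \<bullet> a l > 0" using il bI by (auto simp: X_def)
    moreover have "i \<noteq> b" using il calculation by auto
    ultimately show False using twin[of i l] il by (auto simp: X_def inner_commute)
  qed
  moreover have "a b \<bullet> a b > 0" using a[OF bI] P(1) by auto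
  ultimately have dom: "a b \<bullet> a i > 0" if "i \<in> I" for i
    using that by (cases "i = b") (auto simp: X_def)
  show False
    using no_dominating_vertex[where c = "\<lambda>i. of_int (c i)" and a = a and I = I and b = b] fin bI posr rel0 dom by metis
qed

lemma only_relation_scale:
  assumes "only_relation I a c" "t \<noteq> 0" "\<And>i. i \<in> I \<Longrightarrow> d i = t * c i"
  shows "only_relation I a d"
proof -
  have "(\<Sum>i\<in>I. d i *\<^sub>R a i) = t *\<^sub>R (\<Sum>i\<in>I. c i *\<^sub>R a i)"
    using assms(3) by (simp add: scaleR_sum_right)
  moreover have "\<exists>s. \<forall>i\<in>I. f i = s * d i" if f0: "(\<Sum>i\<in>I. f i *\<^sub>R a i) = 0" for f
  proof -
    obtain s where "\<forall>i\<in>I. f i = s * c i"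
      using assms(1) f0 unfolding only_relation_def by blast
    then have "\<forall>i\<in>I. f i = (s / t) * d i" using assms(2,3) by simp
    then show ?thesis by blast
  qed
  ultimately show ?thesis using assms(1) by (simp add: only_relation_def)
qed

text \<open>Simultaneous Diophantine approximation gives an integer vector close to a multiple of \<open>c\<close>.
  Each row of the Cartan matrix annihilates \<open>c\<close> and sends the integer vector to an integer of
  absolute value below one, so the integer vector is a relation as well.\<close>

lemma integer_relation:
  fixes a :: "'i \<Rightarrow> 'a::euclidean_space"
  assumes fin: "finite I" and ne: "I \<noteq> {}" and rel: "only_relation I a c" and pos: "\<And>i. i \<in> I \<Longrightarrow> c i > 0"
    and nz: "\<And>i. i \<in> I \<Longrightarrow> a i \<noteq> 0"
    and cartan: "\<And>i j. i \<in> I \<Longrightarrow> j \<in> I \<Longrightarrow> 2 * (a i \<bullet> a j) / (a j \<bullet> a j) \<in> \<int>"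
  obtains n :: "'i \<Rightarrow> int" where "\<And>i. i \<in> I \<Longrightarrow> n i > 0" "only_relation I a (\<lambda>i. of_int (n i))"
    "\<And>g. g > 0 \<Longrightarrow> (\<And>i. i \<in> I \<Longrightarrow> g dvd n i) \<Longrightarrow> g = 1"
proof -
  obtain i0 where i0: "i0 \<in> I" using ne by auto
  define g where "g i j = 2 * (a i \<bullet> a j) / (a j \<bullet> a j)" for i j
  define M where "M = (\<Sum>j\<in>I. \<Sum>i\<in>I. \<bar>g i j\<bar>)"
  obtain N :: nat where N: "real N > max M (1 / c i0)" using reals_Archimedean2 by blast
  have "1 / c i0 > 0" using pos[OF i0] by simp
  then have N0: "N > 0" using N by (metis less_trans max_less_iff_conj of_nat_0_less_iff)
  obtain h where h: "bij_betw h {..<card I} I"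
    using ex_bij_betw_nat_finite[OF fin] by (auto simp: atLeast0LessThan)
  obtain q p0 where qp0: "0 < q" "\<And>i. i < card I \<Longrightarrow> \<bar>of_int q * c (h i) - of_int (p0 i)\<bar> < 1 / N"
    using Dirichlet_approx_simult[OF N0, of "card I" "\<lambda>i. c (h i)"] by metis
  define p where "p i = p0 (the_inv_into {..<card I} h i)" for i
  have p: "\<bar>of_int q * c i - of_int (p i)\<bar> < 1 / N" if i: "i \<in> I" for i
  proof -
    have "the_inv_into {..<card I} h i < card I" "h (the_inv_into {..<card I} h i) = i"
      using h i by (auto simp: bij_betw_def the_inv_into_into[of h "{..<card I}" i "{..<card I}", simplified] f_the_inv_into_f)
    then show ?thesis using qp0(2)[of "the_inv_into {..<card I} h i"] by (simp add: p_def)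
  qed
  define v where "v = (\<Sum>i\<in>I. of_int (p i) *\<^sub>R a i)"
  have "(\<Sum>i\<in>I. (of_int q * c i) *\<^sub>R a i) = of_int q *\<^sub>R (\<Sum>i\<in>I. c i *\<^sub>R a i)"
    by (simp add: scaleR_sum_right)
  also have "\<dots> = 0" using rel by (simp add: only_relation_def)
  finally have v: "v = - (\<Sum>i\<in>I. (of_int q * c i - of_int (p i)) *\<^sub>R a i)"
    by (simp add: v_def scaleR_diff_left sum_subtractf)
  have vj: "v \<bullet> a j = 0" if j: "j \<in> I" for j
  proof -
    have ajj: "a j \<bullet> a j > 0" using nz[OF j] by simp
    have "2 * (v \<bullet> a j) / (a j \<bullet> a j) = (\<Sum>i\<in>I. of_int (p i) * g i j)"
      by (simp add: v_def g_def inner_sum_left sum_distrib_left sum_divide_distrib mult.left_commute)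
    moreover have "of_int (p i) * g i j \<in> \<int>" if "i \<in> I" for i
      using cartan[OF that j] unfolding g_def by (intro Ints_mult) auto
    ultimately have int: "2 * (v \<bullet> a j) / (a j \<bullet> a j) \<in> \<int>"
      by (metis (no_types, lifting) Ints_sum)
    have "\<bar>2 * (v \<bullet> a j) / (a j \<bullet> a j)\<bar> = \<bar>\<Sum>i\<in>I. (of_int q * c i - of_int (p i)) * g i j\<bar>"
      unfolding v g_def by (simp add: inner_sum_left sum_distrib_left sum_divide_distrib mult.left_commute)
    also have "\<dots> \<le> (\<Sum>i\<in>I. \<bar>of_int q * c i - of_int (p i)\<bar> * \<bar>g i j\<bar>)"
      by (rule order_trans[OF sum_abs]) (simp add: abs_mult)
    also have "\<dots> \<le> (\<Sum>i\<in>I. 1 / N * \<bar>g i j\<bar>)"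
      using p by (intro sum_mono mult_right_mono) (auto intro: less_imp_le)
    also have "\<dots> = (\<Sum>i\<in>I. \<bar>g i j\<bar>) / N"
      by (simp add: sum_divide_distrib)
    also have "\<dots> \<le> M / N"
      unfolding M_def using fin j by (intro divide_right_mono member_le_sum) (auto intro: sum_nonneg)
    also have "\<dots> < 1" using N N0 by simp
    finally have "2 * (v \<bullet> a j) / (a j \<bullet> a j) = 0"
      using Ints_eq_abs_less1[OF int Ints_0] by simp
    then show ?thesis using ajj by simp
  qed
  have "v \<bullet> v = (\<Sum>i\<in>I. of_int (p i) * (v \<bullet> a i))"
    by (subst (2) v_def) (simp add: inner_sum_right)
  then have "v = 0" using vj by simp
  then obtain t where t: "\<forall>i\<in>I. of_int (p i) = t * c i"
    using rel[unfolded only_relation_def, THEN conjunct2, rule_format, of "\<lambda>i. of_int (p i)"]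
    unfolding v_def by metis
  have "t \<noteq> 0"
  proof
    assume "t = 0"
    then have "p i0 = 0" using t i0 by simp
    then have "of_int q * c i0 < 1 / N" using p[OF i0] by simp
    moreover have "1 * c i0 \<le> of_int q * c i0" using qp0(1) pos[OF i0] by (intro mult_right_mono) auto
    moreover have "1 / N < c i0" using N N0 pos[OF i0] by (simp add: field_simps)
    ultimately show False by simp
  qed
  define G where "G = Gcd (p ` I)"
  have pnz: "p i \<noteq> 0" if "i \<in> I" for i using t pos that \<open>t \<noteq> 0\<close> by force
  have G: "G > 0"
  proof -
    have "G dvd p i0" unfolding G_def using i0 by simp
    then have "G \<noteq> 0" using pnz[OF i0] by auto
    moreover have "G \<ge> 0" unfolding G_def by simp
    ultimately show ?thesis by simp
  qed
  define n where "n i = \<bar>p i\<bar> div G" for i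
  have nG: "n i * G = \<bar>p i\<bar>" if "i \<in> I" for i
    unfolding n_def G_def using that by simp
  show thesis
  proof (rule that[of n])
    show n0: "n i > 0" if "i \<in> I" for i
      using nG[OF that] pnz[OF that] G by (metis zero_less_abs_iff zero_less_mult_pos2)
    have "real_of_int (n i) = (\<bar>t\<bar> / G) * c i" if "i \<in> I" for i
    proof -
      have "real_of_int (n i) * G = \<bar>t * c i\<bar>"
        using nG[OF that] t that by (metis of_int_abs of_int_mult)
      then show ?thesis using pos[OF that] G by (simp add: abs_mult field_simps)
    qed
    then show "only_relation I a (\<lambda>i. of_int (n i))"
      using only_relation_scale[OF rel, of "\<bar>t\<bar> / G"] \<open>t \<noteq> 0\<close> G by simp
    show "h = 1" if "h > 0" "\<And>i. i \<in> I \<Longrightarrow> h dvd n i" for h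
    proof -
      have "h * G dvd p i" if "i \<in> I" for i
        using nG[OF that] \<open>\<And>i. i \<in> I \<Longrightarrow> h dvd n i\<close>[OF that] by (metis dvd_abs_iff dvd_refl mult_dvd_mono)
      then have "h * G dvd G" unfolding G_def by (intro Gcd_greatest) auto
      then have "h dvd 1" using G by (metis dvd_mult_cancel_right less_irrefl mult_1)
      then show ?thesis using that(1) by simp
    qed
  qed
qed

section \<open>Normalised root systems and simple roots\<close>

text \<open>For a vector \<open>q\<close> of square length two this is the reflection in \<open>q\<close>; all
  roots are normalised to this length.\<close>

definition rf :: "'a::euclidean_space \<Rightarrow> 'a \<Rightarrow> 'a" where
  "rf q v = v - (q \<bullet> v) *\<^sub>R q"

definition normalised :: "'a::euclidean_space set \<Rightarrow> bool" where
  "normalised R \<longleftrightarrow> finite R \<and> (\<forall>p\<in>R. p \<bullet> p = 2) \<and> (\<forall>p\<in>R. \<forall>q\<in>R. rf q p \<in> R)"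

lemma rf_inner: "q \<bullet> q = 2 \<Longrightarrow> rf q u \<bullet> rf q v = u \<bullet> v"
  by (simp add: rf_def inner_diff_left inner_diff_right inner_commute algebra_simps)

lemma rf_rf: "q \<bullet> q = 2 \<Longrightarrow> rf q (rf q v) = v"
  by (simp add: rf_def inner_diff_right algebra_simps)

lemma normalised_neg: "normalised R \<Longrightarrow> p \<in> R \<Longrightarrow> - p \<in> R"
proof -
  assume "normalised R" "p \<in> R"
  then have "rf p p \<in> R" "p \<bullet> p = 2" by (auto simp: normalised_def)
  then show ?thesis by (simp add: rf_def scaleR_2)
qed

definition cone_of :: "'a::euclidean_space set \<Rightarrow> 'a set" where
  "cone_of D = {v. \<exists>u. (\<forall>d\<in>D. u d \<ge> 0) \<and> v = (\<Sum>d\<in>D. u d *\<^sub>R d)}"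

text \<open>In place of linear independence, the definition asks for a vector \<open>y\<close> which makes the simple roots
  positive, and for obtuse angles between them. Together these imply independence.\<close>

definition simple_system :: "'a::euclidean_space set \<Rightarrow> 'a set \<Rightarrow> bool" where
  "simple_system R D \<longleftrightarrow> D \<subseteq> R \<and> (\<exists>y. (\<forall>d\<in>D. d \<bullet> y > 0)) \<and>
     (\<forall>p\<in>R. p \<in> cone_of D \<or> - p \<in> cone_of D) \<and> (\<forall>d\<in>D. \<forall>e\<in>D. d \<noteq> e \<longrightarrow> d \<bullet> e \<le> 0)"

text \<open>Finitely many hyperplanes do not cover the space.\<close>

lemma generic_vector:
  fixes R :: "'a::euclidean_space set"
  assumes "finite R" "0 \<notin> R"
  obtains y where "\<And>p. p \<in> R \<Longrightarrow> p \<bullet> y \<noteq> 0"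
proof -
  have "\<exists>y. \<forall>p\<in>R. p \<bullet> y \<noteq> 0"
    using assms
  proof (induction R rule: finite_induct)
    case (insert r R)
    then obtain y where y: "\<forall>p\<in>R. p \<bullet> y \<noteq> 0" by auto
    show ?case
    proof (cases "r \<bullet> y = 0")
      case True
      define B where "B = insert 0 ((\<lambda>p. - (p \<bullet> y) / (p \<bullet> r)) ` R)"
      have "finite B" using insert by (simp add: B_def)
      then obtain t where t: "t \<notin> B"
        using ex_new_if_finite infinite_UNIV_char_0 by blast
      have "p \<bullet> (y + t *\<^sub>R r) \<noteq> 0" if "p \<in> R" for p
      proof
        assume z: "p \<bullet> (y + t *\<^sub>R r) = 0"
        then have e: "p \<bullet> y = - (t * (p \<bullet> r))" by (simp add: inner_add_right)
        then have "p \<bullet> r \<noteq> 0" using y that by auto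
        then have "t = - (p \<bullet> y) / (p \<bullet> r)" using e by simp
        then show False using t that by (auto simp: B_def)
      qed
      moreover have "r \<bullet> (y + t *\<^sub>R r) \<noteq> 0"
        using True t insert.prems by (auto simp: inner_add_right B_def)
      ultimately show ?thesis by blast
    qed (use y in auto)
  qed auto
  then show thesis using that by blast
qed

lemma cone_of_insert:
  assumes "finite D" "d \<in> D" "d \<in> cone_of (D - {d})"
  shows "cone_of D \<subseteq> cone_of (D - {d})"
proof
  fix v assume "v \<in> cone_of D"
  then obtain u where u: "\<forall>e\<in>D. u e \<ge> 0" "v = (\<Sum>e\<in>D. u e *\<^sub>R e)" by (auto simp: cone_of_def)
  obtain w where w: "\<forall>e\<in>D - {d}. w e \<ge> 0" "d = (\<Sum>e\<in>D - {d}. w e *\<^sub>R e)"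
    using assms(3) unfolding cone_of_def by blast
  have "v = u d *\<^sub>R d + (\<Sum>e\<in>D - {d}. u e *\<^sub>R e)"
    using u assms by (simp add: sum.remove)
  also have "\<dots> = u d *\<^sub>R (\<Sum>e\<in>D - {d}. w e *\<^sub>R e) + (\<Sum>e\<in>D - {d}. u e *\<^sub>R e)"
    using w(2) by simp
  also have "\<dots> = (\<Sum>e\<in>D - {d}. (u d * w e + u e) *\<^sub>R e)"
    by (simp add: scaleR_sum_right sum.distrib scaleR_add_left)
  finally show "v \<in> cone_of (D - {d})"
    unfolding cone_of_def using u(1) w(1) assms(2)
    by (auto intro!: exI[of _ "\<lambda>e. u d * w e + u e"] add_nonneg_nonneg mult_nonneg_nonneg)
qed

text \<open>Moving the multiple of \<open>d\<close> in the sum to the left leaves a positive multiple of \<open>d\<close>.\<close>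

lemma cone_self:
  assumes "finite D" "d \<in> D" "x \<ge> 0" "e *\<^sub>R d = x *\<^sub>R d' + (\<Sum>i\<in>D. u i *\<^sub>R i)" "d' \<in> D" "d' \<noteq> d" "\<forall>i\<in>D. u i \<ge> 0" "u d < e"
  shows "d \<in> cone_of (D - {d})"
proof -
  define w where "w i = ((if i = d' then x else 0) + u i) / (e - u d)" for i
  have "(e - u d) *\<^sub>R d = x *\<^sub>R d' + (\<Sum>i\<in>D - {d}. u i *\<^sub>R i)"
    using assms(1,2,4) by (simp add: sum.remove scaleR_diff_left)
  also have "x *\<^sub>R d' = (\<Sum>i\<in>D - {d}. (if i = d' then x else 0) *\<^sub>R i)"
    using assms(1,5,6) by (simp add: if_distrib[of "\<lambda>t. t *\<^sub>R _"] sum.delta cong: if_cong)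
  finally have "(e - u d) *\<^sub>R d = (\<Sum>i\<in>D - {d}. ((if i = d' then x else 0) + u i) *\<^sub>R i)"
    by (simp add: sum.distrib scaleR_add_left)
  then have "d = inverse (e - u d) *\<^sub>R (\<Sum>i\<in>D - {d}. ((if i = d' then x else 0) + u i) *\<^sub>R i)"
    using assms(8) by (metis diff_gt_0_iff_gt less_irrefl scaleR_one scaleR_scaleR left_inverse)
  also have "\<dots> = (\<Sum>i\<in>D - {d}. w i *\<^sub>R i)"
    by (simp add: scaleR_sum_right w_def divide_inverse mult.commute)
  finally show ?thesis
    unfolding cone_of_def using assms(3,7,8) by (auto simp: w_def intro!: exI[of _ w] divide_nonneg_pos add_nonneg_nonneg)
qed

text \<open>A minimal set \<open>D\<close> of positive roots whose cone contains all positive roots will do. If two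
  elements \<open>d\<close>, \<open>e\<close> of \<open>D\<close> formed an acute angle, then \<open>d - (d \<bullet> e) e\<close> would be a positive or a
  negative root, and writing it as a combination of \<open>D\<close> would express \<open>d\<close> or \<open>e\<close> by the rest
  of \<open>D\<close>.\<close>

lemma simple_system_exists:
  fixes R :: "'a::euclidean_space set"
  assumes R: "normalised R"
  obtains D where "simple_system R D"
proof -
  have fin: "finite R" and norm: "\<And>p. p \<in> R \<Longrightarrow> p \<bullet> p = 2" and cl: "\<And>p q. p \<in> R \<Longrightarrow> q \<in> R \<Longrightarrow> rf q p \<in> R"
    using R by (auto simp: normalised_def)
  have "0 \<notin> R" using norm by force
  then obtain y where y: "\<And>p. p \<in> R \<Longrightarrow> p \<bullet> y \<noteq> 0" using generic_vector[OF fin] by metis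
  define Pos where "Pos = {p \<in> R. p \<bullet> y > 0}"
  define gen where "gen D \<longleftrightarrow> D \<subseteq> Pos \<and> Pos \<subseteq> cone_of D" for D
  have "Pos \<subseteq> cone_of Pos"
  proof
    fix p assume "p \<in> Pos"
    then show "p \<in> cone_of Pos"
      unfolding cone_of_def using fin
      by (auto simp: Pos_def if_distrib[of "\<lambda>t. t *\<^sub>R _"] sum.delta cong: if_cong intro!: exI[of _ "\<lambda>i. if i = p then 1 else 0"])
  qed
  then have "gen Pos" by (simp add: gen_def)
  then obtain D where D: "gen D" "\<And>E. gen E \<Longrightarrow> card D \<le> card E"
    using ex_has_least_nat[of gen Pos card] by blast
  have finD: "finite D" using D fin by (auto simp: gen_def Pos_def intro: finite_subset)
  have DR: "D \<subseteq> R" and Dy: "\<And>d. d \<in> D \<Longrightarrow> d \<bullet> y > 0" using D(1) by (auto simp: gen_def Pos_def)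
  have min: "d \<notin> cone_of (D - {d})" if "d \<in> D" for d
  proof
    assume "d \<in> cone_of (D - {d})"
    then have "gen (D - {d})" using cone_of_insert[OF finD that] D(1) unfolding gen_def by blast
    then have "card D \<le> card (D - {d})" using D(2) by blast
    then show False using finD that by (metis card_Diff1_less not_le)
  qed
  have posy: "x * (d \<bullet> y) + (\<Sum>i\<in>D. u i * (i \<bullet> y)) > 0" if "x > 0" "d \<in> D" "\<forall>i\<in>D. u i \<ge> 0" for x d u
  proof -
    have "(\<Sum>i\<in>D. u i * (i \<bullet> y)) \<ge> 0" using that Dy by (intro sum_nonneg mult_nonneg_nonneg) (auto intro: less_imp_le)
    moreover have "x * (d \<bullet> y) > 0" using that Dy by simp
    ultimately show ?thesis by linarith
  qed
  have key: False if "d \<in> D" "d' \<in> D" "d' \<noteq> d" "x > 0" "e > 0" "\<forall>i\<in>D. u i \<ge> 0" "e *\<^sub>R d = x *\<^sub>R d' + (\<Sum>i\<in>D. u i *\<^sub>R i)" for d d' x e u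
  proof (cases "u d < e")
    case True
    then show False using cone_self[of D d x e d' u] that min finD by auto
  next
    case False
    define w where "w = u(d := u d - e)"
    have "(\<Sum>i\<in>D. w i *\<^sub>R i) = w d *\<^sub>R d + (\<Sum>i\<in>D - {d}. w i *\<^sub>R i)" using finD that(1) by (simp add: sum.remove)
    also have "(\<Sum>i\<in>D - {d}. w i *\<^sub>R i) = (\<Sum>i\<in>D - {d}. u i *\<^sub>R i)" by (intro sum.cong) (auto simp: w_def)
    also have "w d *\<^sub>R d + \<dots> = (\<Sum>i\<in>D. u i *\<^sub>R i) - e *\<^sub>R d" using finD that(1) by (simp add: sum.remove[of D d] w_def scaleR_diff_left)
    finally have "x *\<^sub>R d' + (\<Sum>i\<in>D. w i *\<^sub>R i) = 0" using that(7) by simp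
    then have "(x *\<^sub>R d' + (\<Sum>i\<in>D. w i *\<^sub>R i)) \<bullet> y = 0" by simp
    then have "x * (d' \<bullet> y) + (\<Sum>i\<in>D. w i * (i \<bullet> y)) = 0" by (simp add: inner_add_left inner_sum_left)
    moreover have "\<forall>i\<in>D. w i \<ge> 0" using that False by (auto simp: w_def)
    ultimately show False using posy[of x d' w] that by simp
  qed
  have obt: "d \<bullet> e \<le> 0" if de: "d \<in> D" "e \<in> D" "d \<noteq> e" for d e
  proof (rule ccontr)
    assume "\<not> d \<bullet> e \<le> 0"
    then have t: "d \<bullet> e > 0" by simp
    define s where "s = rf e d"
    have s: "s = d - (d \<bullet> e) *\<^sub>R e" by (simp add: s_def rf_def inner_commute)
    have "s \<in> R" unfolding s_def using cl DR de by blast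
    consider "s \<in> Pos" | "- s \<in> Pos"
      using y[OF \<open>s \<in> R\<close>] normalised_neg[OF R \<open>s \<in> R\<close>] \<open>s \<in> R\<close>
      by (cases "s \<bullet> y > 0") (simp_all add: Pos_def)
    then show False
    proof cases
      case 1
      then obtain u where "\<forall>i\<in>D. u i \<ge> 0" "s = (\<Sum>i\<in>D. u i *\<^sub>R i)" using D(1) unfolding gen_def cone_of_def by blast
      then show False using key[of d e "d \<bullet> e" 1 u] de t s by (simp add: algebra_simps)
    next
      case 2
      then obtain u where "\<forall>i\<in>D. u i \<ge> 0" "- s = (\<Sum>i\<in>D. u i *\<^sub>R i)" using D(1) unfolding gen_def cone_of_def by blast
      then show False using key[of e d 1 "d \<bullet> e" u] de t s by (simp add: algebra_simps)
    qed
  qed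
  have "p \<in> cone_of D \<or> - p \<in> cone_of D" if "p \<in> R" for p
  proof (cases "p \<bullet> y > 0")
    case True
    then show ?thesis using that D(1) unfolding gen_def Pos_def by blast
  next
    case False
    then have "- p \<in> Pos" using y[OF that] normalised_neg[OF R that] by (simp add: Pos_def)
    then show ?thesis using D(1) unfolding gen_def by blast
  qed
  then show thesis using that[of D] DR Dy obt unfolding simple_system_def by blast
qed

lemma simple_system_finite: "normalised R \<Longrightarrow> simple_system R D \<Longrightarrow> finite D"
  by (auto simp: normalised_def simple_system_def intro: finite_subset)

text \<open>A nonzero combination with nonnegative coefficients is positive on the vector \<open>y\<close> of the simple
  system.\<close>

lemma simple_combination_nonzero:
  assumes "simple_system R D" "finite E" "E \<subseteq> D" "\<forall>e\<in>E. u e \<ge> 0" "e0 \<in> E" "u e0 > 0"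
  shows "(\<Sum>e\<in>E. u e *\<^sub>R e) \<noteq> 0"
proof
  assume z: "(\<Sum>e\<in>E. u e *\<^sub>R e) = 0"
  obtain y where y: "\<forall>d\<in>D. d \<bullet> y > 0" using assms(1) by (auto simp: simple_system_def)
  have "(\<Sum>e\<in>E. u e * (e \<bullet> y)) > 0"
  proof (rule sum_pos2[OF assms(2,5)])
    show "u e0 * (e0 \<bullet> y) > 0" using assms y by auto
  qed (use assms y in \<open>auto intro!: mult_nonneg_nonneg intro: less_imp_le\<close>)
  moreover have "(\<Sum>e\<in>E. u e * (e \<bullet> y)) = (\<Sum>e\<in>E. u e *\<^sub>R e) \<bullet> y"
    by (simp add: inner_sum_left)
  ultimately show False using z by simp
qed

text \<open>In a relation, separate the positive from the negative coefficients. Both parts equal the same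
  vector \<open>v\<close>, and \<open>v \<bullet> v \<le> 0\<close> because distinct simple roots have nonpositive products.\<close>

lemma simple_independent:
  assumes R: "normalised R" and D: "simple_system R D"
  shows "independent D"
proof
  have fin: "finite D" using simple_system_finite[OF R D] .
  assume "dependent D"
  then obtain u d0 where u: "(\<Sum>d\<in>D. u d *\<^sub>R d) = 0" and d0: "d0 \<in> D" "u d0 \<noteq> 0"
    using fin by (auto simp: dependent_finite)
  define p where "p d = max (u d) 0" for d
  define n where "n d = max (- u d) 0" for d
  have pn: "u d = p d - n d" "p d \<ge> 0" "n d \<ge> 0" "p d * n d = 0" for d by (auto simp: p_def n_def max_def)
  define v where "v = (\<Sum>d\<in>D. p d *\<^sub>R d)"
  have "(\<Sum>d\<in>D. p d *\<^sub>R d) - (\<Sum>d\<in>D. n d *\<^sub>R d) = 0"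
    using u by (simp add: pn(1) scaleR_diff_left sum_subtractf)
  then have v2: "v = (\<Sum>d\<in>D. n d *\<^sub>R d)" by (simp add: v_def)
  have "v \<bullet> v = (\<Sum>d\<in>D. p d *\<^sub>R d) \<bullet> (\<Sum>e\<in>D. n e *\<^sub>R e)"
    using v2 v_def by metis
  also have "\<dots> = (\<Sum>d\<in>D. \<Sum>e\<in>D. p d * n e * (d \<bullet> e))"
    unfolding inner_sum_left by (intro sum.cong refl) (simp add: inner_sum_right sum_distrib_left mult.assoc mult.left_commute)
  also have "\<dots> \<le> 0"
  proof (intro sum_nonpos)
    fix d e assume de: "d \<in> D" "e \<in> D"
    show "p d * n e * (d \<bullet> e) \<le> 0"
    proof (cases "d = e")
      case False
      then have "d \<bullet> e \<le> 0" using D de by (simp add: simple_system_def)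
      then show ?thesis using pn(2)[of d] pn(3)[of e] by (simp add: mult_nonneg_nonpos)
    next
      case True
      then have "p d * n e = 0" using pn(4)[of d] by simp
      then show ?thesis by (metis mult_zero_left order_refl)
    qed
  qed
  finally have "v = 0" by (metis inner_gt_zero_iff not_less)
  moreover have "p d0 > 0 \<or> n d0 > 0" using d0 by (auto simp: p_def n_def)
  ultimately show False
    using simple_combination_nonzero[OF D fin subset_refl, of p d0] simple_combination_nonzero[OF D fin subset_refl, of n d0]
      pn d0 v_def v2 by metis
qed

inductive_set orbit_of :: "'a::euclidean_space set \<Rightarrow> 'a set" for D where
  base: "d \<in> D \<Longrightarrow> d \<in> orbit_of D"
| step: "d \<in> D \<Longrightarrow> p \<in> orbit_of D \<Longrightarrow> rf d p \<in> orbit_of D"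

text \<open>A positive root \<open>p\<close> has a positive product with some simple root \<open>d\<close> which occurs in it. If
  \<open>rf d p\<close> is positive, it is lower than \<open>p\<close> in the direction of \<open>y\<close>, which allows induction;
  otherwise only \<open>d\<close> occurs in \<open>p\<close>.\<close>

lemma roots_in_orbit:
  assumes R: "normalised R" and D: "simple_system R D"
  shows "orbit_of D = R"
proof -
  have fin: "finite R" and norm: "\<And>p. p \<in> R \<Longrightarrow> p \<bullet> p = 2" and cl: "\<And>p q. p \<in> R \<Longrightarrow> q \<in> R \<Longrightarrow> rf q p \<in> R"
    using R by (auto simp: normalised_def)
  have finD: "finite D" and DR: "D \<subseteq> R" using simple_system_finite[OF R D] D by (auto simp: simple_system_def)
  obtain y where y: "\<forall>d\<in>D. d \<bullet> y > 0" using D by (auto simp: simple_system_def)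
  have O_neg: "- p \<in> orbit_of D" if "p \<in> orbit_of D" for p
    using that
  proof induction
    case (base d)
    then have "rf d d = - d" using norm DR by (auto simp: rf_def scaleR_2)
    then show ?case using orbit_of.step[OF base orbit_of.base[OF base]] by simp
  next
    case (step d p)
    have "rf d (- p) = - rf d p" by (simp add: rf_def)
    then show ?case using orbit_of.step[OF step(1,3)] by simp
  qed
  have pos: "p \<in> orbit_of D" if "p \<in> R" "p \<in> cone_of D" for p
    using that
  proof (induction "card {q \<in> R. q \<bullet> y < p \<bullet> y}" arbitrary: p rule: less_induct)
    case less
    obtain u where u: "\<forall>d\<in>D. u d \<ge> 0" "p = (\<Sum>d\<in>D. u d *\<^sub>R d)" using less.prems by (auto simp: cone_of_def)
    have "(\<Sum>d\<in>D. u d * (p \<bullet> d)) = p \<bullet> p"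
      by (subst (3) u(2)) (simp add: inner_sum_right)
    then have "(\<Sum>d\<in>D. u d * (p \<bullet> d)) > 0" using norm[OF less.prems(1)] by simp
    then obtain d where d: "d \<in> D" "u d * (p \<bullet> d) > 0" by (meson not_less sum_nonpos)
    then have t: "p \<bullet> d > 0" "u d > 0" using u(1) by (auto simp: zero_less_mult_iff not_less)
    define q where "q = rf d p"
    have q: "q = p - (p \<bullet> d) *\<^sub>R d" by (simp add: q_def rf_def inner_commute)
    have qR: "q \<in> R" unfolding q_def using cl less.prems d DR by blast
    have pq: "rf d q = p" unfolding q_def using rf_rf norm d DR by blast
    show ?case
    proof (cases "q \<in> cone_of D")
      case True
      have "q \<bullet> y < p \<bullet> y" using t y d by (simp add: q inner_diff_left)
      then have "{r \<in> R. r \<bullet> y < q \<bullet> y} \<subset> {r \<in> R. r \<bullet> y < p \<bullet> y}" using qR by auto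
      then have "card {r \<in> R. r \<bullet> y < q \<bullet> y} < card {r \<in> R. r \<bullet> y < p \<bullet> y}"
        using fin by (intro psubset_card_mono) auto
      then have "q \<in> orbit_of D" using less.hyps qR True by blast
      then show ?thesis using orbit_of.step[OF d(1)] pq by metis
    next
      case False
      then have "- q \<in> cone_of D" using D qR by (auto simp: simple_system_def)
      then obtain w where w: "\<forall>d\<in>D. w d \<ge> 0" "- q = (\<Sum>d\<in>D. w d *\<^sub>R d)" by (auto simp: cone_of_def)
      define z where "z e = u e + w e - (if e = d then p \<bullet> d else 0)" for e
      have "(\<Sum>e\<in>D. z e *\<^sub>R e) = p + (- q) - (p \<bullet> d) *\<^sub>R d"
        unfolding w(2) using u(2) finD d
        by (simp add: z_def scaleR_add_left scaleR_diff_left sum.distrib sum_subtractf if_distrib[of "\<lambda>t. t *\<^sub>R _"] sum.delta cong: if_cong)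
      also have "\<dots> = 0" by (simp add: q)
      finally have "\<forall>e\<in>D. z e = 0"
        using independentD[OF simple_independent[OF R D] finD subset_refl, of z] by blast
      then have "u e = 0" if "e \<in> D" "e \<noteq> d" for e using that u(1) w(1) z_def[of e] \<open>\<forall>e\<in>D. z e = 0\<close> by (simp add: add_nonneg_eq_0_iff)
      then have "p = u d *\<^sub>R d" using u(2) finD d by (simp add: sum.remove)
      then have "u d * u d * 2 = 2" using norm[OF less.prems(1)] norm[of d] d DR by auto
      then have "u d = 1" using t by (metis mult_cancel_right1 power2_eq_1_iff power2_eq_square less_asym zero_neq_numeral neg_less_0_iff_less zero_less_one)
      then show ?thesis using orbit_of.base d \<open>p = u d *\<^sub>R d\<close> by simp
    qed
  qed
  have "p \<in> orbit_of D" if "p \<in> R" for p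
  proof (cases "p \<in> cone_of D")
    case False
    then have "- p \<in> cone_of D" using D that by (auto simp: simple_system_def)
    then have "- p \<in> orbit_of D" using pos normalised_neg[OF R that] by blast
    then show ?thesis using O_neg by force
  qed (use pos that in blast)
  moreover have "p \<in> R" if "p \<in> orbit_of D" for p
    using that by induction (use DR cl in auto)
  ultimately show ?thesis by blast
qed

section \<open>Angles between simple roots\<close>

definition phi :: real where "phi = (1 + sqrt 5) / 2"

lemma phi_square: "phi * phi = phi + 1"
  by (simp add: phi_def field_simps)

lemma phi_bounds: "1618/1000 < phi" "phi < 16181/10000"
proof -
  have "2236/1000 < sqrt 5" "sqrt 5 < 22362/10000" by (rule real_less_rsqrt, simp add: power2_eq_square) (rule real_less_lsqrt, simp_all add: power2_eq_square)
  then show "1618/1000 < phi" "phi < 16181/10000" by (simp_all add: phi_def)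
qed

lemma simple_pair_signs:
  assumes R: "normalised R" and D: "simple_system R D" and de: "d \<in> D" "e \<in> D" "d \<noteq> e"
    and r: "x *\<^sub>R d + z *\<^sub>R e \<in> R"
  shows "x \<ge> 0 \<and> z \<ge> 0 \<or> x \<le> 0 \<and> z \<le> 0"
proof -
  have finD: "finite D" using simple_system_finite[OF R D] .
  have *: "x \<ge> 0 \<and> z \<ge> 0" if "x *\<^sub>R d + z *\<^sub>R e \<in> cone_of D" for x z
  proof -
    obtain u where u: "\<forall>d\<in>D. u d \<ge> 0" "x *\<^sub>R d + z *\<^sub>R e = (\<Sum>d\<in>D. u d *\<^sub>R d)"
      using \<open>x *\<^sub>R d + z *\<^sub>R e \<in> cone_of D\<close> unfolding cone_of_def by blast
    define w where "w i = u i - (if i = d then x else 0) - (if i = e then z else 0)" for i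
    have "(\<Sum>i\<in>D. w i *\<^sub>R i) = (\<Sum>d\<in>D. u d *\<^sub>R d) - x *\<^sub>R d - z *\<^sub>R e"
      using finD de by (simp add: w_def scaleR_diff_left sum_subtractf if_distrib[of "\<lambda>t. t *\<^sub>R _"] cong: if_cong)
    also have "\<dots> = 0" using u(2)[symmetric] by simp
    finally have "\<forall>i\<in>D. w i = 0"
      using independentD[OF simple_independent[OF R D] finD subset_refl, of w] by blast
    then have "w d = 0" "w e = 0" using de by auto
    then show ?thesis using u(1) de by (auto simp: w_def)
  qed
  have "x *\<^sub>R d + z *\<^sub>R e \<in> cone_of D \<or> (- x) *\<^sub>R d + (- z) *\<^sub>R e \<in> cone_of D"
    using D r by (auto simp: simple_system_def)
  then show ?thesis using *[of x z] *[of "-x" "-z"] by auto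
qed

text \<open>All roots generated by \<open>d\<close> and \<open>e\<close> have coordinates of one sign; applied to six of them, this
  leaves few possibilities for the angle.\<close>

lemma simple_pair_label:
  assumes R: "normalised R" and D: "simple_system R D" and de: "d \<in> D" "e \<in> D" "d \<noteq> e"
  defines "v \<equiv> - (d \<bullet> e)"
  shows "v = 0 \<or> v = 1 \<or> v = sqrt 2 \<or> v = phi \<or> v \<ge> sqrt 3"
proof -
  have DR: "D \<subseteq> R" and v0: "v \<ge> 0" using D de by (auto simp: simple_system_def v_def)
  have n: "d \<bullet> d = 2" "e \<bullet> e = 2" and cl: "\<And>p q. p \<in> R \<Longrightarrow> q \<in> R \<Longrightarrow> rf q p \<in> R"
    using R DR de by (auto simp: normalised_def)
  have d: "(v * z - x) *\<^sub>R d + z *\<^sub>R e \<in> R" and e: "x *\<^sub>R d + (v * x - z) *\<^sub>R e \<in> R"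
    if "x *\<^sub>R d + z *\<^sub>R e \<in> R" for x z
  proof -
    have "rf d (x *\<^sub>R d + z *\<^sub>R e) = (v * z - x) *\<^sub>R d + z *\<^sub>R e"
      "rf e (x *\<^sub>R d + z *\<^sub>R e) = x *\<^sub>R d + (v * x - z) *\<^sub>R e"
      by (simp_all add: rf_def v_def inner_add_right n inner_commute[of e d] algebra_simps)
         (simp_all flip: scaleR_2 scaleR_add_left add: scaleR_2)
    then show "(v * z - x) *\<^sub>R d + z *\<^sub>R e \<in> R" "x *\<^sub>R d + (v * x - z) *\<^sub>R e \<in> R"
      using cl[OF that, of d] cl[OF that, of e] de DR by auto
  qed
  note sg = simple_pair_signs[OF R D de]
  have r0: "1 *\<^sub>R d + 0 *\<^sub>R e \<in> R" using de DR by auto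
  \<comment> \<open>The coordinates of these roots are Chebyshev polynomials in \<open>v\<close>.\<close>
  note r1 = e[OF r0]
  note r2 = d[OF r1]
  note r3 = e[OF r2]
  note r4 = d[OF r3]
  note r5 = e[OF r4]
  have s2: "v * v - 1 \<ge> 0 \<or> v = 0" using sg[OF r2] v0 by auto
  have s3: "v * (v * v - 2) \<ge> 0 \<or> v * v - 1 \<le> 0" using sg[OF r3] by (auto simp: algebra_simps)
  have s4: "v * v * v * v - 3 * (v * v) + 1 \<ge> 0 \<or> v * (v * v - 2) \<le> 0" using sg[OF r4] by (auto simp: algebra_simps)
  have s5: "v * ((v * v - 1) * (v * v - 3)) \<ge> 0 \<or> v * v * v * v - 3 * (v * v) + 1 \<le> 0" using sg[OF r5] by (auto simp: algebra_simps)
  show ?thesis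
  proof (cases "v = 0 \<or> v = 1 \<or> v = sqrt 2 \<or> v * v \<ge> 3")
    case True
    moreover have "v \<ge> sqrt 3" if "v * v \<ge> 3" using that v0 by (metis real_le_lsqrt abs_of_nonneg real_sqrt_abs2 real_sqrt_le_iff)
    ultimately show ?thesis by auto
  next
    case False
    have vp: "v > 0" using v0 False by auto
    have "v * v \<noteq> 1" using False vp by (metis abs_of_pos abs_1 square_eq_1_iff less_asym neg_0_less_iff_less zero_less_one)
    moreover have "v * v \<noteq> 2" using False vp by (metis abs_of_pos real_sqrt_abs2)
    ultimately have "v * v > 1" using s2 vp by auto
    then have "v * v > 2" using s3 vp \<open>v * v \<noteq> 2\<close> by (auto simp: zero_le_mult_iff)
    then have f: "v * v * v * v - 3 * (v * v) + 1 \<ge> 0" using s4 vp by (auto simp: mult_le_0_iff)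
    have "(v * v - 1) * (v * v - 3) < 0" using \<open>v * v > 2\<close> False by (intro mult_pos_neg) auto
    then have "v * v * v * v - 3 * (v * v) + 1 \<le> 0" using s5 mult_pos_neg[OF vp, of "(v * v - 1) * (v * v - 3)"] by (auto simp: not_le)
    then have "(v * v - v - 1) * (v * v + v - 1) = 0" using f by (simp add: algebra_simps)
    moreover have "v * v + v - 1 > 0" using \<open>v * v > 1\<close> vp by linarith
    ultimately have "v * v = v + 1" by simp
    then have "(v - phi) * (v + phi - 1) = 0" using phi_square by (simp add: algebra_simps)
    moreover have "v + phi - 1 > 0" using vp phi_bounds by linarith
    ultimately show ?thesis by auto
  qed
qed

lemma simple_combination_positive:
  assumes D: "simple_system R D" and "a \<in> D" "b \<in> D" "c \<in> D" "d \<in> D" "e \<in> D"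
    "x > 0" "y \<ge> 0" "z \<ge> 0" "s \<ge> 0" "t \<ge> 0"
  defines "w \<equiv> x *\<^sub>R a + y *\<^sub>R b + z *\<^sub>R c + s *\<^sub>R d + t *\<^sub>R e"
  shows "w \<bullet> w > 0"
proof -
  obtain f where f: "\<forall>d\<in>D. d \<bullet> f > 0" using D by (auto simp: simple_system_def)
  have "w \<bullet> f = x * (a \<bullet> f) + y * (b \<bullet> f) + z * (c \<bullet> f) + s * (d \<bullet> f) + t * (e \<bullet> f)"
    by (simp add: w_def inner_add_left)
  also have "\<dots> > 0"
    using assms f by (intro add_pos_nonneg mult_pos_pos mult_nonneg_nonneg) (auto intro: less_imp_le)
  finally show ?thesis by auto
qed

text \<open>Connectedness of the Coxeter diagram.\<close>

definition linked :: "'a::euclidean_space set \<Rightarrow> bool" where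
  "linked D \<longleftrightarrow> (\<forall>X. X \<subseteq> D \<and> X \<noteq> {} \<and> X \<noteq> D \<longrightarrow> (\<exists>x\<in>X. \<exists>y\<in>D - X. x \<bullet> y \<noteq> 0))"

lemma label_ge_1:
  assumes R: "normalised R" and D: "simple_system R D" and de: "d \<in> D" "e \<in> D" "d \<noteq> e" "d \<bullet> e \<noteq> 0"
  shows "d \<bullet> e \<le> -1"
proof -
  have b: "sqrt 2 \<ge> 1" "sqrt 3 \<ge> 1" by simp_all
  from simple_pair_label[OF R D de(1-3)] show ?thesis
    by (elim disjE) (use b de(4) phi_bounds in linarith)+
qed

text \<open>A third simple root \<open>r\<close> linked to \<open>p\<close> would give \<open>2 p + sqrt 3 q + r\<close> a nonpositive square
  length.\<close>

lemma linked_no_heavy_pair: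
  assumes R: "normalised R" and D: "simple_system R D" and l: "linked D" and c: "card D \<ge> 3"
    and pq: "p \<in> D" "q \<in> D" "p \<noteq> q"
  shows "- (p \<bullet> q) < sqrt 3"
proof (rule ccontr)
  assume "\<not> ?thesis"
  then have v: "p \<bullet> q \<le> - sqrt 3" by simp
  have norm: "d \<bullet> d = 2" if "d \<in> D" for d using R D that by (auto simp: normalised_def simple_system_def)
  have "card {p, q} \<le> 2" by (simp add: card_insert_if)
  then have "{p, q} \<noteq> D" using c by auto
  then obtain x r where xr: "x \<in> {p, q}" "r \<in> D" "r \<notin> {p, q}" "x \<bullet> r \<noteq> 0"
    using l pq unfolding linked_def by (metis Diff_iff empty_not_insert empty_subsetI insert_subset)
  have *: False if pq: "p \<in> D" "q \<in> D" "p \<bullet> q \<le> - sqrt 3" "p \<noteq> q" "r \<noteq> p" "r \<noteq> q" "p \<bullet> r \<noteq> 0" for p q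
  proof -
    have pr: "p \<bullet> r \<le> -1" using label_ge_1[OF R D] that xr by metis
    have qr: "q \<bullet> r \<le> 0" using D that xr by (auto simp: simple_system_def)
    have "sqrt 3 * (p \<bullet> q) \<le> sqrt 3 * (- sqrt 3)" using that by (intro mult_left_mono) auto
    then have 1: "sqrt 3 * (p \<bullet> q) \<le> - 3" by simp
    have 2: "sqrt 3 * (q \<bullet> r) \<le> 0" using qr by (simp add: mult_nonneg_nonpos)
    have "(2 *\<^sub>R p + sqrt 3 *\<^sub>R q + 1 *\<^sub>R r + 0 *\<^sub>R p + 0 *\<^sub>R p) \<bullet> (2 *\<^sub>R p + sqrt 3 *\<^sub>R q + 1 *\<^sub>R r + 0 *\<^sub>R p + 0 *\<^sub>R p) > 0"
      using that xr by (intro simple_combination_positive[OF D]) auto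
    then have "16 + 4 * (sqrt 3 * (p \<bullet> q)) + 4 * (p \<bullet> r) + 2 * (sqrt 3 * (q \<bullet> r)) > 0"
      using norm that xr by (simp add: inner_add_left inner_add_right inner_commute algebra_simps)
    then show False using 1 2 pr by linarith
  qed
  from xr show False using *[of p q] *[of q p] pq v by (auto simp: inner_commute)
qed

section \<open>Diagrams without the golden ratio\<close>

text \<open>Lengths which make the simple roots crystallographic exist because the diagram is a tree:
  a connected part \<open>X\<close> satisfies \<open>(\<Sum>X)\<^sup>2 \<le> 2\<close>, and a further root with
  two neighbours in \<open>X\<close> would make the square of the sum nonpositive.\<close>

lemma crystallographic_lengths:
  assumes R: "normalised R" and D: "simple_system R D" and l: "linked D" and ne: "D \<noteq> {}"
    and lab: "\<And>d e. d \<in> D \<Longrightarrow> e \<in> D \<Longrightarrow> d \<noteq> e \<Longrightarrow> d \<bullet> e = 0 \<or> d \<bullet> e = -1 \<or> d \<bullet> e = - sqrt 2"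
  obtains h where "\<And>d. d \<in> D \<Longrightarrow> h d > (0::real)"
    "\<And>d e. d \<in> D \<Longrightarrow> e \<in> D \<Longrightarrow> h d / h e * (d \<bullet> e) \<in> \<int>"
proof -
  have finD: "finite D" using simple_system_finite[OF R D] .
  have norm: "d \<bullet> d = 2" if "d \<in> D" for d using R D that by (auto simp: normalised_def simple_system_def)
  have obt: "d \<bullet> e \<le> 0" if "d \<in> D" "e \<in> D" "d \<noteq> e" for d e using D that by (auto simp: simple_system_def)
  define good where "good X h \<longleftrightarrow> (\<Sum>X) \<bullet> (\<Sum>X) \<le> 2 \<and> (\<forall>d\<in>X. h d > (0::real)) \<and> (\<forall>d\<in>X. \<forall>e\<in>X. h d / h e * (d \<bullet> e) \<in> \<int>)"
    for X :: "'a set" and h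
  have "\<exists>X h. X \<subseteq> D \<and> card X = Suc n \<and> good X h" if "Suc n \<le> card D" for n
    using that
  proof (induction n)
    case 0
    obtain d where d: "d \<in> D" using ne by auto
    then have "good {d} (\<lambda>_. 1)" using norm by (simp add: good_def)
    then show ?case using d by (intro exI[of _ "{d}"]) auto
  next
    case (Suc n)
    then obtain X h where X: "X \<subseteq> D" "card X = Suc n" "good X h" by auto
    have finX: "finite X" using X finD finite_subset by blast
    have "X \<noteq> {}" "X \<noteq> D" using X Suc.prems by auto
    then obtain x y where xy: "x \<in> X" "y \<in> D" "y \<notin> X" "x \<bullet> y \<noteq> 0"
      using l X(1) unfolding linked_def by blast
    define X' where "X' = insert y X"
    have X': "X' \<subseteq> D" "card X' = Suc (Suc n)" using X xy finX by (auto simp: X'_def)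
    have sumX': "\<Sum>X' = y + \<Sum>X" using finX xy by (simp add: X'_def)
    have "\<Sum>X' = (\<Sum>d\<in>X'. 1 *\<^sub>R d)" by simp
    also have "\<dots> \<noteq> 0"
      by (rule simple_combination_nonzero[OF D _ X'(1), of _ y]) (use finX in \<open>auto simp: X'_def\<close>)
    finally have pos: "(\<Sum>X') \<bullet> (\<Sum>X') > 0" by simp
    have sq: "(\<Sum>X') \<bullet> (\<Sum>X') = 2 + 2 * (\<Sum>d\<in>X. y \<bullet> d) + (\<Sum>X) \<bullet> (\<Sum>X)"
      using norm[OF xy(2)] by (simp add: sumX' inner_add_left inner_add_right inner_commute inner_sum_right)
    have yd: "y \<bullet> d \<le> 0" if "d \<in> X" for d using obt[of y d] that xy X by auto
    have yx: "y \<bullet> x \<le> -1" using label_ge_1[OF R D, of y x] xy X by (auto simp: inner_commute)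
    have only: "y \<bullet> d = 0" if d: "d \<in> X" "d \<noteq> x" for d
    proof (rule ccontr)
      assume "y \<bullet> d \<noteq> 0"
      then have "y \<bullet> d \<le> -1" using label_ge_1[OF R D, of y d] xy X d by auto
      moreover have "(\<Sum>e\<in>X. y \<bullet> e) = y \<bullet> x + (y \<bullet> d + (\<Sum>e\<in>X - {x} - {d}. y \<bullet> e))"
        using finX xy d by (simp add: sum.remove[of X x] sum.remove[of "X - {x}" d])
      moreover have "(\<Sum>e\<in>X - {x} - {d}. y \<bullet> e) \<le> 0" using yd by (intro sum_nonpos) auto
      ultimately show False using sq pos X(3) yx unfolding good_def by linarith
    qed
    have "(\<Sum>e\<in>X. y \<bullet> e) = y \<bullet> x" using finX xy only by (simp add: sum.remove[of X x])
    then have le2: "(\<Sum>X') \<bullet> (\<Sum>X') \<le> 2" using sq yx X(3) unfolding good_def by linarith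
    define h' where "h' = h(y := if y \<bullet> x = -1 then h x else sqrt 2 * h x)"
    have hx: "h x > 0" using X(3) xy by (auto simp: good_def)
    have "h' d > 0" if "d \<in> X'" for d using that X(3) hx by (auto simp: h'_def X'_def good_def)
    moreover have "h' d / h' e * (d \<bullet> e) \<in> \<int>" if de: "d \<in> X'" "e \<in> X'" for d e
    proof -
      have yx2: "y \<bullet> x = -1 \<or> y \<bullet> x = - sqrt 2" using lab[of y x] xy X yx by auto
      have *: "h' y / h' x * (y \<bullet> x) \<in> \<int>" "h' x / h' y * (x \<bullet> y) \<in> \<int>"
        using yx2 xy hx by (auto simp: h'_def inner_commute real_div_sqrt)
      consider "d = y" "e = y" | "d = y" "e \<in> X" "e \<noteq> y" | "d \<in> X" "e = y" "d \<noteq> y" | "d \<in> X" "e \<in> X" "d \<noteq> y" "e \<noteq> y"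
        using de xy by (auto simp: X'_def)
      then show ?thesis
      proof cases
        case 1
        then show ?thesis using norm[OF xy(2)] hx by (simp add: h'_def)
      next
        case 2
        then show ?thesis using *(1) only[of e] by (cases "e = x") auto
      next
        case 3
        then show ?thesis using *(2) only[of d] by (cases "d = x") (auto simp: inner_commute)
      next
        case 4
        then show ?thesis using X(3) by (simp add: h'_def good_def)
      qed
    qed
    ultimately have "good X' h'" using le2 by (simp add: good_def)
    then show ?case using X' by blast
  qed
  moreover have "card D > 0" using finD ne by (simp add: card_gt_0_iff)
  ultimately obtain X h where X: "X \<subseteq> D" "card X = card D" "good X h"
    by (metis Suc_pred order_refl)
  then have "X = D" using finD by (simp add: card_subset_eq)
  then show thesis using that[of h] X(3) by (auto simp: good_def)
qed

text \<open>Rescaling the simple roots \<open>d\<close> to length factors \<open>h d\<close> and reflecting rescales every root.\<close>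

inductive_set scaled_roots :: "'a::euclidean_space set \<Rightarrow> ('a \<Rightarrow> real) \<Rightarrow> 'a set" for D h where
  base: "d \<in> D \<Longrightarrow> h d *\<^sub>R d \<in> scaled_roots D h"
| step: "d \<in> D \<Longrightarrow> p \<in> scaled_roots D h \<Longrightarrow> rf d p \<in> scaled_roots D h"

lemma rf_scaleR: "rf d (s *\<^sub>R p) = s *\<^sub>R rf d p"
  by (simp add: rf_def algebra_simps)

lemma reflection_isometry:
  assumes "d \<bullet> d = 2"
  shows "reflection (rf d q) p = rf d (reflection q (rf d p))"
proof -
  have "p \<bullet> rf d q = rf d p \<bullet> q" using rf_inner[OF assms, of "rf d p" q] rf_rf[OF assms] by metis
  moreover have "rf d (reflection q (rf d p)) = rf d (rf d p) - (2 * (rf d p \<bullet> q) / (q \<bullet> q)) *\<^sub>R rf d q"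
    unfolding reflection_inner by (simp add: rf_def inner_diff_right algebra_simps)
  ultimately show ?thesis
    using rf_inner[OF assms, of q q] rf_rf[OF assms, of p] by (simp add: reflection_inner)
qed

text \<open>The rescaled roots form a crystallographic root system: they lie in the lattice \<open>L\<close> spanned by the
  rescaled simple roots, which the simple reflections preserve. The circuit is rescaled to roots of
  this system, with the same acuteness graph.\<close>

lemma scaled_root_system_disconnected:
  fixes a :: "'i \<Rightarrow> 'a::euclidean_space"
  assumes R: "normalised R" and D: "simple_system R D"
    and h: "\<And>d. d \<in> D \<Longrightarrow> h d > 0" "\<And>d e. d \<in> D \<Longrightarrow> e \<in> D \<Longrightarrow> h d / h e * (d \<bullet> e) \<in> \<int>"
    and fin: "finite I" and card: "card I \<ge> 2" and a: "\<And>i. i \<in> I \<Longrightarrow> a i \<in> R"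
    and c: "\<And>i. i \<in> I \<Longrightarrow> c i > 0" and rel: "only_relation I a c"
  shows "\<not> acute_connected I a"
proof -
  have finD: "finite D" using simple_system_finite[OF R D] .
  have norm: "d \<bullet> d = 2" if "d \<in> D" for d using R D that by (auto simp: normalised_def simple_system_def)
  define P where "P = scaled_roots D h"
  have P_root: "\<exists>s>0. \<exists>q\<in>R. p = s *\<^sub>R q" if "p \<in> P" for p
    using that unfolding P_def
  proof induction
    case (base d)
    then have "d \<in> R" using D by (auto simp: simple_system_def)
    then show ?case using h(1)[OF base] by blast
  next
    case (step d p)
    then obtain s q where "s > 0" "q \<in> R" "p = s *\<^sub>R q" by auto
    moreover have "rf d q \<in> R" using R D step \<open>q \<in> R\<close> by (auto simp: normalised_def simple_system_def)
    ultimately show ?case using rf_scaleR by metis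
  qed
  have scale_ex: "\<exists>s>0. s *\<^sub>R q \<in> P" if "q \<in> R" for q
    using that unfolding roots_in_orbit[OF R D, symmetric]
  proof induction
    case (base d)
    then show ?case using h scaled_roots.base unfolding P_def by blast
  next
    case (step d q)
    then show ?case using scaled_roots.step[of d D _ h] rf_scaleR unfolding P_def by metis
  qed
  define L where "L = {v. \<exists>n :: 'a \<Rightarrow> int. v = (\<Sum>d\<in>D. (of_int (n d) * h d) *\<^sub>R d)}"
  have L_base: "h d *\<^sub>R d \<in> L" if "d \<in> D" for d
    unfolding L_def using that finD
    by (auto simp: if_distrib[of "\<lambda>t. (of_int t * _) *\<^sub>R _"] if_distrib[of "\<lambda>t. t *\<^sub>R _"] cong: if_cong intro!: exI[of _ "\<lambda>e. if e = d then 1 else 0"])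
  have L_rf: "rf e v \<in> L" if e: "e \<in> D" and v: "v \<in> L" for e v
  proof -
    obtain n :: "'a \<Rightarrow> int" where n: "v = (\<Sum>d\<in>D. (of_int (n d) * h d) *\<^sub>R d)" using v by (auto simp: L_def)
    have "(e \<bullet> v) / h e = (\<Sum>d\<in>D. of_int (n d) * (h d / h e * (d \<bullet> e)))"
      by (simp add: n inner_sum_right sum_divide_distrib inner_commute mult.assoc)
    moreover have "of_int (n d) * (h d / h e * (d \<bullet> e)) \<in> \<int>" if "d \<in> D" for d
      by (rule Ints_mult[OF Ints_of_int h(2)[OF that e]])
    ultimately have "(e \<bullet> v) / h e \<in> \<int>" by (metis (no_types, lifting) Ints_sum)
    then obtain k :: int where "(e \<bullet> v) / h e = k" by (auto elim: Ints_cases)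
    then have k: "e \<bullet> v = k * h e" using h(1)[OF e] by (simp add: field_simps)
    have "rf e v = (\<Sum>d\<in>D. (of_int (n d) * h d) *\<^sub>R d) - (\<Sum>d\<in>D. (if d = e then of_int k * h e else 0) *\<^sub>R d)"
      using finD e by (simp add: rf_def k n[symmetric] if_distrib[of "\<lambda>t. t *\<^sub>R _"] cong: if_cong)
    also have "\<dots> = (\<Sum>d\<in>D. (of_int (n d - (if d = e then k else 0)) * h d) *\<^sub>R d)"
      unfolding sum_subtractf[symmetric] by (intro sum.cong refl) (auto simp: algebra_simps)
    finally show ?thesis
      unfolding L_def mem_Collect_eq by (intro exI[of _ "\<lambda>d. n d - (if d = e then k else 0)"])
  qed
  have P_L: "p \<in> L" if "p \<in> P" for p
    using that unfolding P_def by induction (use L_base L_rf in auto)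
  have integral: "2 * (v \<bullet> p) / (p \<bullet> p) \<in> \<int>" if "p \<in> P" "v \<in> L" for p v
    using that unfolding P_def
  proof (induction arbitrary: v)
    case (base d)
    obtain n :: "'a \<Rightarrow> int" where n: "v = (\<Sum>e\<in>D. (of_int (n e) * h e) *\<^sub>R e)" using base by (auto simp: L_def)
    have "2 * (v \<bullet> (h d *\<^sub>R d)) / ((h d *\<^sub>R d) \<bullet> (h d *\<^sub>R d)) = (v \<bullet> d) / h d"
      using norm[OF base(1)] h(1)[OF base(1)] by simp
    also have "\<dots> = (\<Sum>e\<in>D. of_int (n e) * (h e / h d * (e \<bullet> d)))"
      by (simp add: n inner_sum_left sum_divide_distrib mult.assoc)
    also have "\<dots> \<in> \<int>"
      by (rule Ints_sum, rule Ints_mult[OF Ints_of_int h(2)[OF _ base(1)]])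
    finally show ?case .
  next
    case (step d p)
    have "v \<bullet> rf d p = rf d v \<bullet> p" "rf d p \<bullet> rf d p = p \<bullet> p"
      using rf_inner[OF norm[OF step(1)], of "rf d v" p] rf_inner[OF norm[OF step(1)], of p p] rf_rf[OF norm[OF step(1)], of v] by auto
    then show ?case using step.IH[OF L_rf[OF step(1) step.prems]] by simp
  qed
  have P_closed: "reflection q p \<in> P" if "q \<in> P" "p \<in> P" for p q
    using that unfolding P_def
  proof (induction arbitrary: p)
    case (base d)
    have "reflection (h d *\<^sub>R d) p = rf d p"
      using norm[OF base(1)] h(1)[OF base(1)] by (simp add: reflection_inner rf_def inner_commute)
    then show ?case using scaled_roots.step[OF base] by simp
  next
    case (step d q)
    then show ?case using reflection_isometry[OF norm[OF step(1)]] scaled_roots.step by metis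
  qed
  have "\<forall>i\<in>I. \<exists>s. s > 0 \<and> s *\<^sub>R a i \<in> P" using scale_ex a by blast
  from bchoice[OF this] obtain s where s: "\<And>i. i \<in> I \<Longrightarrow> s i > 0 \<and> s i *\<^sub>R a i \<in> P" by blast
  define b where "b i = s i *\<^sub>R a i" for i
  have relb: "only_relation I b (\<lambda>i. c i / s i)"
    unfolding only_relation_def
  proof (intro conjI allI impI)
    have "(\<Sum>i\<in>I. (c i / s i) *\<^sub>R b i) = (\<Sum>i\<in>I. c i *\<^sub>R a i)"
      using s by (intro sum.cong refl) (force simp: b_def)
    then show "(\<Sum>i\<in>I. (c i / s i) *\<^sub>R b i) = 0" using rel by (simp add: only_relation_def)
    fix d assume d: "(\<Sum>i\<in>I. d i *\<^sub>R b i) = 0"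
    then have "(\<Sum>i\<in>I. (d i * s i) *\<^sub>R a i) = 0" by (simp add: b_def)
    then obtain t where t: "\<forall>i\<in>I. d i * s i = t * c i"
      using rel[unfolded only_relation_def, THEN conjunct2, rule_format, of "\<lambda>i. d i * s i"] by metis
    then have "\<forall>i\<in>I. d i = t * (c i / s i)" using s by (force simp: field_simps)
    then show "\<exists>t. \<forall>i\<in>I. d i = t * (c i / s i)" by blast
  qed
  have P0: "0 \<notin> P" using P_root R by (force simp: normalised_def)
  have bP: "b i \<in> P" if "i \<in> I" for i using s[OF that] by (simp add: b_def)
  have int: "2 * (p \<bullet> q) / (q \<bullet> q) \<in> \<int>" if "p \<in> P" "q \<in> P" for p q
    using integral that P_L by blast
  have ne: "I \<noteq> {}" using card by auto
  obtain n :: "'i \<Rightarrow> int" where n: "\<And>i. i \<in> I \<Longrightarrow> n i > 0" "only_relation I b (\<lambda>i. of_int (n i))"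
    "\<And>g. g > 0 \<Longrightarrow> (\<And>i. i \<in> I \<Longrightarrow> g dvd n i) \<Longrightarrow> g = 1"
  proof (rule integer_relation[OF fin ne relb])
    show "c i / s i > 0" if "i \<in> I" for i using c[OF that] s[OF that] by simp
    show "b i \<noteq> 0" if "i \<in> I" for i using bP[OF that] P0 by auto
    show "2 * (b i \<bullet> b j) / (b j \<bullet> b j) \<in> \<int>" if "i \<in> I" "j \<in> I" for i j using int bP that by blast
  qed blast
  have "\<not> acute_connected I b"
    by (rule crystallographic_circuit_disconnected[OF fin card P0 _ int bP n(1,2)]) (use P_closed n(3) in auto)
  moreover have "b i \<bullet> b j > 0 \<longleftrightarrow> a i \<bullet> a j > 0" if "i \<in> I" "j \<in> I" for i j
    using s[OF that(1)] s[OF that(2)] by (simp add: b_def zero_less_mult_iff not_less)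
  ultimately show ?thesis unfolding acute_connected_def by (metis DiffD1 subset_iff)
qed

section \<open>Diagrams with the golden ratio\<close>

text \<open>Each other way of linking further simple roots to the pair \<open>p\<close>, \<open>q\<close> is excluded by a nonnegative
  combination whose square length would not be positive. The weights are rounded null vectors of
  the forbidden diagrams: a triangle, a label 4 or a branch next to the golden edge, an edge at
  both of its ends, a label 4 further away, and a chain or branch with five vertices.\<close>

lemma golden_diagram:
  assumes R: "normalised R" and D: "simple_system R D" and l: "linked D" and c3: "card D \<ge> 3"
    and pq: "p \<in> D" "q \<in> D" "p \<noteq> q" "p \<bullet> q = - phi"
  obtains a b c d where "a \<bullet> a = 2" "b \<bullet> b = 2" "c \<bullet> c = 2" "a \<bullet> b = - phi" "b \<bullet> c = -1" "a \<bullet> c = 0"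
    "D = {a, b, c} \<and> d = 0 \<or> D = {a, b, c, d} \<and> d \<bullet> d = 2 \<and> c \<bullet> d = -1 \<and> a \<bullet> d = 0 \<and> b \<bullet> d = 0"
proof -
  have norm: "d \<bullet> d = 2" if "d \<in> D" for d using R D that by (auto simp: normalised_def simple_system_def)
  have obt: "d \<bullet> e \<le> 0" if "d \<in> D" "e \<in> D" "d \<noteq> e" for d e using D that by (auto simp: simple_system_def)
  have lab1: "d \<bullet> e = 0 \<or> d \<bullet> e \<le> -1" if "d \<in> D" "e \<in> D" "d \<noteq> e" for d e using label_ge_1[OF R D that] by blast
  have lab2: "d \<bullet> e \<ge> -1 \<or> d \<bullet> e \<le> - (14/10)" if "d \<in> D" "e \<in> D" "d \<noteq> e" for d e
  proof -
    have b: "sqrt 2 \<ge> 14/10" "sqrt 3 \<ge> 14/10" by (rule real_le_rsqrt, simp add: power2_eq_square)+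
    from simple_pair_label[OF R D that] show ?thesis
      by (elim disjE) (use b phi_bounds in linarith)+
  qed
  note pos = simple_combination_positive[OF D]
  have ph: "phi * phi = phi + 1" "phi > 1618/1000" "phi < 16181/10000" using phi_square phi_bounds by auto
  have n_both: "p \<bullet> r = 0" if "p \<in> D" "q \<in> D" "p \<noteq> q" "p \<bullet> q = - phi" "r \<in> D" "r \<noteq> p" "r \<noteq> q" "q \<bullet> r \<noteq> 0" for p q r
  proof (rule ccontr)
    assume "p \<bullet> r \<noteq> 0"
    then have "p \<bullet> r \<le> -1" "q \<bullet> r \<le> -1" using lab1 that by metis+
    moreover have "0 < 6 + 2 * (p \<bullet> q) + 2 * (p \<bullet> r) + 2 * (q \<bullet> r)"
      using pos[of p q r p p 1 1 1 0 0] that norm by (simp add: inner_add_left inner_add_right inner_commute)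
    ultimately show False using that ph by linarith
  qed
  have n_one: "q \<bullet> r = -1" if "p \<in> D" "q \<in> D" "p \<noteq> q" "p \<bullet> q = - phi" "r \<in> D" "r \<noteq> p" "r \<noteq> q" "q \<bullet> r \<noteq> 0" for p q r
  proof (rule ccontr)
    assume "q \<bullet> r \<noteq> -1"
    then have "q \<bullet> r \<le> - (14/10)" using lab1[of q r] lab2[of q r] that by (smt (verit))
    moreover have "p \<bullet> r = 0" using n_both that by blast
    moreover have "0 < 8 + 2 * (phi * phi) + 2 * (14/10) * (14/10) + 4 * phi * (p \<bullet> q) + 4 * (14/10) * (q \<bullet> r) + 2 * phi * (14/10) * (p \<bullet> r)"
      using pos[of q p r p p 2 phi "14/10" 0 0] that norm ph by (simp add: inner_add_left inner_add_right inner_commute algebra_simps)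
    ultimately show False using that ph by (simp add: algebra_simps)
  qed
  have n_two: False if "p \<in> D" "q \<in> D" "p \<noteq> q" "p \<bullet> q = - phi" "r \<in> D" "r \<noteq> p" "r \<noteq> q" "q \<bullet> r \<noteq> 0"
    "s \<in> D" "s \<noteq> p" "s \<noteq> q" "q \<bullet> s \<noteq> 0" "r \<noteq> s" for p q r s
  proof -
    have "q \<bullet> r = -1" "q \<bullet> s = -1" "p \<bullet> r = 0" "p \<bullet> s = 0" using n_one n_both that by blast+
    moreover have "r \<bullet> s \<le> 0" using obt that by auto
    moreover have "0 < 12 + 2 * (phi * phi) + 4 * phi * (p \<bullet> q) + 4 * (q \<bullet> r) + 4 * (q \<bullet> s) + 2 * phi * (p \<bullet> r) + 2 * phi * (p \<bullet> s) + 2 * (r \<bullet> s)"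
      using pos[of q p r s p 2 phi 1 1 0] that norm ph by (simp add: inner_add_left inner_add_right inner_commute algebra_simps)
    ultimately show False using that ph by (simp add: algebra_simps)
  qed
  have n_three: False if "p \<in> D" "q \<in> D" "p \<noteq> q" "p \<bullet> q = - phi" "r \<in> D" "r \<noteq> p" "r \<noteq> q" "q \<bullet> r \<noteq> 0"
    "s \<in> D" "s \<noteq> p" "s \<noteq> q" "p \<bullet> s \<noteq> 0" for p q r s
  proof -
    have qp: "q \<bullet> p = - phi" using that by (simp add: inner_commute)
    have v: "q \<bullet> r = -1" "p \<bullet> s = -1" "p \<bullet> r = 0" "q \<bullet> s = 0" using n_one n_both qp that by metis+
    moreover have "r \<bullet> s \<le> 0" using obt[of r s] that v by (cases "r = s") auto
    moreover have "0 < 4 * (13/5) * (13/5) + 4 + 2 * (13/5) * (13/5) * (p \<bullet> q) + 2 * (13/5) * (q \<bullet> r) + 2 * (13/5) * (q \<bullet> s) + 2 * (13/5) * (p \<bullet> r) + 2 * (13/5) * (p \<bullet> s) + 2 * (r \<bullet> s)"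
      using pos[of p q r s p "13/5" "13/5" 1 1 0] that norm ph by (simp add: inner_add_left inner_add_right inner_commute algebra_simps)
    ultimately show False using that ph by (simp add: algebra_simps)
  qed
  have "card {p, q} \<le> 2" by (simp add: card_insert_if)
  then have "{p, q} \<noteq> D" using c3 by auto
  then obtain x r where xr: "x \<in> {p, q}" "r \<in> D" "r \<notin> {p, q}" "x \<bullet> r \<noteq> 0"
    using l pq unfolding linked_def by (metis Diff_iff empty_not_insert empty_subsetI insert_subset)
  obtain a b c where abc: "a \<in> D" "b \<in> D" "a \<noteq> b" "a \<bullet> b = - phi" "c \<in> D" "c \<noteq> a" "c \<noteq> b" "b \<bullet> c \<noteq> 0"
    using xr pq that by (metis inner_commute insertE singletonD insertCI)
  have ac: "a \<bullet> c = 0" and bc: "b \<bullet> c = -1" using n_both n_one abc by blast+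
  have ea: "a \<bullet> e = 0" and eb: "b \<bullet> e = 0" if "e \<in> D" "e \<notin> {a, b, c}" for e
    using n_two[of a b c e] n_three[of a b c e] abc that by auto
  show thesis
  proof (cases "D = {a, b, c}")
    case True
    then show thesis using that[of a b c 0] abc ac bc norm by auto
  next
    case False
    then obtain x d where xd: "x \<in> {a, b, c}" "d \<in> D" "d \<notin> {a, b, c}" "x \<bullet> d \<noteq> 0"
      using l abc unfolding linked_def by (metis Diff_iff empty_not_insert empty_subsetI insert_subset)
    then have cd0: "c \<bullet> d \<noteq> 0" using ea eb by auto
    have da: "a \<bullet> d = 0" "b \<bullet> d = 0" using ea eb xd by auto
    have cd: "c \<bullet> d = -1"
    proof (rule ccontr)
      assume "c \<bullet> d \<noteq> -1"
      then have "c \<bullet> d \<le> - (14/10)" using lab1[of c d] lab2[of c d] cd0 abc xd by (smt (verit) insertCI)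
      moreover have "0 < 4 + 2 * (phi/2) * (phi/2) + 2 * (7/10) * (7/10) + phi * (a \<bullet> b) + 2 * (b \<bullet> c) + 2 * (7/10) * (c \<bullet> d)"
        using pos[of b a c d a 1 "phi/2" 1 "7/10" 0] abc xd norm ph ac da by (simp add: inner_add_left inner_add_right inner_commute algebra_simps)
      moreover have "phi * (a \<bullet> b) = - (phi * phi)" using abc by simp
      ultimately show False using bc ph by linarith
    qed
    have "D = {a, b, c, d}"
    proof (rule ccontr)
      assume "D \<noteq> {a, b, c, d}"
      then obtain x e where xe: "x \<in> {a, b, c, d}" "e \<in> D" "e \<notin> {a, b, c, d}" "x \<bullet> e \<noteq> 0"
        using l abc xd unfolding linked_def by (metis Diff_iff empty_not_insert empty_subsetI insert_subset)
      have e: "a \<bullet> e = 0" "b \<bullet> e = 0" using ea eb xe by auto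
      have de: "d \<bullet> e \<le> 0" "c \<bullet> e \<le> 0" using obt[of d e] obt[of c e] xe xd abc by auto
      have "c \<bullet> e \<le> -1 \<or> d \<bullet> e \<le> -1" using xe e lab1[of c e] lab1[of d e] abc xd by auto
      then show False
      proof
        assume "c \<bullet> e \<le> -1"
        moreover have "0 < 4 + 2 * (phi/2) * (phi/2) + 1 + phi * (a \<bullet> b) + 2 * (b \<bullet> c) + (c \<bullet> d) + (c \<bullet> e) + (d \<bullet> e) / 2"
          using pos[of b a c d e 1 "phi/2" 1 "1/2" "1/2"] abc xd xe norm ph ac da e by (simp add: inner_add_left inner_add_right inner_commute algebra_simps)
        moreover have "phi * (a \<bullet> b) = - (phi * phi)" using abc by simp
        ultimately show False using bc cd ph de by linarith
      next
        assume "d \<bullet> e \<le> -1"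
        moreover have "0 < 60 + 8 * (phi * phi) + 16 * phi * (a \<bullet> b) + 24 * (b \<bullet> c) + 12 * (c \<bullet> d) + 6 * (c \<bullet> e) + 4 * (d \<bullet> e)"
          using pos[of b a c d e 4 "2 * phi" 3 2 1] abc xd xe norm ph ac da e by (simp add: inner_add_left inner_add_right inner_commute algebra_simps)
        moreover have "phi * (a \<bullet> b) = - (phi * phi)" using abc by simp
        ultimately show False using bc cd ph de by linarith
      qed
    qed
    then show thesis using that[of a b c d] abc ac bc cd da norm xd by auto
  qed
qed

text \<open>Galois conjugation in \<open>\<int>[\<phi>]\<close>, as a relation between real numbers.\<close>

definition conjugates :: "real \<Rightarrow> real \<Rightarrow> bool" where
  "conjugates r s \<longleftrightarrow> (\<exists>m n :: int. r = of_int m + of_int n * phi \<and> s = of_int m + of_int n * (1 - phi))"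

lemma conjugates_0: "conjugates 0 0" and conjugates_1: "conjugates 1 1" and conjugates_phi: "conjugates phi (1 - phi)"
  unfolding conjugates_def by (rule exI[of _ 0], rule exI[of _ 0], simp) (rule exI[of _ 1], rule exI[of _ 0], simp, rule exI[of _ 0], rule exI[of _ 1], simp)

lemma conjugates_add: "conjugates r s \<Longrightarrow> conjugates r' s' \<Longrightarrow> conjugates (r + r') (s + s')"
  unfolding conjugates_def
proof (elim exE conjE)
  fix m n m' n' :: int
  assume "r = of_int m + of_int n * phi" "s = of_int m + of_int n * (1 - phi)"
    "r' = of_int m' + of_int n' * phi" "s' = of_int m' + of_int n' * (1 - phi)"
  then show "\<exists>m n :: int. r + r' = of_int m + of_int n * phi \<and> s + s' = of_int m + of_int n * (1 - phi)"
    by (intro exI[of _ "m + m'"] exI[of _ "n + n'"]) (simp add: algebra_simps)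
qed

lemma conjugates_minus: "conjugates r s \<Longrightarrow> conjugates (- r) (- s)"
  unfolding conjugates_def
proof (elim exE conjE)
  fix m n :: int
  assume "r = of_int m + of_int n * phi" "s = of_int m + of_int n * (1 - phi)"
  then show "\<exists>m n :: int. - r = of_int m + of_int n * phi \<and> - s = of_int m + of_int n * (1 - phi)"
    by (intro exI[of _ "- m"] exI[of _ "- n"]) (simp add: algebra_simps)
qed

lemma conjugates_diff: "conjugates r s \<Longrightarrow> conjugates r' s' \<Longrightarrow> conjugates (r - r') (s - s')"
  using conjugates_add[of r s "- r'" "- s'"] conjugates_minus by auto

lemma conjugates_mult: "conjugates r s \<Longrightarrow> conjugates r' s' \<Longrightarrow> conjugates (r * r') (s * s')"
  unfolding conjugates_def
proof (elim exE conjE)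
  fix m n m' n' :: int
  assume e: "r = of_int m + of_int n * phi" "s = of_int m + of_int n * (1 - phi)"
    "r' = of_int m' + of_int n' * phi" "s' = of_int m' + of_int n' * (1 - phi)"
  have "r * r' = of_int (m * m') + of_int (m * n' + n * m') * phi + of_int (n * n') * (phi * phi)"
    "s * s' = of_int (m * m') + of_int (m * n' + n * m') * (1 - phi) + of_int (n * n') * (1 - phi - phi + phi * phi)"
    unfolding e by (simp_all add: algebra_simps)
  then show "\<exists>m n :: int. r * r' = of_int m + of_int n * phi \<and> s * s' = of_int m + of_int n * (1 - phi)"
    unfolding phi_square
    by (intro exI[of _ "m * m' + n * n'"] exI[of _ "m * n' + n * m' + n * n'"]) (simp add: algebra_simps)
qed

text \<open>The difference between a number of \<open>\<int>[\<phi>]\<close> and its conjugate is an integer multiple of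
  \<open>sqrt 5\<close>, so only finitely many numbers are bounded by \<open>2\<close> together with their conjugates.\<close>

lemma conjugates_small:
  assumes "conjugates r s" "\<bar>r\<bar> \<le> 2" "\<bar>s\<bar> \<le> 2"
  shows "r \<in> {0, 1, -1, 2, -2, phi, - phi, phi - 1, 1 - phi}"
proof -
  obtain m n :: int where e: "r = of_int m + of_int n * phi" "s = of_int m + of_int n * (1 - phi)"
    using assms(1) by (auto simp: conjugates_def)
  have "r - s = of_int n * (2 * phi - 1)" by (simp add: e algebra_simps)
  then have "\<bar>real_of_int n\<bar> * (2 * phi - 1) \<le> 4" using assms phi_bounds by (simp add: abs_mult[symmetric])
  moreover have "2 * (2 * phi - 1) \<le> \<bar>real_of_int n\<bar> * (2 * phi - 1)" if "\<bar>real_of_int n\<bar> \<ge> 2"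
    using that phi_bounds(1) by (intro mult_right_mono) auto
  ultimately have "\<not> \<bar>real_of_int n\<bar> \<ge> 2" using phi_bounds(1) by auto
  then have "n = 0 \<or> n = 1 \<or> n = -1" by linarith
  then show ?thesis
  proof (elim disjE)
    assume n: "n = 0"
    then have "m = 0 \<or> m = 1 \<or> m = -1 \<or> m = 2 \<or> m = -2" using assms(2) e by auto
    then show ?thesis using n e by auto
  next
    assume n: "n = 1"
    then have "real_of_int m < 1" "real_of_int m > -2" using assms e phi_bounds by auto
    then have "m = 0 \<or> m = -1" by linarith
    then show ?thesis using n e by auto
  next
    assume n: "n = -1"
    then have "real_of_int m < 2" "real_of_int m > -1" using assms e phi_bounds by auto
    then have "m = 0 \<or> m = 1" by linarith
    then show ?thesis using n e by auto
  qed
qed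

text \<open>In a root system with this diagram the coordinates of the roots lie in \<open>\<int>[\<phi>]\<close>.
  Conjugating them gives vectors of square length two for the conjugate form, which is positive
  definite as well, so both an inner product of two roots and its conjugate lie between
  \<open>-2\<close> and \<open>2\<close>.\<close>

definition conj_form :: "real \<times> real \<times> real \<times> real \<Rightarrow> real \<times> real \<times> real \<times> real \<Rightarrow> real" where
  "conj_form y z = (case y of (y1, y2, y3, y4) \<Rightarrow> case z of (z1, z2, z3, z4) \<Rightarrow>
     2 * (y1 * z1 + y2 * z2 + y3 * z3 + y4 * z4) - (1 - phi) * (y1 * z2 + y2 * z1)
     - (y2 * z3 + y3 * z2) - (y3 * z4 + y4 * z3))"

text \<open>Completing squares, from the fourth coordinate downwards.\<close>

lemma conj_form_nonneg: "conj_form (y1, y2, y3, y4) (y1, y2, y3, y4) \<ge> 0"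
proof -
  have "conj_form (y1, y2, y3, y4) (y1, y2, y3, y4) =
    2 * (y4 - y3 / 2)\<^sup>2 + 3 / 2 * (y3 - 2 / 3 * y2)\<^sup>2 + 2 * (y1 + (phi - 1) / 2 * y2)\<^sup>2 + (4 / 3 - (phi - 1)\<^sup>2 / 2) * y2\<^sup>2"
    by (simp add: conj_form_def power2_eq_square field_simps)
  moreover have "(phi - 1)\<^sup>2 \<le> 1\<^sup>2" using phi_bounds by (intro power_mono) auto
  ultimately show ?thesis by simp
qed

lemma golden_inner_products:
  assumes R: "normalised R" and D: "simple_system R D" and l: "linked D" and c3: "card D \<ge> 3"
    and pq: "p \<in> D" "q \<in> D" "p \<noteq> q" "p \<bullet> q = - phi" and rs: "r \<in> R" "s \<in> R"
  shows "r \<bullet> s \<in> {0, 1, -1, 2, -2, phi, - phi, phi - 1, 1 - phi}"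
proof -
  obtain a b c d where abc: "a \<bullet> a = 2" "b \<bullet> b = 2" "c \<bullet> c = 2" "a \<bullet> b = - phi" "b \<bullet> c = -1" "a \<bullet> c = 0"
    and dd: "D = {a, b, c} \<and> d = 0 \<or> D = {a, b, c, d} \<and> d \<bullet> d = 2 \<and> c \<bullet> d = -1 \<and> a \<bullet> d = 0 \<and> b \<bullet> d = 0"
    by (rule golden_diagram[OF R D l c3 pq])
  have ad: "a \<bullet> d = 0" "b \<bullet> d = 0" and dd': "d = 0 \<or> d \<bullet> d = 2 \<and> c \<bullet> d = -1" using dd by auto
  note ip = abc ad inner_commute[of b a] inner_commute[of c a] inner_commute[of d a] inner_commute[of c b]
    inner_commute[of d b] inner_commute[of d c]
  have norm: "p \<bullet> p = 2" if "p \<in> R" for p using R that by (auto simp: normalised_def)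
  define co where "co p x y \<longleftrightarrow> (case x of (x1, x2, x3, x4) \<Rightarrow> case y of (y1, y2, y3, y4) \<Rightarrow>
     p = x1 *\<^sub>R a + x2 *\<^sub>R b + x3 *\<^sub>R c + x4 *\<^sub>R d \<and> (d = 0 \<longrightarrow> x4 = 0 \<and> y4 = 0) \<and>
     conjugates x1 y1 \<and> conjugates x2 y2 \<and> conjugates x3 y3 \<and> conjugates x4 y4)"
    for p :: 'a and x y :: "real \<times> real \<times> real \<times> real"
  have co: "\<exists>x y. co p x y \<and> conj_form y y = 2" if "p \<in> R" for p
    using that unfolding roots_in_orbit[OF R D, symmetric]
  proof induction
    case (base e)
    consider "e = a" | "e = b" | "e = c" | "e = d" "d \<bullet> d = 2" using base dd by auto
    then show ?case
    proof cases
      case 1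
      then show ?thesis by (intro exI[of _ "(1, 0, 0, 0)"]) (simp add: co_def conj_form_def conjugates_0 conjugates_1)
    next
      case 2
      then show ?thesis by (intro exI[of _ "(0, 1, 0, 0)"]) (simp add: co_def conj_form_def conjugates_0 conjugates_1)
    next
      case 3
      then show ?thesis by (intro exI[of _ "(0, 0, 1, 0)"]) (simp add: co_def conj_form_def conjugates_0 conjugates_1)
    next
      case 4
      then have "d \<noteq> 0" by auto
      then show ?thesis using 4 by (intro exI[of _ "(0, 0, 0, 1)"]) (simp add: co_def conj_form_def conjugates_0 conjugates_1)
    qed
  next
    case (step e p)
    then obtain x y where xy: "co p x y" "conj_form y y = 2" by blast
    obtain x1 x2 x3 x4 where x: "x = (x1, x2, x3, x4)" by (cases x)
    obtain y1 y2 y3 y4 where y: "y = (y1, y2, y3, y4)" by (cases y)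
    from xy have p: "p = x1 *\<^sub>R a + x2 *\<^sub>R b + x3 *\<^sub>R c + x4 *\<^sub>R d"
      and z: "d = 0 \<longrightarrow> x4 = 0 \<and> y4 = 0" and conjugates: "conjugates x1 y1" "conjugates x2 y2" "conjugates x3 y3" "conjugates x4 y4"
      and Q: "conj_form (y1, y2, y3, y4) (y1, y2, y3, y4) = 2"
      by (simp_all add: co_def x y)
    have cd: "x4 * (c \<bullet> d) = - x4" using z dd' by auto
    consider "e = a" | "e = b" | "e = c" | "e = d" "d \<bullet> d = 2" "c \<bullet> d = -1" using step dd by auto
    then show ?case
    proof cases
      case 1
      have "rf a p = (phi * x2 - x1) *\<^sub>R a + x2 *\<^sub>R b + x3 *\<^sub>R c + x4 *\<^sub>R d"
        by (simp add: p rf_def inner_add_right ip algebra_simps) (simp flip: scaleR_2 scaleR_add_left)?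
      then have "co (rf a p) (phi * x2 - x1, x2, x3, x4) ((1 - phi) * y2 - y1, y2, y3, y4)"
        using conjugates z by (auto simp: co_def intro!: conjugates_diff conjugates_mult conjugates_phi)
      moreover have "conj_form ((1 - phi) * y2 - y1, y2, y3, y4) ((1 - phi) * y2 - y1, y2, y3, y4) = 2"
        using Q by (simp add: conj_form_def algebra_simps)
      ultimately show ?thesis using 1 by blast
    next
      case 2
      have "rf b p = x1 *\<^sub>R a + (phi * x1 + x3 - x2) *\<^sub>R b + x3 *\<^sub>R c + x4 *\<^sub>R d"
        by (simp add: p rf_def inner_add_right ip algebra_simps) (simp flip: scaleR_2 scaleR_add_left)?
      then have "co (rf b p) (x1, phi * x1 + x3 - x2, x3, x4) (y1, (1 - phi) * y1 + y3 - y2, y3, y4)"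
        using conjugates z by (auto simp: co_def intro!: conjugates_diff conjugates_add conjugates_mult conjugates_phi)
      moreover have "conj_form (y1, (1 - phi) * y1 + y3 - y2, y3, y4) (y1, (1 - phi) * y1 + y3 - y2, y3, y4) = 2"
        using Q by (simp add: conj_form_def algebra_simps)
      ultimately show ?thesis using 2 by blast
    next
      case 3
      have "rf c p = x1 *\<^sub>R a + x2 *\<^sub>R b + (x2 + x4 - x3) *\<^sub>R c + x4 *\<^sub>R d"
        using cd by (simp add: p rf_def inner_add_right ip algebra_simps) (simp flip: scaleR_2 scaleR_add_left)?
      then have "co (rf c p) (x1, x2, x2 + x4 - x3, x4) (y1, y2, y2 + y4 - y3, y4)"
        using conjugates z by (auto simp: co_def intro!: conjugates_diff conjugates_add)
      moreover have "conj_form (y1, y2, y2 + y4 - y3, y4) (y1, y2, y2 + y4 - y3, y4) = 2"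
        using Q by (simp add: conj_form_def algebra_simps)
      ultimately show ?thesis using 3 by blast
    next
      case 4
      have dn: "d \<noteq> 0" using 4 by auto
      have "rf d p = x1 *\<^sub>R a + x2 *\<^sub>R b + x3 *\<^sub>R c + (x3 - x4) *\<^sub>R d"
        by (simp add: p rf_def inner_add_right ip 4 algebra_simps) (simp flip: scaleR_2 scaleR_add_left)?
      then have "co (rf d p) (x1, x2, x3, x3 - x4) (y1, y2, y3, y3 - y4)"
        using conjugates dn by (auto simp: co_def intro!: conjugates_diff)
      moreover have "conj_form (y1, y2, y3, y3 - y4) (y1, y2, y3, y3 - y4) = 2"
        using Q by (simp add: conj_form_def algebra_simps)
      ultimately show ?thesis using 4(1) by blast
    qed
  qed
  obtain x y where xy: "co r x y" "conj_form y y = 2" using co[OF rs(1)] by blast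
  obtain x1 x2 x3 x4 where x: "x = (x1, x2, x3, x4)" by (cases x)
  obtain y1 y2 y3 y4 where y: "y = (y1, y2, y3, y4)" by (cases y)
  from xy have r: "r = x1 *\<^sub>R a + x2 *\<^sub>R b + x3 *\<^sub>R c + x4 *\<^sub>R d"
      and rz: "d = 0 \<longrightarrow> x4 = 0 \<and> y4 = 0" and rc: "conjugates x1 y1" "conjugates x2 y2" "conjugates x3 y3" "conjugates x4 y4"
      and rQ: "conj_form (y1, y2, y3, y4) (y1, y2, y3, y4) = 2"
    by (simp_all add: co_def x y)
  obtain v w where vw: "co s v w" "conj_form w w = 2" using co[OF rs(2)] by blast
  obtain v1 v2 v3 v4 where v: "v = (v1, v2, v3, v4)" by (cases v)
  obtain w1 w2 w3 w4 where w: "w = (w1, w2, w3, w4)" by (cases w)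
  from vw have s: "s = v1 *\<^sub>R a + v2 *\<^sub>R b + v3 *\<^sub>R c + v4 *\<^sub>R d"
      and sz: "d = 0 \<longrightarrow> v4 = 0 \<and> w4 = 0" and sc: "conjugates v1 w1" "conjugates v2 w2" "conjugates v3 w3" "conjugates v4 w4"
      and sQ: "conj_form (w1, w2, w3, w4) (w1, w2, w3, w4) = 2"
    by (simp_all add: co_def v w)
  have rsv: "r \<bullet> s = (1 + 1) * (x1 * v1 + x2 * v2 + x3 * v3 + x4 * v4) - phi * (x1 * v2 + x2 * v1)
     - (x2 * v3 + x3 * v2) - (x3 * v4 + x4 * v3)"
  proof (cases "d = 0")
    case True
    then show ?thesis using rz sz by (simp add: r s inner_add_left inner_add_right ip algebra_simps)
  next
    case False
    then have "d \<bullet> d = 2" "c \<bullet> d = -1" using dd' by auto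
    then show ?thesis by (simp add: r s inner_add_left inner_add_right ip algebra_simps)
  qed
  define f where "f = conj_form (y1, y2, y3, y4) (w1, w2, w3, w4)"
  have f: "f = (1 + 1) * (y1 * w1 + y2 * w2 + y3 * w3 + y4 * w4) - (1 - phi) * (y1 * w2 + y2 * w1)
     - (y2 * w3 + y3 * w2) - (y3 * w4 + y4 * w3)"
    by (simp add: f_def conj_form_def)
  have "conjugates (r \<bullet> s) f"
    unfolding rsv f by (intro conjugates_diff conjugates_add conjugates_mult conjugates_phi conjugates_1 rc sc)
  moreover have "\<bar>r \<bullet> s\<bar> \<le> 2"
  proof -
    have "\<bar>r \<bullet> s\<bar> \<le> norm r * norm s" by (rule Cauchy_Schwarz_ineq2)
    also have "\<dots> = 2" using norm[OF rs(1)] norm[OF rs(2)] by (simp add: norm_eq_sqrt_inner)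
    finally show ?thesis .
  qed
  moreover have "\<bar>f\<bar> \<le> 2"
  proof -
    have "0 \<le> 2 + 2 * f + 2"
      using conj_form_nonneg[of "y1 + w1" "y2 + w2" "y3 + w3" "y4 + w4"] rQ sQ
      by (simp add: f conj_form_def algebra_simps)
    moreover have "0 \<le> 2 - 2 * f + 2"
      using conj_form_nonneg[of "y1 - w1" "y2 - w2" "y3 - w3" "y4 - w4"] rQ sQ
      by (simp add: f conj_form_def algebra_simps)
    ultimately show ?thesis by linarith
  qed
  ultimately show ?thesis by (rule conjugates_small)
qed

section \<open>Golden angles and spherical triangles\<close>

lemma phi_bounds_fine: "161803/100000 < phi" "phi < 161804/100000"
proof -
  have "0 < phi" using phi_bounds by linarith
  have "161803/100000 * phi \<ge> phi * phi" if "phi \<le> 161803/100000"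
    using that \<open>0 < phi\<close> by (intro mult_right_mono) auto
  then show "161803/100000 < phi" using phi_square by linarith
  have "161804/100000 * phi \<le> phi * phi" if "phi \<ge> 161804/100000"
    using that \<open>0 < phi\<close> by (intro mult_right_mono) auto
  then show "phi < 161804/100000" using phi_square by linarith
qed

text \<open>The angle \<open>t\<close>, in degrees, between two vectors of square length two with product \<open>g = 2 cos t\<close>.
  With the angle as a number, comparisons of products and triangle inequalities are all linear.\<close>

definition angle :: "real \<Rightarrow> real \<Rightarrow> bool" where
  "angle t g \<longleftrightarrow> (t, g) \<in> {(36, phi), (60, 1), (72, phi - 1), (90, 0), (108, 1 - phi), (120, - 1), (144, - phi)}"

lemma angle_cases:
  assumes "angle t g"
  obtains "t = 36" "g = phi" | "t = 60" "g = 1" | "t = 72" "g = phi - 1" | "t = 90" "g = 0" | "t = 108" "g = 1 - phi" | "t = 120" "g = - 1" | "t = 144" "g = - phi"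
  using assms unfolding angle_def by auto

lemma angle_le: "angle t g \<Longrightarrow> t \<le> 144" and angle_ge: "angle t g \<Longrightarrow> 36 \<le> t"
  by (auto elim!: angle_cases)

lemma angle_above36: "angle t g \<Longrightarrow> (t \<le> 36 \<Longrightarrow> False) \<Longrightarrow> 60 \<le> t"
  by (auto elim!: angle_cases)

lemma angle_above60: "angle t g \<Longrightarrow> (t \<le> 60 \<Longrightarrow> False) \<Longrightarrow> 72 \<le> t"
  and angle_below60: "angle t g \<Longrightarrow> (72 \<le> t \<Longrightarrow> False) \<Longrightarrow> t \<le> 60"
  by (auto elim!: angle_cases)

lemma angle_split72: "angle t g \<Longrightarrow> (t \<le> 72 \<Longrightarrow> P) \<Longrightarrow> (90 \<le> t \<Longrightarrow> P) \<Longrightarrow> P"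
  and angle_above72: "angle t g \<Longrightarrow> (t \<le> 72 \<Longrightarrow> False) \<Longrightarrow> 90 \<le> t"
  and angle_below72: "angle t g \<Longrightarrow> (90 \<le> t \<Longrightarrow> False) \<Longrightarrow> t \<le> 72"
  by (auto elim!: angle_cases)

lemma angle_split90: "angle t g \<Longrightarrow> (t \<le> 90 \<Longrightarrow> P) \<Longrightarrow> (108 \<le> t \<Longrightarrow> P) \<Longrightarrow> P"
  and angle_above90: "angle t g \<Longrightarrow> (t \<le> 90 \<Longrightarrow> False) \<Longrightarrow> 108 \<le> t"
  by (auto elim!: angle_cases)

lemma angle_split108: "angle t g \<Longrightarrow> (t \<le> 108 \<Longrightarrow> P) \<Longrightarrow> (120 \<le> t \<Longrightarrow> P) \<Longrightarrow> P"
  and angle_above108: "angle t g \<Longrightarrow> (t \<le> 108 \<Longrightarrow> False) \<Longrightarrow> 120 \<le> t"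
  and angle_below108: "angle t g \<Longrightarrow> (120 \<le> t \<Longrightarrow> False) \<Longrightarrow> t \<le> 108"
  by (auto elim!: angle_cases)

lemma angle_split120: "angle t g \<Longrightarrow> (t \<le> 120 \<Longrightarrow> P) \<Longrightarrow> (144 \<le> t \<Longrightarrow> P) \<Longrightarrow> P"
  and angle_above120: "angle t g \<Longrightarrow> (t \<le> 120 \<Longrightarrow> False) \<Longrightarrow> 144 \<le> t"
  and angle_below120: "angle t g \<Longrightarrow> (144 \<le> t \<Longrightarrow> False) \<Longrightarrow> t \<le> 120"
  by (auto elim!: angle_cases)

lemma lower36: "angle t g \<Longrightarrow> t \<le> 36 \<Longrightarrow> 0 < c \<Longrightarrow> 161803/100000 * c \<le> g * c"
  and upper36: "angle t g \<Longrightarrow> 36 \<le> t \<Longrightarrow> 0 < c \<Longrightarrow> g * c \<le> 161804/100000 * c"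
  by (intro mult_right_mono less_imp_le[of 0 c]; (assumption | (use phi_bounds_fine in \<open>elim angle_cases; simp\<close>)))+

lemma lower60: "angle t g \<Longrightarrow> t \<le> 60 \<Longrightarrow> 0 < c \<Longrightarrow> 1 * c \<le> g * c"
  and angle_eq60: "angle t g \<Longrightarrow> 60 \<le> t \<Longrightarrow> t \<le> 60 \<Longrightarrow> g = 1"
  by (intro mult_right_mono less_imp_le[of 0 c]; (assumption | (use phi_bounds_fine in \<open>elim angle_cases; simp\<close>)))+
    (use phi_bounds_fine in \<open>elim angle_cases; simp\<close>)

lemma lower72: "angle t g \<Longrightarrow> t \<le> 72 \<Longrightarrow> 0 < c \<Longrightarrow> 61803/100000 * c \<le> g * c"
  and angle_eq72: "angle t g \<Longrightarrow> 72 \<le> t \<Longrightarrow> t \<le> 72 \<Longrightarrow> g = phi - 1"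
  by (intro mult_right_mono less_imp_le[of 0 c]; (assumption | (use phi_bounds_fine in \<open>elim angle_cases; simp\<close>)))+
    (use phi_bounds_fine in \<open>elim angle_cases; simp\<close>)

lemma lower90: "angle t g \<Longrightarrow> t \<le> 90 \<Longrightarrow> 0 < c \<Longrightarrow> 0 * c \<le> g * c"
  and upper90: "angle t g \<Longrightarrow> 90 \<le> t \<Longrightarrow> 0 < c \<Longrightarrow> g * c \<le> 0 * c"
  and angle_eq90: "angle t g \<Longrightarrow> 90 \<le> t \<Longrightarrow> t \<le> 90 \<Longrightarrow> g = 0"
  by (intro mult_right_mono less_imp_le[of 0 c]; (assumption | (use phi_bounds_fine in \<open>elim angle_cases; simp\<close>)))+
    (use phi_bounds_fine in \<open>elim angle_cases; simp\<close>)

lemma lower108: "angle t g \<Longrightarrow> t \<le> 108 \<Longrightarrow> 0 < c \<Longrightarrow> -61804/100000 * c \<le> g * c"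
  and upper108: "angle t g \<Longrightarrow> 108 \<le> t \<Longrightarrow> 0 < c \<Longrightarrow> g * c \<le> -61803/100000 * c"
  by (intro mult_right_mono less_imp_le[of 0 c]; (assumption | (use phi_bounds_fine in \<open>elim angle_cases; simp\<close>)))+

lemma lower120: "angle t g \<Longrightarrow> t \<le> 120 \<Longrightarrow> 0 < c \<Longrightarrow> -1 * c \<le> g * c"
  and angle_eq120: "angle t g \<Longrightarrow> 120 \<le> t \<Longrightarrow> t \<le> 120 \<Longrightarrow> g = - 1"
  by (intro mult_right_mono less_imp_le[of 0 c]; (assumption | (use phi_bounds_fine in \<open>elim angle_cases; simp\<close>)))+
    (use phi_bounds_fine in \<open>elim angle_cases; simp\<close>)

lemma lower144: "angle t g \<Longrightarrow> t \<le> 144 \<Longrightarrow> 0 < c \<Longrightarrow> -161804/100000 * c \<le> g * c"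
  and upper144: "angle t g \<Longrightarrow> 144 \<le> t \<Longrightarrow> 0 < c \<Longrightarrow> g * c \<le> -161803/100000 * c"
  and angle_eq144: "angle t g \<Longrightarrow> 144 \<le> t \<Longrightarrow> t \<le> 144 \<Longrightarrow> g = - phi"
  by (intro mult_right_mono less_imp_le[of 0 c]; (assumption | (use phi_bounds_fine in \<open>elim angle_cases; simp\<close>)))+
    (use phi_bounds_fine in \<open>elim angle_cases; simp\<close>)

text \<open>The inequalities between the angles that three linearly independent vectors form pairwise.\<close>

definition triangle :: "real \<Rightarrow> real \<Rightarrow> real \<Rightarrow> bool" where
  "triangle x y z \<longleftrightarrow> x < y + z \<and> y < x + z \<and> z < x + y \<and> x + y + z < 360"

lemma triangle_1: "triangle x y z \<Longrightarrow> x < y + z" and triangle_2: "triangle x y z \<Longrightarrow> y < x + z"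
  and triangle_3: "triangle x y z \<Longrightarrow> z < x + y" and triangle_4: "triangle x y z \<Longrightarrow> x + y + z < 360"
  by (auto simp: triangle_def)

text \<open>The assumption says that the Gram determinant of the three vectors is positive. It factors into
  sines of half sums of the angles, which relates it to the triangle inequalities; for the finitely
  many golden angles the products are compared directly.\<close>

lemma angle_sum_bound:
  assumes "angle x p" "angle y q" "angle z r" "4 + p * q * r > p * p + q * q + r * r"
  shows "z < x + y" "x + y + z < 360"
proof -
  have phi: "phi * phi = phi + 1" "phi * (phi * phi) = 2 * phi + 1" "161803/100000 < phi" "phi < 161804/100000"
    using phi_square phi_bounds_fine by (simp_all add: algebra_simps)
  have "z < x + y \<and> x + y + z < 360"
    using assms
    by (elim angle_cases; hypsubst; simp add: algebra_simps phi) (use phi in linarith)+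
  then show "z < x + y" "x + y + z < 360" by auto
qed

lemma angle_triangle:
  assumes "angle x p" "angle y q" "angle z r" "4 + p * q * r > p * p + q * q + r * r"
  shows "triangle x y z"
  using angle_sum_bound[OF assms(1-3)] angle_sum_bound[OF assms(1,3,2)] angle_sum_bound[OF assms(2,3,1)] assms(4)
  unfolding triangle_def by (simp add: algebra_simps)

section \<open>Golden circuits with four or five vectors\<close>

text \<open>The variables \<open>u\<close>, \<open>a\<close>, \<open>b\<close>, \<open>v\<close> are the coefficients of the vertices of a path, \<open>ua\<close> is the
  product of the vectors at \<open>u\<close> and \<open>a\<close>, and \<open>tua\<close> the angle between them. As \<open>u\<close> is largest, the
  rows of \<open>u\<close> and \<open>b\<close> force an angle of 144 degrees between \<open>u\<close> and \<open>b\<close>, but it is less than twice 72.\<close>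

lemma golden_four:
  fixes u a b v ua ub uv ab bv tua tub tuv tab tbv :: real
  assumes pu: "0 < u" and pa: "0 < a" and pb: "0 < b" and pv: "0 < v" and mv: "v \<le> u"
    and ru: "2 * u + ua * a + ub * b + uv * v = 0"
    and rb: "2 * b + ub * u + ab * a + bv * v = 0"
    and gua: "angle tua ua" and gub: "angle tub ub" and guv: "angle tuv uv" and gab: "angle tab ab" and gbv: "angle tbv bv"
    and tuab: "triangle tua tub tab"
    and eua: "tua \<le> 72" and eab: "tab \<le> 72" and ebv: "tbv \<le> 72"
  shows False
proof -
  have h2: "144 \<le> tub"
  proof (rule angle_above120[OF gub])
    assume h1: "tub \<le> 120" show False using pu pa pb pv ru rb mv lower72[OF gua eua pa] lower120[OF gub h1 pb] lower120[OF gub h1 pu] lower144[OF guv angle_le[OF guv] pv] lower72[OF gab eab pa] lower72[OF gbv ebv pv] by linarith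
  qed
  show False using triangle_2[OF tuab] h2 eua eab by linarith
qed

text \<open>The same for five vectors. Here \<open>u\<close> and \<open>v\<close> have no common neighbour, \<open>a\<close> is a neighbour of \<open>u\<close>
  and \<open>b\<close> one of \<open>v\<close>; the position of \<open>w\<close> is open, apart from connectedness
  (\<open>conn_w\<close>, \<open>conn_ua\<close>, \<open>conn_bv\<close>) and a choice between isomorphic labellings (\<open>ex1\<close> to \<open>ex4\<close>).

  The proof is a decision tree which bisects the range of one angle at a time. Replacing each product
  by the bounds for its angle turns the rows of the relation into linear inequalities between the
  coefficients, and a branch ends when these or the triangle inequalities are contradictory. In a few
  branches all six angles between four of the vectors are fixed and their Gram matrix
  is degenerate: the hypotheses \<open>quabv\<close> and \<open>qubvw\<close> state positivity of the square length for the null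
  vectors of these matrices.\<close>

lemma golden_five:
  fixes u a b v w ua ub uv uw ab av aw bv bw vw tua tub tuv tuw tab tav taw tbv tbw tvw :: real
  assumes pu: "0 < u" and pa: "0 < a" and pb: "0 < b" and pv: "0 < v" and pw: "0 < w"
    and ma: "a \<le> u" and mb: "b \<le> u" and mv: "v \<le> u" and mw: "w \<le> u"
    and ru: "2 * u + ua * a + ub * b + uv * v + uw * w = 0"
    and ra: "2 * a + ua * u + ab * b + av * v + aw * w = 0"
    and rb: "2 * b + ub * u + ab * a + bv * v + bw * w = 0"
    and rv: "2 * v + uv * u + av * a + bv * b + vw * w = 0"
    and rw: "2 * w + uw * u + aw * a + bw * b + vw * v = 0"
    and gua: "angle tua ua" and gub: "angle tub ub" and guv: "angle tuv uv" and guw: "angle tuw uw" and gab: "angle tab ab" and gav: "angle tav av" and gaw: "angle taw aw" and gbv: "angle tbv bv" and gbw: "angle tbw bw" and gvw: "angle tvw vw"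
    and tuab: "triangle tua tub tab"
    and tuav: "triangle tua tuv tav"
    and tuaw: "triangle tua tuw taw"
    and tubv: "triangle tub tuv tbv"
    and tubw: "triangle tub tuw tbw"
    and tuvw: "triangle tuv tuw tvw"
    and tabv: "triangle tab tav tbv"
    and tabw: "triangle tab taw tbw"
    and tbvw: "triangle tbv tbw tvw"
    and eua: "tua \<le> 72" and ebv: "tbv \<le> 72"
    and conn_w: "tuw \<le> 72 \<or> taw \<le> 72 \<or> tbw \<le> 72 \<or> tvw \<le> 72"
    and conn_ua: "tuw \<le> 72 \<or> taw \<le> 72 \<or> tab \<le> 72"
    and conn_bv: "tab \<le> 72 \<or> tbw \<le> 72 \<or> tvw \<le> 72"
    and far_w: "90 \<le> tuw \<or> 90 \<le> tvw"
    and ex1: "90 \<le> tvw \<or> tbw \<le> 72 \<or> tab \<le> 72"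
    and ex2: "90 \<le> tvw \<or> taw \<le> 72 \<or> tbw \<le> 72"
    and ex3: "90 \<le> tuw \<or> 90 \<le> tbw \<or> taw \<le> 72 \<or> tab \<le> 72"
    and ex4: "90 \<le> tvw \<or> 90 \<le> taw \<or> 90 \<le> tbw \<or> tab \<le> 72"
    and quabv: "0 < 8 + 2 * (ua + ub + uv + ab + av + bv)"
      "0 < 4 * phi + 8 + 2 * phi * ua + 2 * phi * ub + 2 * (phi + 1) * uv + 2 * ab + 2 * phi * av + 2 * phi * bv"
    and qubvw: "0 < 8 + 2 * (ub + uv + uw + bv + bw + vw)"
      "0 < 8 * phi + 10 + 2 * (phi + 1) * ub + 2 * (2 * phi + 1) * uv + 2 * (phi + 1) * uw + 2 * phi * bv + 2 * bw + 2 * phi * vw"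
  shows False
proof -
  \<comment> \<open>The facts \<open>lxy\<close> and \<open>kxy\<close> bound the angle \<open>txy\<close>; \<open>xy_x\<close> bounds the product \<open>xy * x\<close> below, and a
    number at its end refers to the hypothesis on \<open>txy\<close> from which the bound comes.\<close>
  note pos = pu pa pb pv pw
  note lab = angle_le[OF gab]
  note lav = angle_le[OF gav]
  note law = angle_le[OF gaw]
  note lbw = angle_le[OF gbw]
  note lub = angle_le[OF gub]
  note luv = angle_le[OF guv]
  note luw = angle_le[OF guw]
  note lvw = angle_le[OF gvw]
  note kaw = angle_ge[OF gaw]
  note kbw = angle_ge[OF gbw]
  note ua_a = lower72[OF gua eua pa]
  note uv_v = lower144[OF guv luv pv]
  note bv_v = lower72[OF gbv ebv pv]
  note ua_u = lower72[OF gua eua pu]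
  note av_v = lower144[OF gav lav pv]
  note bw_w = lower144[OF gbw lbw pw]
  note uv_u = lower144[OF guv luv pu]
  note av_a = lower144[OF gav lav pa]
  note bv_b = lower72[OF gbv ebv pb]
  note vw_w = lower144[OF gvw lvw pw]
  note ub_b = lower144[OF gub lub pb]
  note uw_w = lower144[OF guw luw pw]
  note uw_u = lower144[OF guw luw pu]
  note ub_u = lower144[OF gub lub pu]
  show False
  proof (rule angle_split72[OF guw])
   assume h1: "tuw \<le> 72"
   note uw_w1 = lower72[OF guw h1 pw]
   have h4: "90 \<le> tvw"
   proof (rule angle_above72[OF gvw])
    assume h3: "tvw \<le> 72" show False using far_w h1 h3 by (elim disjE) linarith+
   qed
   show False
   proof (rule angle_split72[OF gaw])
    assume h5: "taw \<le> 72"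
    show False
    proof (rule angle_split72[OF gbw])
     assume h7: "tbw \<le> 72"
     show False
     proof (rule angle_split72[OF gab])
      assume h9: "tab \<le> 72"
      have h12: "144 \<le> tub"
      proof (rule angle_above120[OF gub])
       assume h11: "tub \<le> 120" show False using pos ru rb mv ua_a lower120[OF gub h11 pb] lower120[OF gub h11 pu] uv_v uw_w1 lower72[OF gab h9 pa] bv_v lower72[OF gbw h7 pw] by linarith
      qed
      show False using triangle_2[OF tuab] h12 eua h9 by linarith
     next
      assume h10: "90 \<le> tab"
      have h14: "144 \<le> tub"
      proof (rule angle_above120[OF gub])
       assume h13: "tub \<le> 120" show False using pos ru rb rw mv ua_a lower120[OF gub h13 pb] lower120[OF gub h13 pu] uv_v uw_w1 lower72[OF guw h1 pu] lower144[OF gab lab pa] lower72[OF gaw h5 pa] bv_v lower72[OF gbw h7 pw] lower72[OF gbw h7 pb] lower144[OF gvw lvw pv] by linarith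
      qed
      show False using triangle_1[OF tubw] h14 h1 h7 by linarith
     qed
    next
     assume h8: "90 \<le> tbw"
     have h16: "tab \<le> 72"
     proof (rule angle_below72[OF gab])
      assume h15: "90 \<le> tab" show False using conn_bv h15 h8 h4 by (elim disjE) linarith+
     qed
     have h18: "144 \<le> tub"
     proof (rule angle_above120[OF gub])
      assume h17: "tub \<le> 120" show False using pos ru ra rb mv ua_a ua_u lower120[OF gub h17 pb] lower120[OF gub h17 pu] uv_v uw_w1 lower72[OF gab h16 pb] lower72[OF gab h16 pa] av_v lower72[OF gaw h5 pw] bv_v bw_w by linarith
     qed
     show False using triangle_2[OF tuab] h18 eua h16 by linarith
    qed
   next
    assume h6: "90 \<le> taw"
    show False
    proof (rule angle_split72[OF gbw])
     assume h19: "tbw \<le> 72"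
     have h22: "tab \<le> 72"
     proof (rule angle_below72[OF gab])
      assume h21: "90 \<le> tab" show False using ex3 h1 h19 h6 h21 by (elim disjE) linarith+
     qed
     have h24: "144 \<le> tub"
     proof (rule angle_above120[OF gub])
      assume h23: "tub \<le> 120" show False using pos ru rb mv ua_a lower120[OF gub h23 pb] lower120[OF gub h23 pu] uv_v uw_w1 lower72[OF gab h22 pa] bv_v lower72[OF gbw h19 pw] by linarith
     qed
     show False using triangle_2[OF tuab] h24 eua h22 by linarith
    next
     assume h20: "90 \<le> tbw"
     have h26: "tab \<le> 72"
     proof (rule angle_below72[OF gab])
      assume h25: "90 \<le> tab" show False using conn_bv h25 h20 h4 by (elim disjE) linarith+
     qed
     note ab_a26 = lower72[OF gab h26 pa]
     have h28: "120 \<le> tub"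
     proof (rule angle_above108[OF gub])
      assume h27: "tub \<le> 108" show False using pos ru rv mb mv ua_a lower108[OF gub h27 pb] uv_v uv_u uw_w1 av_a bv_b vw_w by linarith
     qed
     have h30: "tub \<le> 120"
     proof (rule angle_below120[OF gub])
      assume h29: "144 \<le> tub" show False using triangle_2[OF tuab] h29 eua h26 by linarith
     qed
     note ub_b30 = lower120[OF gub h30 pb]
     note ub_u30 = lower120[OF gub h30 pu]
     have h32: "144 \<le> tuv"
     proof (rule angle_above120[OF guv])
      assume h31: "tuv \<le> 120" show False using pos ru mb mv ua_a ub_b30 lower120[OF guv h31 pv] uw_w1 by linarith
     qed
     have h34: "72 \<le> tuw"
     proof (rule angle_above60[OF guw])
      assume h33: "tuw \<le> 60" show False using pos ru rb mv ua_a ub_b30 ub_u30 uv_v lower60[OF guw h33 pw] ab_a26 bv_v bw_w by linarith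
     qed
     have h36: "144 \<le> tbw"
     proof (rule angle_above120[OF gbw])
      assume h35: "tbw \<le> 120" show False using pos ru rb mv ua_a ub_b30 ub_u30 uv_v uw_w1 ab_a26 bv_v lower120[OF gbw h35 pw] by linarith
     qed
     have h38: "72 \<le> tbv"
     proof (rule angle_above60[OF gbv])
      assume h37: "tbv \<le> 60" show False using pos ru rb mv mw ua_a ub_b30 ub_u30 uv_v uw_w1 ab_a26 lower60[OF gbv h37 pv] bw_w by linarith
     qed
     have h40: "120 \<le> tvw"
     proof (rule angle_above108[OF gvw])
      assume h39: "tvw \<le> 108" show False using pos ru rb rw mv ua_a ub_b30 ub_u30 uv_v uw_w1 lower72[OF guw h1 pu] ab_a26 lower144[OF gaw law pa] bv_v bw_w lower144[OF gbw lbw pb] lower108[OF gvw h39 pv] by linarith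
     qed
     have h42: "144 \<le> tvw"
     proof (rule angle_above120[OF gvw])
      assume h41: "tvw \<le> 120" show False using qubvw angle_eq120[OF gub h28 h30] angle_eq144[OF guv h32 luv] angle_eq72[OF guw h34 h1] angle_eq72[OF gbv h38 ebv] angle_eq144[OF gbw h36 lbw] angle_eq120[OF gvw h40 h41] phi_square by (simp add: algebra_simps)
     qed
     show False using triangle_4[OF tuvw] h32 h34 h42 by linarith
    qed
   qed
  next
   assume h2: "90 \<le> tuw"
   show False
   proof (rule angle_split72[OF gvw])
    assume h43: "tvw \<le> 72"
    show False
    proof (rule angle_split72[OF gaw])
     assume h45: "taw \<le> 72"
     show False
     proof (rule angle_split72[OF gbw])
      assume h47: "tbw \<le> 72"
      have h50: "tab \<le> 72"
      proof (rule angle_below72[OF gab])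
       assume h49: "90 \<le> tab" show False using ex4 h43 h45 h47 h49 by (elim disjE) linarith+
      qed
      have h52: "144 \<le> tav"
      proof (rule angle_above120[OF gav])
       assume h51: "tav \<le> 120" show False using pos ru ra rv ua_a ua_u ub_b uv_v uv_u uw_w lower72[OF gab h50 pb] lower120[OF gav h51 pv] lower120[OF gav h51 pa] lower72[OF gaw h45 pw] bv_b lower72[OF gvw h43 pw] by linarith
      qed
      show False using triangle_2[OF tabv] h52 h50 ebv by linarith
     next
      assume h48: "90 \<le> tbw"
      have h54: "tab \<le> 72"
      proof (rule angle_below72[OF gab])
       assume h53: "90 \<le> tab" show False using ex1 h43 h48 h53 by (elim disjE) linarith+
      qed
      have h56: "144 \<le> tav"
      proof (rule angle_above120[OF gav])
       assume h55: "tav \<le> 120" show False using pos ru ra rv ua_a ua_u ub_b uv_v uv_u uw_w lower72[OF gab h54 pb] lower120[OF gav h55 pv] lower120[OF gav h55 pa] lower72[OF gaw h45 pw] bv_b lower72[OF gvw h43 pw] by linarith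
      qed
      show False using triangle_2[OF tabv] h56 h54 ebv by linarith
     qed
    next
     assume h46: "90 \<le> taw"
     have h58: "tbw \<le> 72"
     proof (rule angle_below72[OF gbw])
      assume h57: "90 \<le> tbw" show False using ex2 h43 h46 h57 by (elim disjE) linarith+
     qed
     note bw_w58 = lower72[OF gbw h58 pw]
     note bw_b58 = lower72[OF gbw h58 pb]
     have h60: "tab \<le> 72"
     proof (rule angle_below72[OF gab])
      assume h59: "90 \<le> tab" show False using conn_ua h2 h46 h59 by (elim disjE) linarith+
     qed
     note ab_a60 = lower72[OF gab h60 pa]
     have h62: "tub \<le> 120"
     proof (rule angle_below120[OF gub])
      assume h61: "144 \<le> tub" show False using triangle_2[OF tuab] h61 eua h60 by linarith
     qed
     note ub_b62 = lower120[OF gub h62 pb]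
     note ub_u62 = lower120[OF gub h62 pu]
     have h64: "tav \<le> 120"
     proof (rule angle_below120[OF gav])
      assume h63: "144 \<le> tav" show False using triangle_2[OF tabv] h63 h60 ebv by linarith
     qed
     have h66: "taw \<le> 120"
     proof (rule angle_below120[OF gaw])
      assume h65: "144 \<le> taw" show False using triangle_2[OF tabw] h65 h60 h58 by linarith
     qed
     note aw_a66 = lower120[OF gaw h66 pa]
     have h68: "144 \<le> tuv"
     proof (rule angle_above120[OF guv])
      assume h67: "tuv \<le> 120" show False using pos ru rb rw ua_a ub_b62 ub_u62 lower120[OF guv h67 pv] uw_w uw_u ab_a60 aw_a66 bv_v bw_w58 bw_b58 lower72[OF gvw h43 pv] by linarith
     qed
     have h70: "144 \<le> tuw"
     proof (rule angle_above120[OF guw])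
      assume h69: "tuw \<le> 120" show False using pos ru rb rw mv ua_a ub_b62 ub_u62 uv_v lower120[OF guw h69 pw] lower120[OF guw h69 pu] ab_a60 aw_a66 bv_v bw_w58 bw_b58 lower72[OF gvw h43 pv] by linarith
     qed
     have h72: "72 \<le> tvw"
     proof (rule angle_above60[OF gvw])
      assume h71: "tvw \<le> 60" show False using pos ru rb rv rw ua_a ub_b62 ub_u62 uv_v uv_u uw_w uw_u ab_a60 lower120[OF gav h64 pa] aw_a66 bv_v bv_b bw_w58 bw_b58 lower60[OF gvw h71 pw] lower60[OF gvw h71 pv] by linarith
     qed
     show False using triangle_4[OF tuvw] h68 h70 h72 by linarith
    qed
   next
    assume h44: "90 \<le> tvw"
    show False
    proof (rule angle_split72[OF gaw])
     assume h73: "taw \<le> 72"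
     note aw_w73 = lower72[OF gaw h73 pw]
     note aw_a73 = lower72[OF gaw h73 pa]
     show False
     proof (rule angle_split72[OF gbw])
      assume h75: "tbw \<le> 72"
      note bw_w75 = lower72[OF gbw h75 pw]
      note bw_b75 = lower72[OF gbw h75 pb]
      show False
      proof (rule angle_split72[OF gab])
       assume h77: "tab \<le> 72"
       note ab_b77 = lower72[OF gab h77 pb]
       have h80: "120 \<le> tav"
       proof (rule angle_above108[OF gav])
        assume h79: "tav \<le> 108" show False using pos ra rv ua_u uv_u ab_b77 lower108[OF gav h79 pv] lower108[OF gav h79 pa] aw_w73 bv_b vw_w by linarith
       qed
       have h82: "tvw \<le> 120"
       proof (rule angle_below120[OF gvw])
        assume h81: "144 \<le> tvw" show False using triangle_3[OF tbvw] h81 ebv h75 by linarith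
       qed
       have h84: "tav \<le> 120"
       proof (rule angle_below120[OF gav])
        assume h83: "144 \<le> tav" show False using triangle_2[OF tabv] h83 h77 ebv by linarith
       qed
       note av_v84 = lower120[OF gav h84 pv]
       note av_a84 = lower120[OF gav h84 pa]
       have h86: "72 \<le> tua"
       proof (rule angle_above60[OF gua])
        assume h85: "tua \<le> 60" show False using pos ra mv lower60[OF gua h85 pu] ab_b77 av_v84 aw_w73 by linarith
       qed
       have h88: "144 \<le> tuv"
       proof (rule angle_above120[OF guv])
        assume h87: "tuv \<le> 120" show False using pos ra rv ua_u lower120[OF guv h87 pu] ab_b77 av_v84 av_a84 aw_w73 bv_b lower120[OF gvw h82 pw] by linarith
       qed
       have h90: "108 \<le> tuw"
       proof (rule angle_above90[OF guw])
        assume h89: "tuw \<le> 90" show False using pos ru ra rv mv ua_a ua_u ub_b uv_v uv_u lower90[OF guw h89 pw] ab_b77 av_v84 av_a84 aw_w73 bv_b lower120[OF gvw h82 pw] by linarith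
       qed
       have h92: "108 \<le> tvw"
       proof (rule angle_above90[OF gvw])
        assume h91: "tvw \<le> 90" show False using pos ru ra rv ua_a ua_u ub_b uv_v uv_u uw_w ab_b77 av_v84 av_a84 aw_w73 bv_b lower90[OF gvw h91 pw] by linarith
       qed
       show False using triangle_4[OF tuvw] h88 h90 h92 by linarith
      next
       assume h78: "90 \<le> tab"
       have h94: "tab \<le> 120"
       proof (rule angle_below120[OF gab])
        assume h93: "144 \<le> tab" show False using triangle_1[OF tabw] h93 h73 h75 by linarith
       qed
       note ab_a94 = lower120[OF gab h94 pa]
       note ab_b94 = lower120[OF gab h94 pb]
       have h96: "tvw \<le> 120"
       proof (rule angle_below120[OF gvw])
        assume h95: "144 \<le> tvw" show False using triangle_3[OF tbvw] h95 ebv h75 by linarith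
       qed
       note vw_v96 = lower120[OF gvw h96 pv]
       note vw_w96 = lower120[OF gvw h96 pw]
       have h98: "tuw \<le> 120"
       proof (rule angle_below120[OF guw])
        assume h97: "144 \<le> tuw" show False using triangle_2[OF tuaw] h97 eua h73 by linarith
       qed
       note uw_w98 = lower120[OF guw h98 pw]
       note uw_u98 = lower120[OF guw h98 pu]
       have h100: "120 \<le> tuv"
       proof (rule angle_above108[OF guv])
        assume h99: "tuv \<le> 108" show False using pos ru rb rw mv ua_a ub_b ub_u lower108[OF guv h99 pv] uw_w98 uw_u98 ab_a94 aw_a73 bv_v bw_w75 bw_b75 vw_v96 by linarith
       qed
       have h102: "60 \<le> tbv"
       proof (rule angle_above36[OF gbv])
        assume h101: "tbv \<le> 36" show False using pos ru ra rb mv ua_a ua_u ub_b ub_u uv_v uw_w98 ab_b94 ab_a94 av_v aw_w73 lower36[OF gbv h101 pv] bw_w75 by linarith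
       qed
       have h104: "120 \<le> tub"
       proof (rule angle_above108[OF gub])
        assume h103: "tub \<le> 108" show False using pos ru ra rb mv ua_a ua_u lower108[OF gub h103 pb] lower108[OF gub h103 pu] uv_v uw_w98 ab_b94 ab_a94 av_v aw_w73 bv_v bw_w75 by linarith
       qed
       show False
       proof (rule angle_split90[OF guw])
        assume h105: "tuw \<le> 90"
        note uw_w105 = lower90[OF guw h105 pw]
        note uw_u105 = lower90[OF guw h105 pu]
        have h108: "144 \<le> tuv"
        proof (rule angle_above120[OF guv])
         assume h107: "tuv \<le> 120" show False using pos ru rv rw mv ua_a ub_b lower120[OF guv h107 pv] lower120[OF guv h107 pu] uw_w105 uw_u105 av_a aw_a73 bv_b bw_b75 vw_w96 vw_v96 by linarith
        qed
        have h110: "144 \<le> tub"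
        proof (rule angle_above120[OF gub])
         assume h109: "tub \<le> 120" show False using pos ru rb mv ua_a lower120[OF gub h109 pb] lower120[OF gub h109 pu] uv_v uw_w105 ab_a94 bv_v bw_w75 by linarith
        qed
        have h112: "tbv \<le> 60"
        proof (rule angle_below60[OF gbv])
         assume h111: "72 \<le> tbv" show False using triangle_4[OF tubv] h110 h108 h111 by linarith
        qed
        note bv_b112 = lower60[OF gbv h112 pb]
        have h114: "144 \<le> tav"
        proof (rule angle_above120[OF gav])
         assume h113: "tav \<le> 120" show False using pos ru ra rv rw ua_a ua_u ub_b uv_v uv_u uw_w105 uw_u105 ab_b94 lower120[OF gav h113 pv] lower120[OF gav h113 pa] aw_w73 aw_a73 bv_b112 bw_b75 vw_w96 vw_v96 by linarith
        qed
        have h116: "tua \<le> 60"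
        proof (rule angle_below60[OF gua])
         assume h115: "72 \<le> tua" show False using triangle_4[OF tuav] h115 h108 h114 by linarith
        qed
        have h118: "120 \<le> tab"
        proof (rule angle_above108[OF gab])
         assume h117: "tab \<le> 108" show False using pos ru rb rv mv lower60[OF gua h116 pa] ub_b ub_u uv_v uv_u uw_w105 lower108[OF gab h117 pa] av_a lower60[OF gbv h112 pv] bv_b112 bw_w75 vw_w96 by linarith
        qed
        have h120: "60 \<le> tua"
        proof (rule angle_above36[OF gua])
         assume h119: "tua \<le> 36" show False using pos ra rv rw lower36[OF gua h119 pu] uv_u uw_u105 ab_b94 av_v av_a aw_w73 aw_a73 bv_b112 bw_b75 vw_w96 vw_v96 by linarith
        qed
        show False using quabv angle_eq60[OF gua h120 h116] angle_eq144[OF gub h110 lub] angle_eq144[OF guv h108 luv] angle_eq120[OF gab h118 h94] angle_eq144[OF gav h114 lav] angle_eq60[OF gbv h102 h112] phi_square by (simp add: algebra_simps)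
       next
        assume h106: "108 \<le> tuw"
        have h122: "60 \<le> tua"
        proof (rule angle_above36[OF gua])
         assume h121: "tua \<le> 36" show False using triangle_2[OF tuaw] h106 h121 h73 by linarith
        qed
        have h124: "60 \<le> taw"
        proof (rule angle_above36[OF gaw])
         assume h123: "taw \<le> 36" show False using triangle_2[OF tuaw] h106 eua h123 by linarith
        qed
        show False
        proof (rule angle_split90[OF gvw])
         assume h125: "tvw \<le> 90"
         note vw_w125 = lower90[OF gvw h125 pw]
         note vw_v125 = lower90[OF gvw h125 pv]
         have h128: "144 \<le> tuv"
         proof (rule angle_above120[OF guv])
          assume h127: "tuv \<le> 120" show False using pos ru rb rv rw ua_a ub_b ub_u lower120[OF guv h127 pv] lower120[OF guv h127 pu] uw_w98 uw_u98 ab_a94 av_a aw_a73 bv_v bv_b bw_w75 bw_b75 vw_w125 vw_v125 by linarith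
         qed
         have h130: "144 \<le> tub"
         proof (rule angle_above120[OF gub])
          assume h129: "tub \<le> 120" show False using pos ru rb rv rw mv ua_a lower120[OF gub h129 pb] lower120[OF gub h129 pu] uv_v uv_u uw_w98 uw_u98 ab_a94 av_a aw_a73 bv_v bv_b bw_w75 bw_b75 vw_w125 vw_v125 by linarith
         qed
         have h132: "tbv \<le> 60"
         proof (rule angle_below60[OF gbv])
          assume h131: "72 \<le> tbv" show False using triangle_4[OF tubv] h130 h128 h131 by linarith
         qed
         note bv_v132 = lower60[OF gbv h132 pv]
         note bv_b132 = lower60[OF gbv h132 pb]
         have h134: "120 \<le> tav"
         proof (rule angle_above108[OF gav])
          assume h133: "tav \<le> 108" show False using pos ru ra rb rv ua_a ua_u ub_b ub_u uv_v uv_u uw_w98 ab_b94 ab_a94 lower108[OF gav h133 pv] lower108[OF gav h133 pa] aw_w73 bv_v132 bv_b132 bw_w75 vw_w125 by linarith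
         qed
         show False
         proof (rule angle_split120[OF gav])
          assume h135: "tav \<le> 120"
          have h138: "72 \<le> tbw"
          proof (rule angle_above60[OF gbw])
           assume h137: "tbw \<le> 60" show False using pos ru rb rv rw ua_a ub_b ub_u uv_v uv_u uw_w98 uw_u98 ab_a94 lower120[OF gav h135 pa] aw_a73 bv_v132 bv_b132 lower60[OF gbw h137 pw] lower60[OF gbw h137 pb] vw_w125 vw_v125 by linarith
          qed
          have h140: "120 \<le> tuw"
          proof (rule angle_above108[OF guw])
           assume h139: "tuw \<le> 108" show False using pos ru rb rv rw ua_a ub_b ub_u uv_v uv_u lower108[OF guw h139 pw] lower108[OF guw h139 pu] ab_a94 lower120[OF gav h135 pa] aw_a73 bv_v132 bv_b132 bw_w75 bw_b75 vw_w125 vw_v125 by linarith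
          qed
          show False using qubvw angle_eq144[OF gub h130 lub] angle_eq144[OF guv h128 luv] angle_eq120[OF guw h140 h98] angle_eq60[OF gbv h102 h132] angle_eq72[OF gbw h138 h75] angle_eq90[OF gvw h44 h125] phi_square by (simp add: algebra_simps)
         next
          assume h136: "144 \<le> tav"
          have h142: "tua \<le> 60"
          proof (rule angle_below60[OF gua])
           assume h141: "72 \<le> tua" show False using triangle_4[OF tuav] h141 h128 h136 by linarith
          qed
          have h144: "120 \<le> tuw"
          proof (rule angle_above108[OF guw])
           assume h143: "tuw \<le> 108" show False using pos ru rb rv rw lower60[OF gua h142 pa] ub_b ub_u uv_v uv_u lower108[OF guw h143 pw] lower108[OF guw h143 pu] ab_a94 av_a aw_a73 bv_v132 bv_b132 bw_w75 bw_b75 vw_w125 vw_v125 by linarith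
          qed
          have h146: "tbw \<le> 60"
          proof (rule angle_below60[OF gbw])
           assume h145: "72 \<le> tbw" show False using qubvw angle_eq144[OF gub h130 lub] angle_eq144[OF guv h128 luv] angle_eq120[OF guw h144 h98] angle_eq60[OF gbv h102 h132] angle_eq72[OF gbw h145 h75] angle_eq90[OF gvw h44 h125] phi_square by (simp add: algebra_simps)
          qed
          have h148: "120 \<le> tab"
          proof (rule angle_above108[OF gab])
           assume h147: "tab \<le> 108" show False using pos ru rb rv rw lower60[OF gua h142 pa] ub_b ub_u uv_v uv_u uw_w98 uw_u98 lower108[OF gab h147 pa] av_a aw_a73 bv_v132 bv_b132 lower60[OF gbw h146 pw] lower60[OF gbw h146 pb] vw_w125 vw_v125 by linarith
          qed
          show False using quabv angle_eq60[OF gua h122 h142] angle_eq144[OF gub h130 lub] angle_eq144[OF guv h128 luv] angle_eq120[OF gab h148 h94] angle_eq144[OF gav h136 lav] angle_eq60[OF gbv h102 h132] phi_square by (simp add: algebra_simps)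
         qed
        next
         assume h126: "108 \<le> tvw"
         have h150: "tuv \<le> 120"
         proof (rule angle_below120[OF guv])
          assume h149: "144 \<le> tuv" show False using triangle_4[OF tuvw] h149 h106 h126 by linarith
         qed
         note uv_v150 = lower120[OF guv h150 pv]
         note uv_u150 = lower120[OF guv h150 pu]
         have h152: "144 \<le> tub"
         proof (rule angle_above120[OF gub])
          assume h151: "tub \<le> 120" show False using pos ru rb mv mw ua_a lower120[OF gub h151 pb] lower120[OF gub h151 pu] uv_v150 uw_w98 ab_a94 bv_v bw_w75 by linarith
         qed
         have h154: "120 \<le> tav"
         proof (rule angle_above108[OF gav])
          assume h153: "tav \<le> 108" show False using pos ru ra rb rv ua_a ua_u ub_b ub_u uv_v150 uv_u150 uw_w98 ab_b94 ab_a94 lower108[OF gav h153 pv] lower108[OF gav h153 pa] aw_w73 bv_v bv_b bw_w75 vw_w96 by linarith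
         qed
         have h156: "60 \<le> tbw"
         proof (rule angle_above36[OF gbw])
          assume h155: "tbw \<le> 36" show False using triangle_3[OF tbvw] h126 ebv h155 by linarith
         qed
         show False
         proof (rule angle_split108[OF gvw])
          assume h157: "tvw \<le> 108"
          note vw_w157 = lower108[OF gvw h157 pw]
          note vw_v157 = lower108[OF gvw h157 pv]
          have h160: "120 \<le> tab"
          proof (rule angle_above108[OF gab])
           assume h159: "tab \<le> 108" show False using pos ru rb rv rw mv ua_a ub_b ub_u uv_v150 uv_u150 uw_w98 uw_u98 lower108[OF gab h159 pa] av_a aw_a73 bv_v bv_b bw_w75 bw_b75 vw_w157 vw_v157 by linarith
          qed
          have h162: "72 \<le> tbv"
          proof (rule angle_above60[OF gbv])
           assume h161: "tbv \<le> 60" show False using pos ru rb rw mv ua_a ub_b ub_u uv_v150 uw_w98 uw_u98 ab_a94 aw_a73 lower60[OF gbv h161 pv] bw_w75 bw_b75 vw_v157 by linarith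
          qed
          have h164: "72 \<le> tua"
          proof (rule angle_above60[OF gua])
           assume h163: "tua \<le> 60" show False using pos ru rb rv rw lower60[OF gua h163 pa] ub_b ub_u uv_v150 uv_u150 uw_w98 uw_u98 ab_a94 av_a aw_a73 bv_v bv_b bw_w75 bw_b75 vw_w157 vw_v157 by linarith
          qed
          have h166: "144 \<le> tav"
          proof (rule angle_above120[OF gav])
           assume h165: "tav \<le> 120" show False using pos ru rb rv rw ua_a ub_b ub_u uv_v150 uv_u150 uw_w98 uw_u98 ab_a94 lower120[OF gav h165 pa] aw_a73 bv_v bv_b bw_w75 bw_b75 vw_w157 vw_v157 by linarith
          qed
          show False using quabv angle_eq72[OF gua h164 eua] angle_eq144[OF gub h152 lub] angle_eq120[OF guv h100 h150] angle_eq120[OF gab h160 h94] angle_eq144[OF gav h166 lav] angle_eq72[OF gbv h162 ebv] phi_square by (simp add: algebra_simps)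
         next
          assume h158: "120 \<le> tvw"
          have h168: "tuw \<le> 108"
          proof (rule angle_below108[OF guw])
           assume h167: "120 \<le> tuw" show False using triangle_4[OF tuvw] h100 h167 h158 by linarith
          qed
          note uw_w168 = lower108[OF guw h168 pw]
          note uw_u168 = lower108[OF guw h168 pu]
          have h170: "120 \<le> tab"
          proof (rule angle_above108[OF gab])
           assume h169: "tab \<le> 108" show False using pos ru rb mv mw ua_a ub_b ub_u uv_v150 uw_w168 lower108[OF gab h169 pa] bv_v bw_w75 by linarith
          qed
          have h172: "72 \<le> tua"
          proof (rule angle_above60[OF gua])
           assume h171: "tua \<le> 60" show False using pos ru rv rw mb lower60[OF gua h171 pa] ub_b uv_v150 uv_u150 uw_w168 uw_u168 av_a aw_a73 bv_b bw_b75 vw_w96 vw_v96 by linarith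
          qed
          have h174: "72 \<le> tbv"
          proof (rule angle_above60[OF gbv])
           assume h173: "tbv \<le> 60" show False using pos ru rv rw ma mb ua_a ub_b uv_v150 uv_u150 uw_w168 uw_u168 av_a aw_a73 lower60[OF gbv h173 pb] bw_b75 vw_w96 vw_v96 by linarith
          qed
          have h176: "144 \<le> tav"
          proof (rule angle_above120[OF gav])
           assume h175: "tav \<le> 120" show False using pos ru rv rw mb ua_a ub_b uv_v150 uv_u150 uw_w168 uw_u168 lower120[OF gav h175 pa] aw_a73 bv_b bw_b75 vw_w96 vw_v96 by linarith
          qed
          show False using quabv angle_eq72[OF gua h172 eua] angle_eq144[OF gub h152 lub] angle_eq120[OF guv h100 h150] angle_eq120[OF gab h170 h94] angle_eq144[OF gav h176 lav] angle_eq72[OF gbv h174 ebv] phi_square by (simp add: algebra_simps)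
         qed
        qed
       qed
      qed
     next
      assume h76: "90 \<le> tbw"
      have h178: "tab \<le> 72"
      proof (rule angle_below72[OF gab])
       assume h177: "90 \<le> tab" show False using conn_bv h177 h76 h44 by (elim disjE) linarith+
      qed
      note ab_b178 = lower72[OF gab h178 pb]
      have h180: "120 \<le> tav"
      proof (rule angle_above108[OF gav])
       assume h179: "tav \<le> 108" show False using pos ra rv ua_u uv_u ab_b178 lower108[OF gav h179 pv] lower108[OF gav h179 pa] aw_w73 bv_b vw_w by linarith
      qed
      have h182: "tav \<le> 120"
      proof (rule angle_below120[OF gav])
       assume h181: "144 \<le> tav" show False using triangle_2[OF tabv] h181 h178 ebv by linarith
      qed
      note av_v182 = lower120[OF gav h182 pv]
      note av_a182 = lower120[OF gav h182 pa]
      have h184: "72 \<le> tua"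
      proof (rule angle_above60[OF gua])
       assume h183: "tua \<le> 60" show False using pos ra mv lower60[OF gua h183 pu] ab_b178 av_v182 aw_w73 by linarith
      qed
      have h186: "108 \<le> tvw"
      proof (rule angle_above90[OF gvw])
       assume h185: "tvw \<le> 90" show False using pos ru ra rv ua_a ua_u ub_b uv_v uv_u uw_w ab_b178 av_v182 av_a182 aw_w73 bv_b lower90[OF gvw h185 pw] by linarith
      qed
      have h188: "tvw \<le> 120"
      proof (rule angle_below120[OF gvw])
       assume h187: "144 \<le> tvw" show False using pos ra rw mv ua_u upper90[OF guw h2 pu] ab_b178 av_v182 aw_w73 upper36[OF gaw kaw pa] upper90[OF gbw h76 pb] upper144[OF gvw h187 pv] by linarith
      qed
      have h190: "144 \<le> tuv"
      proof (rule angle_above120[OF guv])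
       assume h189: "tuv \<le> 120" show False using pos ra rv ua_u lower120[OF guv h189 pu] ab_b178 av_v182 av_a182 aw_w73 bv_b lower120[OF gvw h188 pw] by linarith
      qed
      have h192: "108 \<le> tuw"
      proof (rule angle_above90[OF guw])
       assume h191: "tuw \<le> 90" show False using pos ru ra rv mv ua_a ua_u ub_b uv_v uv_u lower90[OF guw h191 pw] ab_b178 av_v182 av_a182 aw_w73 bv_b lower120[OF gvw h188 pw] by linarith
      qed
      show False using triangle_4[OF tuvw] h190 h192 h186 by linarith
     qed
    next
     assume h74: "90 \<le> taw"
     have h194: "tbw \<le> 72"
     proof (rule angle_below72[OF gbw])
      assume h193: "90 \<le> tbw" show False using conn_w h2 h74 h193 h44 by (elim disjE) linarith+
     qed
     note bw_w194 = lower72[OF gbw h194 pw]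
     note bw_b194 = lower72[OF gbw h194 pb]
     have h196: "tab \<le> 72"
     proof (rule angle_below72[OF gab])
      assume h195: "90 \<le> tab" show False using conn_ua h2 h74 h195 by (elim disjE) linarith+
     qed
     note ab_a196 = lower72[OF gab h196 pa]
     have h198: "120 \<le> tub"
     proof (rule angle_above108[OF gub])
      assume h197: "tub \<le> 108" show False using pos ru rb ua_a lower108[OF gub h197 pb] lower108[OF gub h197 pu] uv_v uw_w ab_a196 bv_v bw_w194 by linarith
     qed
     have h200: "60 \<le> tab"
     proof (rule angle_above36[OF gab])
      assume h199: "tab \<le> 36" show False using triangle_2[OF tuab] h198 eua h199 by linarith
     qed
     have h202: "tub \<le> 120"
     proof (rule angle_below120[OF gub])
      assume h201: "144 \<le> tub" show False using triangle_2[OF tuab] h201 eua h196 by linarith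
     qed
     note ub_b202 = lower120[OF gub h202 pb]
     note ub_u202 = lower120[OF gub h202 pu]
     have h204: "108 \<le> tuv"
     proof (rule angle_above90[OF guv])
      assume h203: "tuv \<le> 90" show False using pos ru rb mw ua_a ub_b202 ub_u202 lower90[OF guv h203 pv] uw_w ab_a196 bv_v bw_w194 by linarith
     qed
     have h206: "taw \<le> 120"
     proof (rule angle_below120[OF gaw])
      assume h205: "144 \<le> taw" show False using triangle_2[OF tabw] h205 h196 h194 by linarith
     qed
     note aw_a206 = lower120[OF gaw h206 pa]
     have h208: "60 \<le> tua"
     proof (rule angle_above36[OF gua])
      assume h207: "tua \<le> 36" show False using triangle_2[OF tuab] h198 h207 h196 by linarith
     qed
     have h210: "tvw \<le> 120"
     proof (rule angle_below120[OF gvw])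
      assume h209: "144 \<le> tvw" show False using triangle_3[OF tbvw] h209 ebv h194 by linarith
     qed
     have h212: "60 \<le> tbv"
     proof (rule angle_above36[OF gbv])
      assume h211: "tbv \<le> 36" show False using pos ru rb rw ua_a ub_b202 ub_u202 uv_v uw_w uw_u ab_a196 aw_a206 lower36[OF gbv h211 pv] bw_w194 bw_b194 lower120[OF gvw h210 pv] by linarith
     qed
     have h214: "108 \<le> tuw"
     proof (rule angle_above90[OF guw])
      assume h213: "tuw \<le> 90" show False using pos ru rb mv ua_a ub_b202 ub_u202 uv_v lower90[OF guw h213 pw] ab_a196 bv_v bw_w194 by linarith
     qed
     have h216: "60 \<le> tbw"
     proof (rule angle_above36[OF gbw])
      assume h215: "tbw \<le> 36" show False using pos ru rb rw ua_a ub_b202 ub_u202 uv_v uw_w upper108[OF guw h214 pu] ab_a196 upper90[OF gaw h74 pa] bv_v lower36[OF gbw h215 pw] upper36[OF gbw kbw pb] upper90[OF gvw h44 pv] by linarith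
     qed
     have h218: "tav \<le> 120"
     proof (rule angle_below120[OF gav])
      assume h217: "144 \<le> tav" show False using triangle_2[OF tabv] h217 h196 ebv by linarith
     qed
     show False
     proof (rule angle_split90[OF gvw])
      assume h219: "tvw \<le> 90"
      have h222: "144 \<le> tuw"
      proof (rule angle_above120[OF guw])
       assume h221: "tuw \<le> 120" show False using pos ru rb rv rw ua_a ub_b202 ub_u202 uv_v uv_u lower120[OF guw h221 pw] lower120[OF guw h221 pu] ab_a196 lower120[OF gav h218 pa] aw_a206 bv_v bv_b bw_w194 bw_b194 lower90[OF gvw h219 pw] lower90[OF gvw h219 pv] by linarith
      qed
      have h224: "144 \<le> tuv"
      proof (rule angle_above120[OF guv])
       assume h223: "tuv \<le> 120" show False using pos ru rb rv rw ua_a ub_b202 ub_u202 lower120[OF guv h223 pv] lower120[OF guv h223 pu] uw_w uw_u ab_a196 lower120[OF gav h218 pa] aw_a206 bv_v bv_b bw_w194 bw_b194 lower90[OF gvw h219 pw] lower90[OF gvw h219 pv] by linarith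
      qed
      show False using triangle_4[OF tuvw] h224 h222 h44 by linarith
     next
      assume h220: "108 \<le> tvw"
      have h226: "tuw \<le> 120"
      proof (rule angle_below120[OF guw])
       assume h225: "144 \<le> tuw" show False using triangle_4[OF tuvw] h204 h225 h220 by linarith
      qed
      have h228: "144 \<le> tuv"
      proof (rule angle_above120[OF guv])
       assume h227: "tuv \<le> 120" show False using pos ru rb ua_a ub_b202 ub_u202 lower120[OF guv h227 pv] lower120[OF guw h226 pw] ab_a196 bv_v bw_w194 by linarith
      qed
      show False using triangle_4[OF tuvw] h228 h214 h220 by linarith
     qed
    qed
   qed
  qed
qed

lemma angle_edge_iff: "angle t g \<Longrightarrow> t \<le> 72 \<longleftrightarrow> 0 < g" and angle_nonedge_iff: "angle t g \<Longrightarrow> 90 \<le> t \<longleftrightarrow> g \<le> 0"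
  using phi_bounds by (auto elim!: angle_cases)

lemma angle_below_144: "angle t g \<Longrightarrow> t < 144 \<Longrightarrow> - 1 \<le> g"
  using phi_bounds by (auto elim!: angle_cases)

lemma angle_exists:
  assumes "g \<in> {0, 1, -1, 2, -2, phi, - phi, phi - 1, 1 - phi}" "g \<noteq> 2" "g \<noteq> - 2"
  shows "\<exists>t. angle t g"
  using assms by (elim insertE; simp add: angle_def ex_disj_distrib)

text \<open>Vectors indexed by a proper subset are linearly independent, since the only relation has no
  zero coefficient.\<close>

lemma partial_combination_positive:
  fixes x :: "'i \<Rightarrow> 'a::euclidean_space"
  assumes I: "finite I" and rel: "only_relation I x c" and c: "\<And>i. i \<in> I \<Longrightarrow> 0 < c i"
    and S: "S \<subset> I" and d: "i \<in> S" "d i \<noteq> 0"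
  shows "0 < (\<Sum>i\<in>S. d i *\<^sub>R x i) \<bullet> (\<Sum>i\<in>S. d i *\<^sub>R x i)"
proof -
  have "(\<Sum>i\<in>S. d i *\<^sub>R x i) \<noteq> 0"
  proof
    assume 0: "(\<Sum>i\<in>S. d i *\<^sub>R x i) = 0"
    obtain k where k: "k \<in> I" "k \<notin> S" using S by auto
    let ?e = "\<lambda>i. if i \<in> S then d i else 0"
    have "(\<Sum>i\<in>I. ?e i *\<^sub>R x i) = (\<Sum>i\<in>S. d i *\<^sub>R x i)"
      using S I by (intro sum.mono_neutral_cong_right) auto
    then have "(\<Sum>i\<in>I. ?e i *\<^sub>R x i) = 0" using 0 by (rule trans)
    then obtain t where t: "\<forall>i\<in>I. ?e i = t * c i"
      using rel[unfolded only_relation_def, THEN conjunct2, THEN spec, of ?e] by (elim impE exE)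
    then have "t = 0" using k c[of k] by auto
    moreover have "?e i = t * c i" using t d S by blast
    ultimately show False using d by simp
  qed
  then show ?thesis by simp
qed

text \<open>Up to the factor \<open>4 - (x \<bullet> y)\<^sup>2\<close>, the claim is positivity of the square length of the component of
  \<open>z\<close> orthogonal to \<open>x\<close> and \<open>y\<close>.\<close>

lemma gram_three_positive:
  fixes x y z :: "'a::euclidean_space"
  assumes ind: "\<And>s t r. s \<noteq> 0 \<or> t \<noteq> 0 \<or> r \<noteq> 0 \<Longrightarrow> 0 < (s *\<^sub>R x + t *\<^sub>R y + r *\<^sub>R z) \<bullet> (s *\<^sub>R x + t *\<^sub>R y + r *\<^sub>R z)"
    and n: "x \<bullet> x = 2" "y \<bullet> y = 2" "z \<bullet> z = 2"
  shows "x \<bullet> y \<noteq> 2" "x \<bullet> y \<noteq> - 2"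
    "4 + (x \<bullet> y) * (x \<bullet> z) * (y \<bullet> z) > (x \<bullet> y) * (x \<bullet> y) + (x \<bullet> z) * (x \<bullet> z) + (y \<bullet> z) * (y \<bullet> z)"
proof -
  define p q r where pqr: "p = x \<bullet> y" "q = x \<bullet> z" "r = y \<bullet> z"
  have s: "y \<bullet> x = p" "z \<bullet> x = q" "z \<bullet> y = r" "x \<bullet> y = p" "x \<bullet> z = q" "y \<bullet> z = r"
    by (simp_all add: pqr inner_commute)
  have p: "- 2 < p" "p < 2"
    using ind[of 1 1 0] ind[of 1 "-1" 0] by (simp_all add: inner_add_left inner_add_right inner_diff_left inner_diff_right n s)
  then show "x \<bullet> y \<noteq> 2" "x \<bullet> y \<noteq> - 2" by (simp_all add: s)
  have D: "0 < 4 - p * p" using mult_pos_pos[of "2 - p" "2 + p"] p by (simp add: algebra_simps)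
  have "0 < (4 - p * p) * (2 * (4 + p * q * r - (p * p + q * q + r * r)))"
    using ind[of "p * r - 2 * q" "p * q - 2 * r" "4 - p * p"] D
    by (simp add: inner_add_left inner_add_right n s algebra_simps)
  then show "4 + (x \<bullet> y) * (x \<bullet> z) * (y \<bullet> z) > (x \<bullet> y) * (x \<bullet> y) + (x \<bullet> z) * (x \<bullet> z) + (y \<bullet> z) * (y \<bullet> z)"
    using D by (simp add: zero_less_mult_iff s)
qed

text \<open>Let \<open>c u\<close> be the largest coefficient. If every vertex not joined to \<open>u\<close> had a common
  neighbour with \<open>u\<close>, its angle with \<open>u\<close> would be less than \<open>2 * 72\<close> degrees, so its product with \<open>u\<close>
  would be at least \<open>-1\<close>. The row of \<open>u\<close> then demands three such vertices; this leaves a single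
  neighbour of \<open>u\<close>, which dominates. So some \<open>v\<close> has no common neighbour with \<open>u\<close>, and
  the estimates for four or five coefficients apply.\<close>

theorem golden_circuit_disconnected:
  fixes x :: "'i \<Rightarrow> 'a::euclidean_space"
  assumes card: "card I = 4 \<or> card I = 5"
    and n: "\<And>i. i \<in> I \<Longrightarrow> x i \<bullet> x i = 2" and c: "\<And>i. i \<in> I \<Longrightarrow> 0 < c i"
    and gold: "\<And>i j. i \<in> I \<Longrightarrow> j \<in> I \<Longrightarrow> x i \<bullet> x j \<in> {0, 1, -1, 2, -2, phi, - phi, phi - 1, 1 - phi}"
    and rel: "only_relation I x c"
  shows "\<not> acute_connected I x"
proof
  assume conn: "acute_connected I x"
  have I: "finite I" "I \<noteq> {}" using card by (auto intro: card_ge_0_finite)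
  have zero: "(\<Sum>i\<in>I. c i *\<^sub>R x i) = 0" using rel by (simp add: only_relation_def)
  define g where "g i j = x i \<bullet> x j" for i j
  have gs: "g i j = g j i" for i j by (simp add: g_def inner_commute)
  have g2: "g i i = 2" if "i \<in> I" for i using n that by (simp add: g_def)
  have row: "(\<Sum>j\<in>I. g i j * c j) = 0" for i
    using arg_cong[OF zero, of "\<lambda>v. x i \<bullet> v"] by (simp add: inner_sum_right g_def mult.commute)
  have pos3: "0 < (s *\<^sub>R x i + t *\<^sub>R x j + r *\<^sub>R x k) \<bullet> (s *\<^sub>R x i + t *\<^sub>R x j + r *\<^sub>R x k)"
    if "i \<in> I" "j \<in> I" "k \<in> I" "distinct [i, j, k]" "s \<noteq> 0 \<or> t \<noteq> 0 \<or> r \<noteq> 0" for i j k s t r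
  proof -
    have "card {i, j, k} = 3" using that by simp
    then have S: "{i, j, k} \<subset> I" using that card by auto
    let ?d = "\<lambda>h. if h = i then s else if h = j then t else r"
    have "distinct [i, j, k]" by fact
    then have d: "i \<noteq> j" "i \<noteq> k" "j \<noteq> k" "j \<noteq> i" "k \<noteq> i" "k \<noteq> j" by auto
    then have "?d i \<noteq> 0 \<or> ?d j \<noteq> 0 \<or> ?d k \<noteq> 0" using that(5) by auto
    then have "\<exists>h\<in>{i, j, k}. ?d h \<noteq> 0" by blast
    then obtain h where "h \<in> {i, j, k}" "?d h \<noteq> 0" by blast
    from partial_combination_positive[where d = ?d, OF I(1) rel c S this] show ?thesis
      using d by (simp add: add.assoc)
  qed
  have pos4: "0 < (s *\<^sub>R x i + t *\<^sub>R x j + r *\<^sub>R x k + q *\<^sub>R x l) \<bullet> (s *\<^sub>R x i + t *\<^sub>R x j + r *\<^sub>R x k + q *\<^sub>R x l)"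
    if "i \<in> I" "j \<in> I" "k \<in> I" "l \<in> I" "distinct [i, j, k, l]" "card I = 5" "s \<noteq> 0" for i j k l s t r q
  proof -
    have "card {i, j, k, l} = 4" using that by simp
    then have S: "{i, j, k, l} \<subset> I" using that by auto
    let ?d = "\<lambda>h. if h = i then s else if h = j then t else if h = k then r else q"
    have d: "i \<noteq> j" "i \<noteq> k" "j \<noteq> k" "j \<noteq> i" "k \<noteq> i" "k \<noteq> j" "l \<noteq> i" "l \<noteq> j" "l \<noteq> k" "i \<noteq> l" "j \<noteq> l" "k \<noteq> l" using that by auto
    have "i \<in> {i, j, k, l}" "?d i \<noteq> 0" using that by auto
    from partial_combination_positive[where d = ?d, OF I(1) rel c S this] show ?thesis
      using d by (simp add: add.assoc)
  qed
  define th where "th i j = (SOME t. angle t (g i j))" for i j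
  have ths: "th i j = th j i" for i j by (simp add: th_def gs)
  have third: "\<exists>k\<in>I. k \<noteq> i \<and> k \<noteq> j" for i j
  proof -
    have "card {i, j} \<le> 2" by (simp add: card_insert_if)
    then have "\<not> I \<subseteq> {i, j}" using card card_mono[of "{i, j}" I] by auto
    then show ?thesis by auto
  qed
  have th: "angle (th i j) (g i j)" if "i \<in> I" "j \<in> I" "i \<noteq> j" for i j
  proof -
    obtain k where k: "k \<in> I" "k \<noteq> i" "k \<noteq> j" using third by blast
    have "g i j \<noteq> 2" "g i j \<noteq> - 2"
      using gram_three_positive[OF pos3[of i j k] n n n] that k by (auto simp: g_def)
    then show ?thesis
      unfolding th_def using someI_ex[OF angle_exists] gold that by (metis g_def)
  qed
  have tri: "triangle (th i j) (th i k) (th j k)" if "i \<in> I" "j \<in> I" "k \<in> I" "distinct [i, j, k]" for i j k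
    using that gram_three_positive(3)[OF pos3[of i j k] n n n]
    by (intro angle_triangle[OF th th th]) (auto simp: g_def)
  have edge: "th i j \<le> 72 \<longleftrightarrow> 0 < g i j" and nonedge: "90 \<le> th i j \<longleftrightarrow> g i j \<le> 0" if "i \<in> I" "j \<in> I" "i \<noteq> j" for i j
    using angle_edge_iff angle_nonedge_iff th that by blast+
  have cut: "\<exists>i\<in>X. \<exists>j\<in>I - X. 0 < g i j" if "X \<subseteq> I" "X \<noteq> {}" "X \<noteq> I" for X
    using conn that by (auto simp: acute_connected_def g_def)
  have nbr: "\<exists>j\<in>I. j \<noteq> i \<and> 0 < g i j" if "i \<in> I" for i
    using cut[of "{i}"] third[of i i] that by blast
  have "Max (c ` I) \<in> c ` I" using I by (intro Max_in) auto
  then obtain u where "u \<in> I" "Max (c ` I) = c u" by auto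
  then have u: "u \<in> I" "\<And>i. i \<in> I \<Longrightarrow> c i \<le> c u" using I by (metis Max_ge finite_imageI imageI)+
  obtain v where v: "v \<in> I" "v \<noteq> u" "g u v \<le> 0"
    and far: "\<And>i. i \<in> I \<Longrightarrow> i \<noteq> u \<Longrightarrow> i \<noteq> v \<Longrightarrow> g u i \<le> 0 \<or> g i v \<le> 0"
  proof (rule ccontr)
    note found = that
    assume no: "\<not> thesis"
    have common: "\<exists>i\<in>I. i \<noteq> u \<and> i \<noteq> v \<and> 0 < g u i \<and> 0 < g i v" if "v \<in> I" "v \<noteq> u" "g u v \<le> 0" for v
      using no found[OF that] by (meson not_le)
    define A where "A = {i \<in> I. i \<noteq> u \<and> 0 < g u i}"
    define N where "N = {i \<in> I. i \<noteq> u \<and> g u i \<le> 0}"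
    have fin: "finite A" "finite N" using I by (simp_all add: A_def N_def)
    have split: "I = insert u (A \<union> N)" "u \<notin> A \<union> N" "A \<inter> N = {}" using u by (auto simp: A_def N_def)
    have "A \<noteq> {}" using nbr[OF u(1)] by (auto simp: A_def)
    have bound: "- 1 \<le> g u v" if "v \<in> N" for v
    proof -
      have v: "v \<in> I" "v \<noteq> u" "g u v \<le> 0" using that by (auto simp: N_def)
      then obtain i where i: "i \<in> I" "i \<noteq> u" "i \<noteq> v" "0 < g u i" "0 < g i v" using common by blast
      have "th u i \<le> 72" "th i v \<le> 72" using edge i u v by auto
      moreover have "th u v < th u i + th i v"
        using triangle_2[OF tri[of u i v]] i u v by auto
      ultimately show ?thesis using angle_below_144[OF th[of u v]] u v by auto
    qed
    have "0 = g u u * c u + ((\<Sum>j\<in>A. g u j * c j) + (\<Sum>j\<in>N. g u j * c j))"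
      using row[of u] fin split by (simp add: sum.union_disjoint)
    moreover have "0 < (\<Sum>j\<in>A. g u j * c j)"
      using fin \<open>A \<noteq> {}\<close> by (intro sum_pos) (auto simp: A_def c)
    moreover have "(\<Sum>j\<in>N. - c u) \<le> (\<Sum>j\<in>N. g u j * c j)"
    proof (intro sum_mono)
      fix j assume j: "j \<in> N"
      then have jI: "j \<in> I" by (simp add: N_def)
      have "- c u \<le> - c j" using u jI by simp
      also have "- c j \<le> g u j * c j" using mult_right_mono[OF bound[OF j], of "c j"] c[OF jI] by simp
      finally show "- c u \<le> g u j * c j" .
    qed
    ultimately have "2 * c u < real (card N) * c u" using g2[OF u(1)] by simp
    then have "2 < card N" using c[OF u(1)] by simp
    moreover have "card I = 1 + (card A + card N)"
      using fin split by (simp add: card_Un_disjoint)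
    moreover have "card A \<noteq> 0" using fin \<open>A \<noteq> {}\<close> by simp
    ultimately have "card A = 1" using card by auto
    then obtain y where y: "A = {y}" by (rule card_1_singletonE)
    then have "y \<in> A" by simp
    then have yI: "y \<in> I" "y \<noteq> u" "0 < g u y" by (simp_all add: A_def)
    have "0 < g y i" if "i \<in> I" for i
    proof (cases "i \<in> N")
      case True
      then have "i \<noteq> u" "g u i \<le> 0" by (simp_all add: N_def)
      from common[OF that this] obtain k where "k \<in> I" "k \<noteq> u" "0 < g u k" and ki: "0 < g k i" by blast
      then have "k \<in> A" by (simp add: A_def)
      then show ?thesis using y ki by simp
    next
      case False
      then have "i = u \<or> i = y" using that split(1) y by auto
      then show ?thesis using yI g2[OF yI(1)] gs[of y u] by auto
    qed
    then show False using no_dominating_vertex[OF I(1) yI(1) c zero] by (simp add: g_def)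
  qed
  obtain a where a: "a \<in> I" "a \<noteq> u" "0 < g u a" using nbr u by blast
  obtain b where b: "b \<in> I" "b \<noteq> v" "0 < g v b" using nbr v by blast
  have bu: "b \<noteq> u"
  proof
    assume "b = u"
    then show False using b(3) v(3) gs[of v u] by simp
  qed
  have av: "a \<noteq> v"
  proof
    assume "a = v"
    then show False using a(3) v(3) by simp
  qed
  have gbv: "0 < g b v" using b(3) gs[of v b] by simp
  have gub: "g u b \<le> 0" using far[OF b(1) bu b(2)] gbv by linarith
  have gav: "g a v \<le> 0" using far[OF a(1,2) av] a(3) by linarith
  have ab: "a \<noteq> b"
  proof
    assume "a = b"
    then show False using gub a(3) by simp
  qed
  have dist: "distinct [u, a, b, v]" using a(2) b(2) v(2) bu av ab by (simp add: eq_commute)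
  show False
  proof (cases "card I = 4")
    case True
    have "card {u, a, b, v} = 4" using dist by simp
    moreover have "{u, a, b, v} \<subseteq> I" using u(1) a(1) b(1) v(1) by simp
    ultimately have "{u, a, b, v} = I" using True I(1) by (intro card_subset_eq) simp_all
    then have I4: "I = {u, a, b, v}" by (rule sym)
    have mem: "u \<in> I" "a \<in> I" "b \<in> I" "v \<in> I" by fact+
    have diff: "{u, a} \<noteq> I" "I - {u, a} = {b, v}" using dist by (auto simp: I4)
    have "0 < g a b"
      using cut[of "{u, a}"] mem diff gub gav v(3) by (simp add: not_le[symmetric])
    have rows: "2 * c u + g u a * c a + g u b * c b + g u v * c v = 0"
      "2 * c b + g u b * c u + g a b * c a + g b v * c v = 0"
      using row[of u] row[of b] dist g2[OF mem(1)] g2[OF mem(3)] gs[of b u] gs[of b a]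
      by (simp_all add: I4 add.assoc add.left_commute)
    show False
      by (rule golden_four[of "c u" "c a" "c b" "c v" "g u a" "g u b" "g u v" "g a b" "g b v"
        "th u a" "th u b" "th u v" "th a b" "th b v", OF
        c c c c u(2) rows th th th th th tri])
        (use mem dist a(3) gbv \<open>0 < g a b\<close> edge in simp_all)
  next
    case False
    then have c5: "card I = 5" using card by simp
    have core: False
      if I5: "I = {u, a, b, v, w}" and d5: "distinct [u, a, b, v, w]"
        and e: "0 < g u a" "0 < g b v" "g u b \<le> 0" "g u v \<le> 0" "g a v \<le> 0"
        and far: "g u w \<le> 0 \<or> g v w \<le> 0"
        and ex: "g v w \<le> 0 \<or> 0 < g b w \<or> 0 < g a b" "g v w \<le> 0 \<or> 0 < g a w \<or> 0 < g b w"
          "g u w \<le> 0 \<or> g b w \<le> 0 \<or> 0 < g a w \<or> 0 < g a b" "g v w \<le> 0 \<or> g a w \<le> 0 \<or> g b w \<le> 0 \<or> 0 < g a b"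
      for a b v w
    proof -
      have mem: "u \<in> I" "a \<in> I" "b \<in> I" "v \<in> I" "w \<in> I" using I5 by auto
      have q: "0 < (s *\<^sub>R x i + t *\<^sub>R x j + r *\<^sub>R x k + q *\<^sub>R x l) \<bullet> (s *\<^sub>R x i + t *\<^sub>R x j + r *\<^sub>R x k + q *\<^sub>R x l)
         \<Longrightarrow> 0 < 2 * (s * s + t * t + r * r + q * q) + 2 * (s * t * g i j + s * r * g i k + s * q * g i l + t * r * g j k + t * q * g j l + r * q * g k l)"
        if "i \<in> I" "j \<in> I" "k \<in> I" "l \<in> I" for i j k l s t r q
        using n[OF that(1)] n[OF that(2)] n[OF that(3)] n[OF that(4)]
        by (simp add: g_def inner_add_left inner_add_right inner_commute algebra_simps)
      note q4 = q[OF _ _ _ _ pos4]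
      have diff: "{w} \<noteq> I" "I - {w} = {u, a, b, v}" "{u, a} \<noteq> I" "I - {u, a} = {b, v, w}"
        "{b, v} \<noteq> I" "I - {b, v} = {u, a, w}" using d5 by (auto simp: I5)
      have conn_w: "0 < g u w \<or> 0 < g a w \<or> 0 < g b w \<or> 0 < g v w"
        using cut[of "{w}"] d5 mem diff(1,2) gs[of w u] gs[of w a] gs[of w b] gs[of w v] by simp
      have conn_ua: "0 < g u w \<or> 0 < g a w \<or> 0 < g a b"
        using cut[of "{u, a}"] d5 mem diff(3,4) e by (simp add: not_le[symmetric]; blast)
      have conn_bv: "0 < g a b \<or> 0 < g b w \<or> 0 < g v w"
        using cut[of "{b, v}"] d5 mem diff(5,6) e gs[of b u] gs[of v u] gs[of b a] gs[of v a] by (simp add: not_le[symmetric]; blast)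
      have rows: "2 * c u + g u a * c a + g u b * c b + g u v * c v + g u w * c w = 0"
        "2 * c a + g u a * c u + g a b * c b + g a v * c v + g a w * c w = 0"
        "2 * c b + g u b * c u + g a b * c a + g b v * c v + g b w * c w = 0"
        "2 * c v + g u v * c u + g a v * c a + g b v * c b + g v w * c w = 0"
        "2 * c w + g u w * c u + g a w * c a + g b w * c b + g v w * c v = 0"
        using row[of u] row[of a] row[of b] row[of v] row[of w] d5 g2[OF mem(1)] g2[OF mem(2)] g2[OF mem(3)] g2[OF mem(4)] g2[OF mem(5)]
          gs[of a u] gs[of b u] gs[of v u] gs[of w u] gs[of b a] gs[of v a] gs[of w a] gs[of v b] gs[of w b] gs[of w v]
        by (simp_all add: I5 add.assoc add.left_commute)
      have ph: "phi * phi = phi + 1" "(phi + 1) * (phi + 1) = 3 * phi + 2" "phi * (phi + 1) = 2 * phi + 1" "(phi + 1) * phi = 2 * phi + 1"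
        using phi_square by (simp_all add: algebra_simps)
      have quabv: "0 < 8 + 2 * (g u a + g u b + g u v + g a b + g a v + g b v)"
        "0 < 4 * phi + 8 + 2 * phi * g u a + 2 * phi * g u b + 2 * (phi + 1) * g u v + 2 * g a b + 2 * phi * g a v + 2 * phi * g b v"
        using q4[of u a b v 1 1 1 1] q4[of u a b v phi 1 1 phi] mem d5 c5 phi_bounds ph by (simp_all add: algebra_simps)
      have qubvw: "0 < 8 + 2 * (g u b + g u v + g u w + g b v + g b w + g v w)"
        "0 < 8 * phi + 10 + 2 * (phi + 1) * g u b + 2 * (2 * phi + 1) * g u v + 2 * (phi + 1) * g u w + 2 * phi * g b v + 2 * g b w + 2 * phi * g v w"
        using q4[of u b v w 1 1 1 1] q4[of u b v w "phi + 1" 1 phi 1] mem d5 c5 phi_bounds ph by (simp_all add: algebra_simps)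
      show False
        by (rule golden_five[of "c u" "c a" "c b" "c v" "c w" "g u a" "g u b" "g u v" "g u w" "g a b" "g a v" "g a w" "g b v" "g b w" "g v w"
              "th u a" "th u b" "th u v" "th u w" "th a b" "th a v" "th a w" "th b v" "th b w" "th v w", OF
              c c c c c u(2) u(2) u(2) u(2) rows th th th th th th th th th th tri tri tri tri tri tri tri tri tri])
          (use mem d5 e far ex conn_w conn_ua conn_bv quabv qubvw edge nonedge in simp_all)
    qed
    have "card {u, a, b, v} = 4" using dist by simp
    moreover have "{u, a, b, v} \<subseteq> I" using u(1) a(1) b(1) v(1) by simp
    ultimately have "card (I - {u, a, b, v}) = 1" using c5 by (simp add: card_Diff_subset)
    then obtain w where w: "I - {u, a, b, v} = {w}" by (rule card_1_singletonE)
    then have wI: "w \<in> I" "w \<notin> {u, a, b, v}" by (metis Diff_iff singletonI)+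
    have I5: "I = {u, a, b, v, w}" using w \<open>{u, a, b, v} \<subseteq> I\<close> by blast
    have d5: "distinct [u, a, b, v, w]" using dist wI(2) by (simp add: eq_commute)
    have sym: "g v b = g b v" "g w b = g b w" "g w v = g v w" using gs by blast+
    have fw: "g u w \<le> 0 \<or> g v w \<le> 0" using far[of w] wI sym by simp
    \<comment> \<open>The last four cases reduce to the first by renaming vertices: \<open>b \<leftrightarrow> v\<close>; \<open>b, v, w\<close> to \<open>v, w, b\<close>
      for a path \<open>u a b v w\<close>; \<open>a \<leftrightarrow> w\<close>; \<open>b \<leftrightarrow> w\<close>.\<close>
    consider (standard) "g v w \<le> 0 \<or> (0 < g b w \<or> 0 < g a b) \<and> (0 < g a w \<or> 0 < g b w) \<and> (g a w \<le> 0 \<or> g b w \<le> 0 \<or> 0 < g a b)"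
        "g u w \<le> 0 \<or> g b w \<le> 0 \<or> 0 < g a w \<or> 0 < g a b"
      | (swap_bv) "0 < g v w" "g b w \<le> 0" "g a b \<le> 0"
      | (rotate) "0 < g v w" "g a w \<le> 0" "g b w \<le> 0"
      | (swap_aw) "0 < g u w" "0 < g b w" "g a w \<le> 0" "g a b \<le> 0"
      | (swap_bw) "0 < g v w" "0 < g a w" "0 < g b w" "g a b \<le> 0" by (meson not_le)
    then show False
    proof cases
      case standard
      then have "g v w \<le> 0 \<or> 0 < g b w \<or> 0 < g a b" "g v w \<le> 0 \<or> 0 < g a w \<or> 0 < g b w"
        "g v w \<le> 0 \<or> g a w \<le> 0 \<or> g b w \<le> 0 \<or> 0 < g a b" by (elim disjE conjE; simp)+
      from core[OF I5 d5 a(3) gbv gub v(3) gav fw this(1,2) standard(2) this(3)] show False .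
    next
      case swap_bv
      have "I = {u, a, v, b, w}" using I5 by (simp add: insert_commute)
      moreover have "distinct [u, a, v, b, w]" using d5 by (simp add: eq_commute)
      ultimately show False by (rule core[of a v b w]) (use swap_bv fw a(3) gbv gub v(3) gav sym in simp_all)
    next
      case rotate
      have "I = {u, a, v, w, b}" using I5 by (simp add: insert_commute)
      moreover have "distinct [u, a, v, w, b]" using d5 by (simp add: eq_commute)
      moreover have "g u w \<le> 0" using fw rotate by simp
      ultimately show False by (intro core[of a v w b]) (use rotate a(3) gbv gub v(3) gav sym in simp_all)
    next
      case swap_aw
      have "I = {u, w, b, v, a}" using I5 by (simp add: insert_commute)
      moreover have "distinct [u, w, b, v, a]" using d5 by (simp add: eq_commute)
      moreover have "g v w \<le> 0" using fw swap_aw by simp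
      ultimately show False by (intro core[of w b v a]) (use swap_aw a(3) gbv gub v(3) gav sym gs[of v a] gs[of w a] gs[of b a] in simp_all)
    next
      case swap_bw
      have "I = {u, a, w, v, b}" using I5 by (simp add: insert_commute)
      moreover have "distinct [u, a, w, v, b]" using d5 by (simp add: eq_commute)
      moreover have "g u w \<le> 0" using fw swap_bw by simp
      ultimately show False by (intro core[of a w v b]) (use swap_bw a(3) gbv gub v(3) gav sym in simp_all)
    qed
  qed
qed

section \<open>Circuits of root systems\<close>

text \<open>If the diagram falls into two orthogonal parts, every root lies in the span of one of them, as
  simple reflections preserve this. Roots in different spans are orthogonal, so a connected
  graph stays in one span, and the other part of the diagram is not reached.\<close>

lemma linked_simple_system:
  fixes a :: "'i \<Rightarrow> 'a::euclidean_space"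
  assumes R: "normalised R" and D: "simple_system R D" and a: "\<And>i. i \<in> I \<Longrightarrow> a i \<in> R"
    and conn: "acute_connected I a" and DI: "D \<subseteq> span (a ` I)"
  shows "linked D"
proof (rule ccontr)
  assume "\<not> linked D"
  then obtain X where X: "X \<subseteq> D" "X \<noteq> {}" "X \<noteq> D" and orth: "\<And>x y. x \<in> X \<Longrightarrow> y \<in> D - X \<Longrightarrow> x \<bullet> y = 0"
    unfolding linked_def by blast
  define Y where "Y = D - X"
  have XY: "p \<bullet> q = 0" if "p \<in> span X" "q \<in> span Y" for p q
  proof -
    have "orthogonal x q" if "x \<in> X" for x
      using orthogonal_to_span[OF \<open>q \<in> span Y\<close>, of x] orth[OF that] by (simp add: Y_def orthogonal_def)
    then have "orthogonal q p" using orthogonal_to_span[OF \<open>p \<in> span X\<close>, of q] by (simp add: orthogonal_commute)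
    then show ?thesis by (simp add: orthogonal_def inner_commute)
  qed
  have side: "p \<in> span X \<or> p \<in> span Y" if "p \<in> R" for p
    using that unfolding roots_in_orbit[OF R D, symmetric]
  proof (induction rule: orbit_of.induct)
    case (base d)
    then show ?case by (cases "d \<in> X") (simp_all add: span_base Y_def)
  next
    case (step d p)
    have d: "d \<in> span X \<or> d \<in> span Y" using step(1) by (cases "d \<in> X") (simp_all add: span_base Y_def)
    show ?case
    proof (cases "d \<bullet> p = 0")
      case True
      then show ?thesis using step.IH by (simp add: rf_def)
    next
      case False
      then have "d \<in> span X \<and> p \<in> span X \<or> d \<in> span Y \<and> p \<in> span Y"
        using d step.IH XY[of d p] XY[of p d] by (auto simp: inner_commute)
      then show ?thesis by (auto simp: rf_def intro!: span_diff span_scale)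
    qed
  qed
  have sq: "d \<bullet> d = 2" if "d \<in> D" for d using R D that by (auto simp: normalised_def simple_system_def)
  define J where "J = {i \<in> I. a i \<in> span X}"
  have "J \<noteq> {}"
  proof
    assume "J = {}"
    then have "a ` I \<subseteq> span Y" using side a by (auto simp: J_def)
    then have DY: "D \<subseteq> span Y" using DI span_minimal[OF _ subspace_span] by blast
    obtain x where x: "x \<in> X" using X(2) by blast
    then have "x \<bullet> x = 0" using XY[of x x] DY X(1) span_base by blast
    then show False using sq x X(1) by force
  qed
  moreover have "J \<noteq> I"
  proof
    assume "J = I"
    then have "a ` I \<subseteq> span X" by (auto simp: J_def)
    then have DX: "D \<subseteq> span X" using DI span_minimal[OF _ subspace_span] by blast
    obtain y where y: "y \<in> Y" using X(1,3) by (auto simp: Y_def)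
    then have "y \<bullet> y = 0" using XY[of y y] DX span_base by (metis Diff_iff Y_def subsetD)
    then show False using sq y by (force simp: Y_def)
  qed
  ultimately obtain i j where ij: "i \<in> J" "j \<in> I - J" "0 < a i \<bullet> a j"
    using conn unfolding acute_connected_def J_def by (metis (no_types, lifting) mem_Collect_eq subsetI)
  then have "a i \<in> span X" "a j \<in> span Y" using side[OF a, of j] by (auto simp: J_def)
  then show False using XY ij(3) by force
qed

text \<open>A connected graph with at most three vertices has a dominating vertex.\<close>

lemma small_circuit_disconnected:
  fixes a :: "'i \<Rightarrow> 'a::euclidean_space"
  assumes I: "finite I" "I \<noteq> {}" "card I \<le> 3" and c: "\<And>i. i \<in> I \<Longrightarrow> 0 < c i"
    and zero: "(\<Sum>i\<in>I. c i *\<^sub>R a i) = 0" and pos: "\<And>i. i \<in> I \<Longrightarrow> 0 < a i \<bullet> a i"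
  shows "\<not> acute_connected I a"
proof
  assume conn: "acute_connected I a"
  have cut: "\<exists>i\<in>X. \<exists>j\<in>I - X. 0 < a i \<bullet> a j" if "X \<subseteq> I" "X \<noteq> {}" "X \<noteq> I" for X
    using conn that by (simp add: acute_connected_def)
  have "\<exists>b\<in>I. \<forall>i\<in>I. 0 < a b \<bullet> a i"
  proof -
    have "card I \<noteq> 0" using I by simp
    then consider "card I = 1" | "card I = 2" | "card I = 3" using I(3) by linarith
    then show ?thesis
    proof cases
      case 1
      then obtain i where "I = {i}" by (rule card_1_singletonE)
      then show ?thesis using pos by simp
    next
      case 2
      then obtain i j where ij: "I = {i, j}" "i \<noteq> j" by (meson card_2_iff)
      then have "{i} \<noteq> I" "I - {i} = {j}" by auto
      then have "0 < a i \<bullet> a j" using cut[of "{i}"] ij by simp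
      then show ?thesis using pos ij by simp
    next
      case 3
      then obtain i j k where ijk: "I = {i, j, k}" "i \<noteq> j" "j \<noteq> k" "i \<noteq> k" by (metis card_3_iff)
      then have "{i} \<noteq> I" "{j} \<noteq> I" "{k} \<noteq> I" "I - {i} = {j, k}" "I - {j} = {i, k}" "I - {k} = {i, j}" by auto
      then have "0 < a i \<bullet> a j \<or> 0 < a i \<bullet> a k" "0 < a i \<bullet> a j \<or> 0 < a j \<bullet> a k" "0 < a i \<bullet> a k \<or> 0 < a j \<bullet> a k"
        using cut[of "{i}"] cut[of "{j}"] cut[of "{k}"] ijk(1) by (simp_all add: inner_commute)
      moreover have "0 < a i \<bullet> a i" "0 < a j \<bullet> a j" "0 < a k \<bullet> a k" using pos ijk(1) by simp_all
      ultimately show ?thesis unfolding ijk(1) by (simp add: inner_commute) blast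
    qed
  qed
  then show False using no_dominating_vertex[OF I(1) _ c zero] by blast
qed

text \<open>The diagram is linked and has at least three vertices as soon as the circuit has four. Its labels
  decide between the crystallographic and the golden case.\<close>

theorem normalised_circuit_disconnected:
  fixes a :: "'i \<Rightarrow> 'a::euclidean_space"
  assumes R: "normalised R" and span: "R \<subseteq> span (a ` I)" and I: "finite I" "I \<noteq> {}"
    and a: "\<And>i. i \<in> I \<Longrightarrow> a i \<in> R" and c: "\<And>i. i \<in> I \<Longrightarrow> 0 < c i" and rel: "only_relation I a c"
  shows "\<not> acute_connected I a"
proof
  assume conn: "acute_connected I a"
  have zero: "(\<Sum>i\<in>I. c i *\<^sub>R a i) = 0" using rel by (simp add: only_relation_def)
  have n: "a i \<bullet> a i = 2" if "i \<in> I" for i using R a[OF that] by (simp add: normalised_def)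
  have c4: "card I \<ge> 4"
    using small_circuit_disconnected[OF I _ c zero] n conn by force
  obtain D where D: "simple_system R D" using simple_system_exists[OF R] by blast
  have DR: "D \<subseteq> R" using D by (simp add: simple_system_def)
  have "cone_of D \<subseteq> span D" by (auto simp: cone_of_def intro!: span_sum intro: span_scale span_base)
  moreover have "p \<in> cone_of D \<or> - p \<in> cone_of D" if "p \<in> R" for p
    using D that by (simp add: simple_system_def)
  ultimately have RD: "R \<subseteq> span D" using span_neg by fastforce
  obtain i0 where i0: "i0 \<in> I" using I(2) by blast
  have "a ` (I - {i0}) \<subseteq> span D" using a RD by blast
  then have "card (a ` (I - {i0})) \<le> card D"
    using independent_span_bound[OF simple_system_finite[OF R D]] only_relation_independent(2)[OF I(1) rel c i0] by blast
  then have cI: "card I \<le> card D + 1"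
    using card_image[OF only_relation_independent(1)[OF I(1) rel c i0]] i0 I(1) by simp
  then have c3: "card D \<ge> 3" using c4 by simp
  have l: "linked D" using linked_simple_system[OF R D a conn] DR span by blast
  show False
  proof (cases "\<exists>p\<in>D. \<exists>q\<in>D. p \<noteq> q \<and> p \<bullet> q = - phi")
    case False
    have "d \<bullet> e = 0 \<or> d \<bullet> e = -1 \<or> d \<bullet> e = - sqrt 2" if "d \<in> D" "e \<in> D" "d \<noteq> e" for d e
      using simple_pair_label[OF R D that] linked_no_heavy_pair[OF R D l c3 that] False that by force
    moreover have "D \<noteq> {}" using c3 by auto
    ultimately obtain h where h: "\<And>d. d \<in> D \<Longrightarrow> h d > (0::real)"
      "\<And>d e. d \<in> D \<Longrightarrow> e \<in> D \<Longrightarrow> h d / h e * (d \<bullet> e) \<in> \<int>"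
      using crystallographic_lengths[OF R D l] by blast
    have "card I \<ge> 2" using c4 by simp
    from scaled_root_system_disconnected[OF R D h I(1) this a c rel] show False using conn by blast
  next
    case True
    then obtain p q where pq: "p \<in> D" "q \<in> D" "p \<noteq> q" "p \<bullet> q = - phi" by blast
    obtain d1 d2 d3 d4 where "D = {d1, d2, d3} \<or> D = {d1, d2, d3, d4}"
      using golden_diagram[OF R D l c3 pq] by metis
    then have "card D \<le> 4" by (elim disjE) (simp_all add: card_insert_if)
    then have "card I = 4 \<or> card I = 5" using cI c4 by linarith
    from golden_circuit_disconnected[OF this n c golden_inner_products[OF R D l c3 pq a a] rel]
    show False using conn by blast
  qed
qed

lemma reflection_normalised:
  "\<alpha> \<noteq> 0 \<Longrightarrow> rf ((sqrt 2 / norm \<alpha>) *\<^sub>R \<alpha>) v = reflection \<alpha> v"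
  by (simp add: rf_def reflection_def inner_commute power2_eq_square field_simps)

lemma normalise_root_system:
  assumes "root_system \<Phi>" and U: "subspace U"
  shows "normalised ((\<lambda>\<alpha>. (sqrt 2 / norm \<alpha>) *\<^sub>R \<alpha>) ` (\<Phi> \<inter> U))" (is "normalised (?n ` _)")
proof -
  have fin: "finite \<Phi>" and nz: "\<And>\<alpha>. \<alpha> \<in> \<Phi> \<Longrightarrow> \<alpha> \<noteq> 0" and closed: "\<And>\<alpha> \<beta>. \<alpha> \<in> \<Phi> \<Longrightarrow> \<beta> \<in> \<Phi> \<Longrightarrow> reflection \<alpha> \<beta> \<in> \<Phi>"
    using assms(1) by (auto simp: root_system_def)
  have norm: "?n \<alpha> \<bullet> ?n \<alpha> = 2" if "\<alpha> \<in> \<Phi>" for \<alpha>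
    using nz[OF that] by (simp add: dot_square_norm power2_eq_square field_simps)
  have "rf (?n \<alpha>) (?n \<beta>) \<in> ?n ` (\<Phi> \<inter> U)" if "\<alpha> \<in> \<Phi> \<inter> U" "\<beta> \<in> \<Phi> \<inter> U" for \<alpha> \<beta>
  proof -
    have r: "rf (?n \<alpha>) v = reflection \<alpha> v" for v using reflection_normalised[of \<alpha>] nz that by simp
    have "reflection \<alpha> \<beta> \<bullet> reflection \<alpha> \<beta> = \<beta> \<bullet> \<beta>"
      using rf_inner[OF norm, of \<alpha> \<beta> \<beta>] that by (simp add: r)
    then have "norm (reflection \<alpha> \<beta>) = norm \<beta>" by (simp add: norm_eq_sqrt_inner)
    then have "rf (?n \<alpha>) (?n \<beta>) = ?n (reflection \<alpha> \<beta>)"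
      by (simp add: rf_scaleR r)
    moreover have "reflection \<alpha> \<beta> \<in> \<Phi> \<inter> U"
      using that closed U unfolding reflection_def by (auto intro!: subspace_diff subspace_scale)
    ultimately show ?thesis by blast
  qed
  then show ?thesis using fin norm by (auto simp: normalised_def)
qed

lemma connected_cut:
  fixes G :: "'v pair_pre_digraph"
  assumes conn: "Digraph_Component.connected (with_proj G)" and sym: "\<And>u v. (u, v) \<in> parcs G \<Longrightarrow> (v, u) \<in> parcs G"
    and X: "X \<subseteq> pverts G" "X \<noteq> {}" "X \<noteq> pverts G"
  shows "\<exists>u\<in>X. \<exists>v\<in>pverts G - X. (u, v) \<in> parcs G"
proof (rule ccontr)
  assume no: "\<not> ?thesis"
  obtain u v where uv: "u \<in> X" "v \<in> pverts G - X" using X by blast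
  have "arcs_ends (with_proj G) = parcs G" by (auto simp: arcs_ends_def arc_to_ends_def with_proj_def)
  moreover have "symcl (parcs G) = parcs G" using sym by (auto simp: symcl_def)
  ultimately have "(u, v) \<in> rtrancl_on (pverts G) (parcs G)"
    using conn uv X(1) unfolding connected_conv by (auto simp: with_proj_def)
  then have "v \<in> X"
    by (induction rule: rtrancl_on_induct) (use uv no in auto)
  then show False using uv by blast
qed

text \<open>Uniqueness of the coefficients is known for nowhere vanishing ones; adding a suitable multiple of
  \<open>c\<close> makes any relation so.\<close>

lemma circuit_only_relation:
  assumes C: "circuit C" "inj_on \<alpha> {1..m}" "C = \<alpha> ` {1..m::nat}"
    and c: "\<forall>i\<in>{1..m}. c i \<noteq> 0" "(\<Sum>i=1..m. c i *\<^sub>R \<alpha> i) = 0"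
  shows "only_relation {1..m} \<alpha> c"
  unfolding only_relation_def
proof (intro conjI allI impI)
  show "(\<Sum>i=1..m. c i *\<^sub>R \<alpha> i) = 0" by fact
  fix d assume d: "(\<Sum>i=1..m. d i *\<^sub>R \<alpha> i) = 0"
  have "finite ((\<lambda>i. - d i / c i) ` {1..m})" by simp
  then obtain k where k: "k \<notin> (\<lambda>i. - d i / c i) ` {1..m}" using ex_new_if_finite infinite_UNIV_char_0 by blast
  have nz: "\<forall>i\<in>{1..m}. d i + k * c i \<noteq> 0"
  proof
    fix i assume i: "i \<in> {1..m}"
    then have "k \<noteq> - d i / c i" using k by blast
    then show "d i + k * c i \<noteq> 0" using c(1) i by (auto simp: field_simps add_eq_0_iff)
  qed
  have "(\<Sum>i=1..m. (d i + k * c i) *\<^sub>R \<alpha> i) = (\<Sum>i=1..m. d i *\<^sub>R \<alpha> i) + k *\<^sub>R (\<Sum>i=1..m. c i *\<^sub>R \<alpha> i)"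
    by (simp add: scaleR_add_left sum.distrib scaleR_sum_right)
  then have "(\<Sum>i=1..m. (d i + k * c i) *\<^sub>R \<alpha> i) = 0" using c(2) d by simp
  then obtain t where "\<forall>i\<in>{1..m}. d i + k * c i = t * c i"
    using circuit_coefficients_unique[OF C c nz] by blast
  then have "\<forall>i\<in>{1..m}. d i = (t - k) * c i" by (auto simp: algebra_simps)
  then show "\<exists>t. \<forall>i\<in>{1..m}. d i = t * c i" by blast
qed

theorem lemma1p2:
  fixes \<Phi> C :: "'a::euclidean_space set"
    and m :: nat
    and \<alpha> :: "nat \<Rightarrow> 'a"
    and c :: "nat \<Rightarrow> real"
  assumes "root_system \<Phi>"
    and "circuit C"
    and "C \<subseteq> \<Phi>"
    and "inj_on \<alpha> {1..m}"
    and "C = \<alpha> ` {1..m}"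
    and "\<forall>i\<in>{1..m}. c i \<noteq> 0"
    and "(\<Sum>i=1..m. c i *\<^sub>R \<alpha> i) = 0"
  shows "\<not> Digraph_Component.connected (with_proj (acuteness_graph m \<alpha> c))"
proof
  let ?G = "acuteness_graph m \<alpha> c"
  assume conn: "Digraph_Component.connected (with_proj ?G)"
  let ?n = "\<lambda>\<alpha>. (sqrt 2 / norm \<alpha>) *\<^sub>R \<alpha>"
  define R where "R = ?n ` (\<Phi> \<inter> span C)"
  define w where "w i = \<bar>c i\<bar> * norm (\<alpha> i) / sqrt 2" for i
  define a where "a i = (c i / w i) *\<^sub>R \<alpha> i" for i
  have R: "normalised R" unfolding R_def using assms(1) by (rule normalise_root_system) simp
  have \<alpha>: "\<alpha> i \<in> \<Phi>" "\<alpha> i \<noteq> 0" "\<alpha> i \<in> span C" "c i \<noteq> 0" if "i \<in> {1..m}" for i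
  proof -
    have "\<alpha> i \<in> C" using that assms(5) by simp
    then show "\<alpha> i \<in> \<Phi>" "\<alpha> i \<in> span C" using assms(3) by (auto intro: span_base)
    then show "\<alpha> i \<noteq> 0" using assms(1) by (auto simp: root_system_def)
    show "c i \<noteq> 0" using that assms(6) by simp
  qed
  have w: "0 < w i" if "i \<in> {1..m}" for i using \<alpha>[OF that] by (simp add: w_def)
  have aR: "a i \<in> R" if "i \<in> {1..m}" for i
  proof -
    have "?n (\<alpha> i) \<in> R" unfolding R_def using \<alpha>[OF that] by blast
    moreover have "a i = ?n (\<alpha> i) \<or> a i = - ?n (\<alpha> i)"
      using \<alpha>[OF that] by (cases "0 < c i") (simp_all add: a_def w_def)
    ultimately show ?thesis using normalised_neg[OF R] by metis
  qed
  have rel\<alpha>: "only_relation {1..m} \<alpha> c" using circuit_only_relation assms by blast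
  have rel: "only_relation {1..m} a w"
    unfolding only_relation_def
  proof (intro conjI allI impI)
    have "w i *\<^sub>R a i = c i *\<^sub>R \<alpha> i" if "i \<in> {1..m}" for i
      using w[OF that] by (simp add: a_def)
    then have "(\<Sum>i=1..m. w i *\<^sub>R a i) = (\<Sum>i=1..m. c i *\<^sub>R \<alpha> i)"
      by (rule sum.cong[OF HOL.refl])
    then show "(\<Sum>i=1..m. w i *\<^sub>R a i) = 0" using assms(7) by simp
    fix d assume "(\<Sum>i=1..m. d i *\<^sub>R a i) = 0"
    then have "(\<Sum>i=1..m. (d i * (c i / w i)) *\<^sub>R \<alpha> i) = 0" by (simp add: a_def)
    then obtain t where t: "\<forall>i\<in>{1..m}. d i * (c i / w i) = t * c i"
      using rel\<alpha>[unfolded only_relation_def, THEN conjunct2, THEN spec, of "\<lambda>i. d i * (c i / w i)"] by blast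
    have "d i = t * w i" if "i \<in> {1..m}" for i
    proof -
      have "d i * (c i / w i) = t * c i" using t that by blast
      then show ?thesis using w[OF that] \<alpha>(4)[OF that] by (simp add: field_simps)
    qed
    then show "\<exists>t. \<forall>i\<in>{1..m}. d i = t * w i" by blast
  qed
  have ne: "{1..m} \<noteq> {}"
    using conn by (simp add: connected_conv with_proj_def acuteness_graph_def)
  have "\<alpha> i \<in> span (a ` {1..m})" if "i \<in> {1..m}" for i
  proof -
    have "\<alpha> i = (w i / c i) *\<^sub>R a i" using w[OF that] \<alpha>(4)[OF that] by (simp add: a_def)
    then show ?thesis using that by (metis imageI span_base span_scale)
  qed
  then have "span C \<subseteq> span (a ` {1..m})" using assms(5) by (intro span_minimal) auto
  then have span: "R \<subseteq> span (a ` {1..m})" by (auto simp: R_def intro!: span_scale)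
  have "\<not> acute_connected {1..m} a"
    using normalised_circuit_disconnected[OF R span _ ne aR w rel] by simp
  moreover have "acute_connected {1..m} a"
    unfolding acute_connected_def
  proof (intro allI impI)
    fix X assume X: "X \<subseteq> {1..m} \<and> X \<noteq> {} \<and> X \<noteq> {1..m}"
    have "\<exists>u\<in>X. \<exists>v\<in>pverts ?G - X. (u, v) \<in> parcs ?G"
      by (rule connected_cut[OF conn]) (use X in \<open>auto simp: acuteness_graph_def inner_commute mult.left_commute\<close>)
    then obtain i j where ij: "i \<in> X" "j \<in> {1..m} - X" "0 < (c i *\<^sub>R \<alpha> i) \<bullet> (c j *\<^sub>R \<alpha> j)"
      by (auto simp: acuteness_graph_def)
    have "a i \<bullet> a j = ((c i *\<^sub>R \<alpha> i) \<bullet> (c j *\<^sub>R \<alpha> j)) / (w i * w j)" by (simp add: a_def)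
    moreover have "0 < w i * w j" using w ij X by auto
    ultimately have "0 < a i \<bullet> a j" using ij(3) by simp
    then show "\<exists>i\<in>X. \<exists>j\<in>{1..m} - X. 0 < a i \<bullet> a j" using ij by blast
  qed
  ultimately show False by blast
qed

end
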